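(* For any monoidal category $\mathcal C$, the functor $\widetilde{\Theta}:Tens(\mathcal{PS},\mathcal C)\to PSYB(\mathcal C)$, $\widetilde{\Theta}(G)=\Theta(G\circ\pi)$, is an equivalence of categories.
   Context: Braid groups: $B_n$ is the braid group on $n$ strands with standard generators $\sigma_1,\dots,\sigma_{n-1}$, $P_n$ the pure braid group, $PS_n:=B_n/[P_n,P_n]$, and $\pi_n:B_n\to PS_n$ the canonical projection. The braid category $\mathcal B$: objects are natural numbers $n\in\mathbb N$ (including $0$); $Hom(m,n)=\emptyset$ if $m\ne n$ and $Hom(n,n)=B_n$, with composition given by multiplication in $B_n$. It is strict monoidal with $m\otimes n=m+n$, unit $0$, and tensor product of morphisms given by juxtaposition of braids $B_m\times B_n\to B_{m+n}$ ($\sigma_i\otimes 1\mapsto\sigma_i$, $1\otimes\sigma_j\mapsto\sigma_{m+j}$). It is braided by $c_{0,n}=id_n=c_{n,0}$ and $c_{n,m}=(\sigma_m\sigma_{m-1}\cdots\sigma_1)(\sigma_{m+1}\sigma_m\cdots\sigma_2)\cdots(\sigma_{m+n-1}\sigma_{m+n-2}\cdots\sigma_n)$ for $m,n>0$; in particular $c_{1,1}=\sigma_1$. The category $\mathcal{PS}$ is defined in the same way with $PS_n$ in place of $B_n$: the monoidal structure is the one induced from $\mathcal B$ and the braiding is the image under $\pi_{n+m}$ of the braiding of $\mathcal B$. The projections $\pi_n$ give a strict monoidal functor $\pi:\mathcal B\to\mathcal{PS}$, the identity on objects. Monoidal functors: a monoidal functor $(F,\varphi_0,\varphi_2)$ has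 natural isomorphisms $\varphi_2(U,V):F(U)\otimes F(V)\to F(U\otimes V)$ and an isomorphism $\varphi_0:I\to F(I)$ satisfying the usual coherence. $Tens(\mathcal A,\mathcal C)$ is the category of monoidal functors $\mathcal A\to\mathcal C$ with natural monoidal transformations as morphisms. Yang-Baxter operators: let $(\mathcal C,\otimes,I,a,l,r)$ be a monoidal category and $V\in\mathcal C$. Write $a=a_{V,V,V}$. A Yang-Baxter operator on $V$ is an automorphism $\sigma$ of $V\otimes V$ such that $$a(\sigma\otimes id_V)a^{-1}(id_V\otimes\sigma)a(\sigma\otimes id_V)=(id_V\otimes\sigma)a(\sigma\otimes id_V)a^{-1}(id_V\otimes\sigma)a.$$ It is a pseudosymmetric Yang-Baxter operator if moreover $$a(\sigma\otimes id_V)a^{-1}(id_V\otimes\sigma^{-1})a(\sigma\otimes id_V)=(id_V\otimes\sigma)a(\sigma^{-1}\otimes id_V)a^{-1}(id_V\otimes\sigma)a.$$ $YB(\mathcal C)$ is the category whose objects are pairs $(V,\sigma)$ with $\sigma$ a Yang-Baxter operator on $V$, and whose morphisms $(V,\sigma)\to(V',\sigma')$ are morphisms $f:V\to V'$ in $\mathcal C$ with $(f\otimes f)\sigma=\sigma'(f\otimes f)$. $PSYB(\mathcal C)$ is the full subcategory of $YB(\mathcal C)$ of pairs $(V,\sigma)$ with $\sigma$ pseudosymmetric. The functor $\Theta:Tens(\mathcal B,\mathcal C)\to YB(\mathcal C)$ sends $(F,\varphi_0,\varphi_2)$ to $\big(F(1),\ \varphi_2(1,1)^{-1}F(c_{1,1})\varphi_2(1,1)\big)$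 and a natural monoidal transformation to its component at the object $1$. For $G\in Tens(\mathcal{PS},\mathcal C)$, $\widetilde\Theta(G)=\Theta(G\circ\pi)$ lies in $PSYB(\mathcal C)$. *)

theory Defs
  imports "HOL-Algebra.Sym_Groups"
begin

section \<open>Categories, functors and natural transformations\<close>

record ('o, 'a) cat =
  Obj :: "'o set"
  Arr :: "'a set"
  Dom :: "'a \<Rightarrow> 'o"
  Cod :: "'a \<Rightarrow> 'o"
  Ide :: "'o \<Rightarrow> 'a"
  Comp :: "'a \<Rightarrow> 'a \<Rightarrow> 'a" (infixr "\<cdot>\<index>" 55)

definition Hom :: "('o, 'a, 'e) cat_scheme \<Rightarrow> 'o \<Rightarrow> 'o \<Rightarrow> 'a set" where
  "Hom C x y = {f \<in> Arr C. Dom C f = x \<and> Cod C f = y}"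

locale category =
  fixes C :: "('o, 'a, 'e) cat_scheme" (structure)
  assumes Dom_Obj: "f \<in> Arr C \<Longrightarrow> Dom C f \<in> Obj C"
    and Cod_Obj: "f \<in> Arr C \<Longrightarrow> Cod C f \<in> Obj C"
    and Ide_Hom: "x \<in> Obj C \<Longrightarrow> Ide C x \<in> Hom C x x"
    and Comp_Hom: "\<lbrakk>f \<in> Hom C x y; g \<in> Hom C y z\<rbrakk> \<Longrightarrow> g \<cdot> f \<in> Hom C x z"
    and Comp_Ide_left: "f \<in> Hom C x y \<Longrightarrow> Ide C y \<cdot> f = f"
    and Comp_Ide_right: "f \<in> Hom C x y \<Longrightarrow> f \<cdot> Ide C x = f"
    and Comp_assoc: "\<lbrakk>f \<in> Hom C w x; g \<in> Hom C x y; h \<in> Hom C y z\<rbrakk>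
                       \<Longrightarrow> (h \<cdot> g) \<cdot> f = h \<cdot> (g \<cdot> f)"

definition inverse_arrows :: "('o, 'a, 'e) cat_scheme \<Rightarrow> 'a \<Rightarrow> 'a \<Rightarrow> bool" where
  "inverse_arrows C f g \<longleftrightarrow> f \<in> Arr C \<and> g \<in> Hom C (Cod C f) (Dom C f)
     \<and> g \<cdot>\<^bsub>C\<^esub> f = Ide C (Dom C f) \<and> f \<cdot>\<^bsub>C\<^esub> g = Ide C (Cod C f)"

definition is_iso :: "('o, 'a, 'e) cat_scheme \<Rightarrow> 'a \<Rightarrow> bool" where
  "is_iso C f \<longleftrightarrow> (\<exists>g. inverse_arrows C f g)"

definition inv_arr :: "('o, 'a, 'e) cat_scheme \<Rightarrow> 'a \<Rightarrow> 'a" where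
  "inv_arr C f = (THE g. inverse_arrows C f g)"

record ('o1, 'a1, 'o2, 'a2) fun_data =
  omap :: "'o1 \<Rightarrow> 'o2"
  amap :: "'a1 \<Rightarrow> 'a2"

text \<open>Functors and natural transformations are kept extensional, i.e. equal to \<^term>\<open>undefined\<close>
  outside the objects and arrows of their source. Hence equality in HOL is the intended equality of
  functors and of natural transformations, which matters for the hom-sets of functor categories.\<close>

locale cat_functor = S: category A + T: category D
  for A :: "('o1, 'a1, 'e1) cat_scheme" and D :: "('o2, 'a2, 'e2) cat_scheme" +
  fixes F :: "('o1, 'a1, 'o2, 'a2, 'e3) fun_data_scheme"
  assumes omap_Obj: "x \<in> Obj A \<Longrightarrow> omap F x \<in> Obj D"
    and amap_Hom: "f \<in> Hom A x y \<Longrightarrow> amap F f \<in> Hom D (omap F x) (omap F y)"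
    and amap_Ide: "x \<in> Obj A \<Longrightarrow> amap F (Ide A x) = Ide D (omap F x)"
    and amap_Comp: "\<lbrakk>f \<in> Hom A x y; g \<in> Hom A y z\<rbrakk>
                      \<Longrightarrow> amap F (g \<cdot>\<^bsub>A\<^esub> f) = amap F g \<cdot>\<^bsub>D\<^esub> amap F f"
    and omap_ext: "omap F \<in> extensional (Obj A)"
    and amap_ext: "amap F \<in> extensional (Arr A)"

definition id_functor :: "('o, 'a, 'e) cat_scheme \<Rightarrow> ('o, 'a, 'o, 'a) fun_data" where
  "id_functor A = \<lparr>omap = (\<lambda>x\<in>Obj A. x), amap = (\<lambda>f\<in>Arr A. f)\<rparr>"

text \<open>\<open>comp_functor A G F\<close> is \<open>G\<close> after \<open>F\<close>, where \<open>A\<close> is the source of \<open>F\<close>.\<close>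

definition comp_functor :: "('o1, 'a1, 'e1) cat_scheme \<Rightarrow> ('o2, 'a2, 'o3, 'a3, 'e2) fun_data_scheme
    \<Rightarrow> ('o1, 'a1, 'o2, 'a2, 'e3) fun_data_scheme \<Rightarrow> ('o1, 'a1, 'o3, 'a3) fun_data" where
  "comp_functor A G F = \<lparr>omap = (\<lambda>x\<in>Obj A. omap G (omap F x)),
                         amap = (\<lambda>f\<in>Arr A. amap G (amap F f))\<rparr>"

definition nat_trans :: "('o1, 'a1, 'e1) cat_scheme \<Rightarrow> ('o2, 'a2, 'e2) cat_scheme
    \<Rightarrow> ('o1, 'a1, 'o2, 'a2, 'e3) fun_data_scheme \<Rightarrow> ('o1, 'a1, 'o2, 'a2, 'e4) fun_data_scheme
    \<Rightarrow> ('o1 \<Rightarrow> 'a2) \<Rightarrow> bool" where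
  "nat_trans A D F G \<tau> \<longleftrightarrow>
     (\<forall>x\<in>Obj A. \<tau> x \<in> Hom D (omap F x) (omap G x))
   \<and> (\<forall>x y. \<forall>f\<in>Hom A x y. \<tau> y \<cdot>\<^bsub>D\<^esub> amap F f = amap G f \<cdot>\<^bsub>D\<^esub> \<tau> x)
   \<and> \<tau> \<in> extensional (Obj A)"

definition naturally_isomorphic :: "('o1, 'a1, 'e1) cat_scheme \<Rightarrow> ('o2, 'a2, 'e2) cat_scheme
    \<Rightarrow> ('o1, 'a1, 'o2, 'a2, 'e3) fun_data_scheme \<Rightarrow> ('o1, 'a1, 'o2, 'a2, 'e4) fun_data_scheme
    \<Rightarrow> bool" where
  "naturally_isomorphic A D F G \<longleftrightarrow>
     (\<exists>\<tau>. nat_trans A D F G \<tau> \<and> (\<forall>x\<in>Obj A. is_iso D (\<tau> x)))"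

definition equivalence_of_categories :: "('o1, 'a1, 'e1) cat_scheme
    \<Rightarrow> ('o2, 'a2, 'e2) cat_scheme \<Rightarrow> ('o1, 'a1, 'o2, 'a2, 'e3) fun_data_scheme \<Rightarrow> bool" where
  "equivalence_of_categories A D F \<longleftrightarrow> cat_functor A D F \<and>
     (\<exists>G :: ('o2, 'a2, 'o1, 'a1) fun_data. cat_functor D A G
        \<and> naturally_isomorphic A A (comp_functor A G F) (id_functor A)
        \<and> naturally_isomorphic D D (comp_functor D F G) (id_functor D))"


section \<open>Monoidal categories and monoidal functors\<close>

record ('o, 'a) moncat = "('o, 'a) cat" +
  tens_obj :: "'o \<Rightarrow> 'o \<Rightarrow> 'o" (infixl "\<boxdot>\<index>" 65)
  tens_arr :: "'a \<Rightarrow> 'a \<Rightarrow> 'a" (infixl "\<boxtimes>\<index>" 65)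
  unit_obj :: 'o
  assoc :: "'o \<Rightarrow> 'o \<Rightarrow> 'o \<Rightarrow> 'a"
  lunit :: "'o \<Rightarrow> 'a"
  runit :: "'o \<Rightarrow> 'a"

locale monoidal_category = category C
  for C :: "('o, 'a, 'e) moncat_scheme" (structure) +
  assumes tens_Obj: "\<lbrakk>x \<in> Obj C; y \<in> Obj C\<rbrakk> \<Longrightarrow> x \<boxdot> y \<in> Obj C"
    and tens_Hom: "\<lbrakk>f \<in> Hom C x y; f' \<in> Hom C x' y'\<rbrakk> \<Longrightarrow> f \<boxtimes> f' \<in> Hom C (x \<boxdot> x') (y \<boxdot> y')"
    and tens_Ide: "\<lbrakk>x \<in> Obj C; y \<in> Obj C\<rbrakk> \<Longrightarrow> Ide C x \<boxtimes> Ide C y = Ide C (x \<boxdot> y)"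
    and tens_Comp: "\<lbrakk>f \<in> Hom C x y; g \<in> Hom C y z; f' \<in> Hom C x' y'; g' \<in> Hom C y' z'\<rbrakk>
                      \<Longrightarrow> (g \<cdot> f) \<boxtimes> (g' \<cdot> f') = (g \<boxtimes> g') \<cdot> (f \<boxtimes> f')"
    and unit_Obj: "unit_obj C \<in> Obj C"
    and assoc_Hom: "\<lbrakk>x \<in> Obj C; y \<in> Obj C; z \<in> Obj C\<rbrakk>
                      \<Longrightarrow> assoc C x y z \<in> Hom C ((x \<boxdot> y) \<boxdot> z) (x \<boxdot> (y \<boxdot> z))"
    and assoc_iso: "\<lbrakk>x \<in> Obj C; y \<in> Obj C; z \<in> Obj C\<rbrakk> \<Longrightarrow> is_iso C (assoc C x y z)"
    and assoc_natural: "\<lbrakk>f \<in> Hom C x x'; g \<in> Hom C y y'; h \<in> Hom C z z'\<rbrakk>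
                      \<Longrightarrow> assoc C x' y' z' \<cdot> ((f \<boxtimes> g) \<boxtimes> h) = (f \<boxtimes> (g \<boxtimes> h)) \<cdot> assoc C x y z"
    and lunit_Hom: "x \<in> Obj C \<Longrightarrow> lunit C x \<in> Hom C (unit_obj C \<boxdot> x) x"
    and lunit_iso: "x \<in> Obj C \<Longrightarrow> is_iso C (lunit C x)"
    and lunit_natural: "f \<in> Hom C x y \<Longrightarrow> lunit C y \<cdot> (Ide C (unit_obj C) \<boxtimes> f) = f \<cdot> lunit C x"
    and runit_Hom: "x \<in> Obj C \<Longrightarrow> runit C x \<in> Hom C (x \<boxdot> unit_obj C) x"
    and runit_iso: "x \<in> Obj C \<Longrightarrow> is_iso C (runit C x)"
    and runit_natural: "f \<in> Hom C x y \<Longrightarrow> runit C y \<cdot> (f \<boxtimes> Ide C (unit_obj C)) = f \<cdot> runit C x"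
    and pentagon: "\<lbrakk>w \<in> Obj C; x \<in> Obj C; y \<in> Obj C; z \<in> Obj C\<rbrakk> \<Longrightarrow>
          (Ide C w \<boxtimes> assoc C x y z) \<cdot> assoc C w (x \<boxdot> y) z \<cdot> (assoc C w x y \<boxtimes> Ide C z)
          = assoc C w x (y \<boxdot> z) \<cdot> assoc C (w \<boxdot> x) y z"
    and triangle: "\<lbrakk>x \<in> Obj C; y \<in> Obj C\<rbrakk> \<Longrightarrow>
          (Ide C x \<boxtimes> lunit C y) \<cdot> assoc C x (unit_obj C) y = runit C x \<boxtimes> Ide C y"

record ('o1, 'a1, 'o2, 'a2) monfun_data = "('o1, 'a1, 'o2, 'a2) fun_data" +
  phi0 :: 'a2
  phi2 :: "'o1 \<times> 'o1 \<Rightarrow> 'a2"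

locale monoidal_functor = cat_functor A C F + A: monoidal_category A + C: monoidal_category C
  for A :: "('o1, 'a1, 'e1) moncat_scheme" and C :: "('o2, 'a2, 'e2) moncat_scheme"
    and F :: "('o1, 'a1, 'o2, 'a2, 'e3) monfun_data_scheme" +
  assumes phi0_Hom: "phi0 F \<in> Hom C (unit_obj C) (omap F (unit_obj A))"
    and phi0_iso: "is_iso C (phi0 F)"
    and phi2_Hom: "\<lbrakk>x \<in> Obj A; y \<in> Obj A\<rbrakk> \<Longrightarrow>
          phi2 F (x, y) \<in> Hom C (omap F x \<boxdot>\<^bsub>C\<^esub> omap F y) (omap F (x \<boxdot>\<^bsub>A\<^esub> y))"
    and phi2_iso: "\<lbrakk>x \<in> Obj A; y \<in> Obj A\<rbrakk> \<Longrightarrow> is_iso C (phi2 F (x, y))"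
    and phi2_natural: "\<lbrakk>f \<in> Hom A x x'; g \<in> Hom A y y'\<rbrakk> \<Longrightarrow>
          phi2 F (x', y') \<cdot>\<^bsub>C\<^esub> (amap F f \<boxtimes>\<^bsub>C\<^esub> amap F g)
          = amap F (f \<boxtimes>\<^bsub>A\<^esub> g) \<cdot>\<^bsub>C\<^esub> phi2 F (x, y)"
    and phi2_assoc: "\<lbrakk>x \<in> Obj A; y \<in> Obj A; z \<in> Obj A\<rbrakk> \<Longrightarrow>
          phi2 F (x, y \<boxdot>\<^bsub>A\<^esub> z) \<cdot>\<^bsub>C\<^esub> (Ide C (omap F x) \<boxtimes>\<^bsub>C\<^esub> phi2 F (y, z))
            \<cdot>\<^bsub>C\<^esub> assoc C (omap F x) (omap F y) (omap F z)
          = amap F (assoc A x y z) \<cdot>\<^bsub>C\<^esub> phi2 F (x \<boxdot>\<^bsub>A\<^esub> y, z)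
            \<cdot>\<^bsub>C\<^esub> (phi2 F (x, y) \<boxtimes>\<^bsub>C\<^esub> Ide C (omap F z))"
    and phi2_lunit: "x \<in> Obj A \<Longrightarrow> lunit C (omap F x)
          = amap F (lunit A x) \<cdot>\<^bsub>C\<^esub> phi2 F (unit_obj A, x) \<cdot>\<^bsub>C\<^esub> (phi0 F \<boxtimes>\<^bsub>C\<^esub> Ide C (omap F x))"
    and phi2_runit: "x \<in> Obj A \<Longrightarrow> runit C (omap F x)
          = amap F (runit A x) \<cdot>\<^bsub>C\<^esub> phi2 F (x, unit_obj A) \<cdot>\<^bsub>C\<^esub> (Ide C (omap F x) \<boxtimes>\<^bsub>C\<^esub> phi0 F)"
    and phi2_ext: "phi2 F \<in> extensional (Obj A \<times> Obj A)"

definition monoidal_nat_trans :: "('o1, 'a1, 'e1) moncat_scheme \<Rightarrow> ('o2, 'a2, 'e2) moncat_scheme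
    \<Rightarrow> ('o1, 'a1, 'o2, 'a2) monfun_data \<Rightarrow> ('o1, 'a1, 'o2, 'a2) monfun_data
    \<Rightarrow> ('o1 \<Rightarrow> 'a2) \<Rightarrow> bool" where
  "monoidal_nat_trans A C F G \<tau> \<longleftrightarrow> nat_trans A C F G \<tau>
   \<and> \<tau> (unit_obj A) \<cdot>\<^bsub>C\<^esub> phi0 F = phi0 G
   \<and> (\<forall>x\<in>Obj A. \<forall>y\<in>Obj A.
        \<tau> (x \<boxdot>\<^bsub>A\<^esub> y) \<cdot>\<^bsub>C\<^esub> phi2 F (x, y) = phi2 G (x, y) \<cdot>\<^bsub>C\<^esub> (\<tau> x \<boxtimes>\<^bsub>C\<^esub> \<tau> y))"

type_synonym ('o1, 'a1, 'o2, 'a2) tens_arrow =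
  "('o1, 'a1, 'o2, 'a2) monfun_data \<times> ('o1 \<Rightarrow> 'a2) \<times> ('o1, 'a1, 'o2, 'a2) monfun_data"

text \<open>An arrow \<open>F \<rightarrow> G\<close> is a triple \<open>(F, \<tau>, G)\<close>, so that it determines its source and target.\<close>

definition Tens :: "('o1, 'a1, 'e1) moncat_scheme \<Rightarrow> ('o2, 'a2, 'e2) moncat_scheme
    \<Rightarrow> (('o1, 'a1, 'o2, 'a2) monfun_data, ('o1, 'a1, 'o2, 'a2) tens_arrow) cat" where
  "Tens A C = \<lparr>
     Obj = {F. monoidal_functor A C F},
     Arr = {(F, \<tau>, G). monoidal_functor A C F \<and> monoidal_functor A C G
                        \<and> monoidal_nat_trans A C F G \<tau>},
     Dom = (\<lambda>(F, \<tau>, G). F),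
     Cod = (\<lambda>(F, \<tau>, G). G),
     Ide = (\<lambda>F. (F, (\<lambda>x\<in>Obj A. Ide C (omap F x)), F)),
     Comp = (\<lambda>(G, \<upsilon>, H) (F, \<tau>, G'). (F, (\<lambda>x\<in>Obj A. \<upsilon> x \<cdot>\<^bsub>C\<^esub> \<tau> x), H))\<rparr>"

text \<open>\<open>comp_monfun A C G F\<close> is \<open>G\<close> after \<open>F\<close>, where \<open>A\<close> is the source of \<open>F\<close> and \<open>C\<close> the target
  of \<open>G\<close>.\<close>

definition comp_monfun :: "('o1, 'a1, 'e1) moncat_scheme \<Rightarrow> ('o3, 'a3, 'e3) moncat_scheme
    \<Rightarrow> ('o2, 'a2, 'o3, 'a3) monfun_data \<Rightarrow> ('o1, 'a1, 'o2, 'a2) monfun_data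
    \<Rightarrow> ('o1, 'a1, 'o3, 'a3) monfun_data" where
  "comp_monfun A C G F = \<lparr>
     omap = (\<lambda>x\<in>Obj A. omap G (omap F x)),
     amap = (\<lambda>f\<in>Arr A. amap G (amap F f)),
     phi0 = amap G (phi0 F) \<cdot>\<^bsub>C\<^esub> phi0 G,
     phi2 = (\<lambda>(x, y)\<in>Obj A \<times> Obj A. amap G (phi2 F (x, y)) \<cdot>\<^bsub>C\<^esub> phi2 G (omap F x, omap F y))\<rparr>"

text \<open>Precomposition with a monoidal functor \<open>P\<close> from \<open>A\<close> to \<open>B\<close>, as a functor from
  \<open>Tens B C\<close> to \<open>Tens A C\<close>.\<close>

definition precomp_functor :: "('o1, 'a1, 'e1) moncat_scheme \<Rightarrow> ('o2, 'a2, 'e2) moncat_scheme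
    \<Rightarrow> ('o3, 'a3, 'e3) moncat_scheme \<Rightarrow> ('o1, 'a1, 'o2, 'a2) monfun_data
    \<Rightarrow> (('o2, 'a2, 'o3, 'a3) monfun_data, ('o2, 'a2, 'o3, 'a3) tens_arrow,
        ('o1, 'a1, 'o3, 'a3) monfun_data, ('o1, 'a1, 'o3, 'a3) tens_arrow) fun_data" where
  "precomp_functor A B C P = \<lparr>
     omap = (\<lambda>G\<in>Obj (Tens B C). comp_monfun A C G P),
     amap = (\<lambda>(G, \<tau>, G')\<in>Arr (Tens B C).
               (comp_monfun A C G P, (\<lambda>x\<in>Obj A. \<tau> (omap P x)), comp_monfun A C G' P))\<rparr>"


section \<open>Yang-Baxter operators\<close>

definition yang_baxter :: "('o, 'a, 'e) moncat_scheme \<Rightarrow> 'o \<Rightarrow> 'a \<Rightarrow> bool" where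
  "yang_baxter C V \<sigma> \<longleftrightarrow>
     \<sigma> \<in> Hom C (V \<boxdot>\<^bsub>C\<^esub> V) (V \<boxdot>\<^bsub>C\<^esub> V) \<and> is_iso C \<sigma> \<and>
     (let a = assoc C V V V; a' = inv_arr C a; i = Ide C V in
        a \<cdot>\<^bsub>C\<^esub> (\<sigma> \<boxtimes>\<^bsub>C\<^esub> i) \<cdot>\<^bsub>C\<^esub> a' \<cdot>\<^bsub>C\<^esub> (i \<boxtimes>\<^bsub>C\<^esub> \<sigma>) \<cdot>\<^bsub>C\<^esub> a \<cdot>\<^bsub>C\<^esub> (\<sigma> \<boxtimes>\<^bsub>C\<^esub> i)
        = (i \<boxtimes>\<^bsub>C\<^esub> \<sigma>) \<cdot>\<^bsub>C\<^esub> a \<cdot>\<^bsub>C\<^esub> (\<sigma> \<boxtimes>\<^bsub>C\<^esub> i) \<cdot>\<^bsub>C\<^esub> a' \<cdot>\<^bsub>C\<^esub> (i \<boxtimes>\<^bsub>C\<^esub> \<sigma>) \<cdot>\<^bsub>C\<^esub> a)"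

definition pseudosymmetric_yang_baxter :: "('o, 'a, 'e) moncat_scheme \<Rightarrow> 'o \<Rightarrow> 'a \<Rightarrow> bool" where
  "pseudosymmetric_yang_baxter C V \<sigma> \<longleftrightarrow> yang_baxter C V \<sigma> \<and>
     (let a = assoc C V V V; a' = inv_arr C a; i = Ide C V; \<sigma>' = inv_arr C \<sigma> in
        a \<cdot>\<^bsub>C\<^esub> (\<sigma> \<boxtimes>\<^bsub>C\<^esub> i) \<cdot>\<^bsub>C\<^esub> a' \<cdot>\<^bsub>C\<^esub> (i \<boxtimes>\<^bsub>C\<^esub> \<sigma>') \<cdot>\<^bsub>C\<^esub> a \<cdot>\<^bsub>C\<^esub> (\<sigma> \<boxtimes>\<^bsub>C\<^esub> i)
        = (i \<boxtimes>\<^bsub>C\<^esub> \<sigma>) \<cdot>\<^bsub>C\<^esub> a \<cdot>\<^bsub>C\<^esub> (\<sigma>' \<boxtimes>\<^bsub>C\<^esub> i) \<cdot>\<^bsub>C\<^esub> a' \<cdot>\<^bsub>C\<^esub> (i \<boxtimes>\<^bsub>C\<^esub> \<sigma>) \<cdot>\<^bsub>C\<^esub> a)"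

type_synonym ('o, 'a) yb_arrow = "('o \<times> 'a) \<times> 'a \<times> ('o \<times> 'a)"

definition YB :: "('o, 'a, 'e) moncat_scheme \<Rightarrow> ('o \<times> 'a, ('o, 'a) yb_arrow) cat" where
  "YB C = \<lparr>
     Obj = {(V, \<sigma>). V \<in> Obj C \<and> yang_baxter C V \<sigma>},
     Arr = {((V, \<sigma>), f, (V', \<sigma>')).
              V \<in> Obj C \<and> yang_baxter C V \<sigma> \<and> V' \<in> Obj C \<and> yang_baxter C V' \<sigma>'
              \<and> f \<in> Hom C V V' \<and> (f \<boxtimes>\<^bsub>C\<^esub> f) \<cdot>\<^bsub>C\<^esub> \<sigma> = \<sigma>' \<cdot>\<^bsub>C\<^esub> (f \<boxtimes>\<^bsub>C\<^esub> f)},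
     Dom = (\<lambda>(X, f, Y). X),
     Cod = (\<lambda>(X, f, Y). Y),
     Ide = (\<lambda>(V, \<sigma>). ((V, \<sigma>), Ide C V, (V, \<sigma>))),
     Comp = (\<lambda>(Y, g, Z) (X, f, Y'). (X, g \<cdot>\<^bsub>C\<^esub> f, Z))\<rparr>"

definition full_subcategory :: "('o, 'a) cat \<Rightarrow> 'o set \<Rightarrow> ('o, 'a) cat" where
  "full_subcategory C S =
     C\<lparr>Obj := Obj C \<inter> S, Arr := {f \<in> Arr C. Dom C f \<in> S \<and> Cod C f \<in> S}\<rparr>"

definition PSYB :: "('o, 'a, 'e) moncat_scheme \<Rightarrow> ('o \<times> 'a, ('o, 'a) yb_arrow) cat" where
  "PSYB C = full_subcategory (YB C) {(V, \<sigma>). pseudosymmetric_yang_baxter C V \<sigma>}"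


section \<open>Braid groups\<close>

text \<open>A letter \<open>(i, True)\<close> stands for the generator \<open>\<sigma>\<^sub>i\<close> and \<open>(i, False)\<close> for its inverse.
  The braid group on \<open>n\<close> strands is given by Artin's presentation, with generators indexed by
  \<open>1 \<le> i < n\<close>.\<close>

type_synonym braid_word = "(nat \<times> bool) list"

definition braid_words :: "nat \<Rightarrow> braid_word set" where
  "braid_words n = lists ({1..<n} \<times> UNIV)"

inductive braid_eq :: "nat \<Rightarrow> braid_word \<Rightarrow> braid_word \<Rightarrow> bool" for n where
  refl: "w \<in> braid_words n \<Longrightarrow> braid_eq n w w"
| sym: "braid_eq n u v \<Longrightarrow> braid_eq n v u"
| trans: "\<lbrakk>braid_eq n u v; braid_eq n v w\<rbrakk> \<Longrightarrow> braid_eq n u w"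
| append: "\<lbrakk>braid_eq n u u'; braid_eq n v v'\<rbrakk> \<Longrightarrow> braid_eq n (u @ v) (u' @ v')"
| cancel: "i \<in> {1..<n} \<Longrightarrow> braid_eq n [(i, b), (i, \<not> b)] []"
| far: "\<lbrakk>i \<in> {1..<n}; j \<in> {1..<n}; i + 2 \<le> j\<rbrakk>
          \<Longrightarrow> braid_eq n [(i, True), (j, True)] [(j, True), (i, True)]"
| braid: "\<lbrakk>i \<in> {1..<n}; i + 1 \<in> {1..<n}\<rbrakk>
          \<Longrightarrow> braid_eq n [(i, True), (i + 1, True), (i, True)]
                         [(i + 1, True), (i, True), (i + 1, True)]"

definition braid_rel :: "nat \<Rightarrow> (braid_word \<times> braid_word) set" where
  "braid_rel n = {(u, v). braid_eq n u v}"

definition braid_class :: "nat \<Rightarrow> braid_word \<Rightarrow> braid_word set" where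
  "braid_class n w = braid_rel n `` {w}"

definition braid_group :: "nat \<Rightarrow> braid_word set monoid" where
  "braid_group n = \<lparr>
     carrier = braid_words n // braid_rel n,
     mult = (\<lambda>x y. \<Union>u\<in>x. \<Union>v\<in>y. braid_class n (u @ v)),
     one = braid_class n []\<rparr>"

definition word_perm :: "braid_word \<Rightarrow> nat \<Rightarrow> nat" where
  "word_perm w = foldr (\<lambda>(i, b) p. Transposition.transpose i (Suc i) \<circ> p) w id"

definition braid_perm :: "braid_word set \<Rightarrow> nat \<Rightarrow> nat" where
  "braid_perm x = the_elem (word_perm ` x)"

definition pure_braid_group :: "nat \<Rightarrow> braid_word set set" where
  "pure_braid_group n = kernel (braid_group n) (sym_group n) braid_perm"

definition pure_commutator :: "nat \<Rightarrow> braid_word set set" where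
  "pure_commutator n = derived (braid_group n) (pure_braid_group n)"

definition PS_group :: "nat \<Rightarrow> braid_word set set monoid" where
  "PS_group n = braid_group n Mod pure_commutator n"

definition PS_class :: "nat \<Rightarrow> braid_word set \<Rightarrow> braid_word set set" where
  "PS_class n x = pure_commutator n #>\<^bsub>braid_group n\<^esub> x"


section \<open>The categories \<open>\<B>\<close> and \<open>\<P>\<S>\<close>\<close>

definition shift_word :: "nat \<Rightarrow> braid_word \<Rightarrow> braid_word" where
  "shift_word m = map (map_prod ((+) m) id)"

definition juxtapose :: "nat \<Rightarrow> nat \<Rightarrow> braid_word set \<Rightarrow> braid_word set \<Rightarrow> braid_word set" where
  "juxtapose m n x y = (\<Union>u\<in>x. \<Union>v\<in>y. braid_class (m + n) (u @ shift_word m v))"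

definition PS_juxtapose ::
    "nat \<Rightarrow> nat \<Rightarrow> braid_word set set \<Rightarrow> braid_word set set \<Rightarrow> braid_word set set" where
  "PS_juxtapose m n X Y = (\<Union>x\<in>X. \<Union>y\<in>Y. PS_class (m + n) (juxtapose m n x y))"

text \<open>An arrow \<open>n \<rightarrow> n\<close> is a pair of \<open>n\<close> and a group element, so that hom-sets are disjoint. The
  composite \<open>g\<close> after \<open>f\<close> is the product \<open>g f\<close>; with this order the braiding defined below is
  natural.\<close>

definition strict_nat_moncat :: "(nat \<Rightarrow> ('g, 'e) monoid_scheme)
    \<Rightarrow> (nat \<Rightarrow> nat \<Rightarrow> 'g \<Rightarrow> 'g \<Rightarrow> 'g) \<Rightarrow> (nat, nat \<times> 'g) moncat" where
  "strict_nat_moncat G J = \<lparr>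
     Obj = UNIV,
     Arr = (SIGMA n:UNIV. carrier (G n)),
     Dom = fst,
     Cod = fst,
     Ide = (\<lambda>n. (n, \<one>\<^bsub>G n\<^esub>)),
     Comp = (\<lambda>(n, x) (m, y). (n, x \<otimes>\<^bsub>G n\<^esub> y)),
     tens_obj = (+),
     tens_arr = (\<lambda>(m, x) (n, y). (m + n, J m n x y)),
     unit_obj = 0,
     assoc = (\<lambda>m n k. (m + n + k, \<one>\<^bsub>G (m + n + k)\<^esub>)),
     lunit = (\<lambda>n. (n, \<one>\<^bsub>G n\<^esub>)),
     runit = (\<lambda>n. (n, \<one>\<^bsub>G n\<^esub>))\<rparr>"

definition braid_cat :: "(nat, nat \<times> braid_word set) moncat" where
  "braid_cat = strict_nat_moncat braid_group juxtapose"

definition PS_cat :: "(nat, nat \<times> braid_word set set) moncat" where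
  "PS_cat = strict_nat_moncat PS_group PS_juxtapose"

text \<open>The braiding \<open>c\<^sub>n\<^sub>,\<^sub>m\<close> is the product over \<open>j = 1, \<dots>, n\<close>, from left to right, of
  \<open>\<sigma>\<^bsub>m+j-1\<^esub> \<sigma>\<^bsub>m+j-2\<^esub> \<cdots> \<sigma>\<^sub>j\<close>; it is the identity if \<open>n = 0\<close> or \<open>m = 0\<close>.\<close>

definition braiding_word :: "nat \<Rightarrow> nat \<Rightarrow> braid_word" where
  "braiding_word n m = concat (map (\<lambda>j. map (\<lambda>i. (i, True)) (rev [j..<j + m])) [1..<n + 1])"

definition braiding :: "nat \<Rightarrow> nat \<Rightarrow> nat \<times> braid_word set" where
  "braiding n m = (n + m, braid_class (n + m) (braiding_word n m))"

definition proj :: "(nat, nat \<times> braid_word set, nat, nat \<times> braid_word set set) monfun_data" where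
  "proj = \<lparr>
     omap = (\<lambda>n. n),
     amap = (\<lambda>(n, x)\<in>Arr braid_cat. (n, PS_class n x)),
     phi0 = Ide PS_cat 0,
     phi2 = (\<lambda>(m, n). Ide PS_cat (m + n))\<rparr>"


section \<open>The functors \<open>\<Theta>\<close> and \<open>\<Theta>\<close>-tilde\<close>

type_synonym ('g, 'o, 'a) tens_nat_fun =
  "((nat, nat \<times> 'g, 'o, 'a) monfun_data, (nat, nat \<times> 'g, 'o, 'a) tens_arrow,
    'o \<times> 'a, ('o, 'a) yb_arrow) fun_data"

definition Theta_obj :: "('o, 'a, 'e) moncat_scheme
    \<Rightarrow> (nat, nat \<times> braid_word set, 'o, 'a) monfun_data \<Rightarrow> 'o \<times> 'a" where
  "Theta_obj C F =
     (omap F 1, inv_arr C (phi2 F (1, 1)) \<cdot>\<^bsub>C\<^esub> amap F (braiding 1 1) \<cdot>\<^bsub>C\<^esub> phi2 F (1, 1))"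

definition Theta :: "('o, 'a, 'e) moncat_scheme \<Rightarrow> (braid_word set, 'o, 'a) tens_nat_fun" where
  "Theta C = \<lparr>
     omap = (\<lambda>F\<in>Obj (Tens braid_cat C). Theta_obj C F),
     amap = (\<lambda>(F, \<tau>, G)\<in>Arr (Tens braid_cat C). (Theta_obj C F, \<tau> 1, Theta_obj C G))\<rparr>"

definition Theta_tilde :: "('o, 'a, 'e) moncat_scheme
    \<Rightarrow> (braid_word set set, 'o, 'a) tens_nat_fun" where
  "Theta_tilde C = comp_functor (Tens PS_cat C) (Theta C) (precomp_functor braid_cat PS_cat C proj)"

end

theory Submission
  imports Defs
begin

text \<open>A strand of a braid behaves like a tensor factor, and every arrow of \<open>\<P>\<S>\<close> is obtained from
identities and the crossing \<open>c\<^bsub>1,1\<^esub>\<close> by tensor products, composites and inverses. A monoidal functor \<open>F\<close>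
on \<open>\<P>\<S>\<close> is therefore governed by the object \<open>F(1)\<close> and the operator that \<open>c\<^bsub>1,1\<^esub>\<close> induces on
\<open>F(1) \<otimes> F(1)\<close>, which is what \<open>\<Theta>\<close>-tilde records. The equivalence is proved in the form: \<open>\<Theta>\<close>-tilde is
faithful, full and essentially surjective.

\<^bold>\<open>Faithful and full.\<close> A monoidal transformation \<open>F \<rightarrow> G\<close> is forced on \<open>0\<close> by the unit constraints and on
\<open>n + 1 = 1 + n\<close> by its values on \<open>1\<close> and \<open>n\<close>. Conversely this recursion turns a morphism \<open>f: F(1) \<rightarrow> G(1)\<close>
into a family of arrows; it is monoidal by induction on the first factor, and natural because naturality
passes to tensor products and composites and holds for a single crossing by the compatibility of \<open>f\<close>
with the operators (\<open>extension_tens\<close>, \<open>natural_at_word\<close>).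

\<^bold>\<open>Essentially surjective.\<close> Given a pseudosymmetric operator \<open>\<sigma>\<close> on \<open>V\<close>, the braid group \<open>B\<^sub>n\<close> acts on
the tensor power \<open>V\<^sup>n\<close>, the generator \<open>\<sigma>\<^sub>i\<close> acting by \<open>\<sigma>\<close> on the factors \<open>i\<close> and \<open>i + 1\<close>. Two points need
an argument: that the actions and the associativity constraints \<open>V\<^sup>m \<otimes> V\<^sup>n \<rightarrow> V\<^bsup>m+n\<^esup>\<close> satisfy the axioms
of a monoidal functor in the absence of strictness, and that the action factors through \<open>PS\<^sub>n\<close>.

\<^bold>\<open>The group theory.\<close> The second point amounts to a presentation of \<open>PS\<^sub>n = B\<^sub>n / [P\<^sub>n, P\<^sub>n]\<close>: it is \<open>B\<^sub>n\<close>
modulo the relations \<open>\<sigma>\<^sub>i \<sigma>\<^bsub>i+1\<^esub>\<^sup>-\<^sup>1 \<sigma>\<^sub>i = \<sigma>\<^bsub>i+1\<^esub> \<sigma>\<^sub>i\<^sup>-\<^sup>1 \<sigma>\<^bsub>i+1\<^esub>\<close> (\<open>PS_universal\<close>). In the presence of the braid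
relation, this relation says that \<open>\<sigma>\<^sub>i\<^sup>2\<close> and \<open>\<sigma>\<^bsub>i+1\<^esub>\<^sup>2\<close> commute (\<open>pseudosymmetric_iff_squares_commute\<close>). Hence
it holds in \<open>PS\<^sub>n\<close>, where the images of the pure braids \<open>\<sigma>\<^sub>i\<^sup>2\<close> commute. Conversely, if it holds in a group,
then conjugation by the generators permutes the elements \<open>A\<^bsub>i,j\<^esub>\<close>, the conjugates of the squares \<open>\<sigma>\<^sub>i\<^sup>2\<close>
in which strands \<open>i\<close> and \<open>j\<close> link, in the way that the symmetric group permutes pairs \<open>{i, j}\<close>
(\<open>gen_permutes_bands\<close>). So each square \<open>\<sigma>\<^sub>k\<^sup>2\<close> commutes with all of them, and therefore all conjugates of
squares commute with one another. These conjugates generate \<open>P\<^sub>n\<close>, because adding the relations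
\<open>\<sigma>\<^sub>i\<^sup>2 = 1\<close> to Artin's presentation leaves the Coxeter presentation of the symmetric group
(\<open>word_val_eq_one\<close>, \<open>pure_braid_group_generated\<close>).\<close>

section \<open>Composition and isomorphisms\<close>

context category begin

lemma Hom_iff: "f \<in> Hom C x y \<longleftrightarrow> f \<in> Arr C \<and> Dom C f = x \<and> Cod C f = y"
  by (auto simp: Hom_def)

lemma Arr_Hom: "f \<in> Arr C \<Longrightarrow> f \<in> Hom C (Dom C f) (Cod C f)"
  by (simp add: Hom_iff)

lemma Ide_simps [simp]:
  assumes "x \<in> Obj C"
  shows "Ide C x \<in> Arr C" "Dom C (Ide C x) = x" "Cod C (Ide C x) = x"
  using Ide_Hom [OF assms] by (auto simp: Hom_iff)

lemma Comp_simps [simp]: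
  assumes "f \<in> Arr C" "g \<in> Arr C" "Cod C f = Dom C g"
  shows "g \<cdot> f \<in> Arr C" "Dom C (g \<cdot> f) = Dom C f" "Cod C (g \<cdot> f) = Cod C g"
  using Comp_Hom [of f "Dom C f" "Cod C f" g "Cod C g"] assms by (auto simp: Hom_iff)

lemma Comp_Ide_simps [simp]:
  assumes "f \<in> Arr C"
  shows "Cod C f = x \<Longrightarrow> Ide C x \<cdot> f = f" "Dom C f = x \<Longrightarrow> f \<cdot> Ide C x = f"
  using assms Comp_Ide_left Comp_Ide_right by (auto simp: Hom_iff)

lemma Comp_assoc_simp [simp]:
  assumes "f \<in> Arr C" "g \<in> Arr C" "h \<in> Arr C" "Cod C f = Dom C g" "Cod C g = Dom C h"
  shows "(h \<cdot> g) \<cdot> f = h \<cdot> (g \<cdot> f)"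
  using assms Comp_assoc by (auto simp: Hom_iff)

declare Dom_Obj [simp] Cod_Obj [simp]

text \<open>The simplifier brackets composites to the right; this lemma lets an equation between two binary
composites be applied in front of a further arrow.\<close>

lemma Comp_eq_extend:
  assumes "x \<cdot> y = z \<cdot> w"
    and "x \<in> Arr C" "y \<in> Arr C" "z \<in> Arr C" "w \<in> Arr C" "h \<in> Arr C"
    and "Cod C y = Dom C x" "Cod C w = Dom C z" "Cod C h = Dom C y" "Cod C h = Dom C w"
  shows "x \<cdot> (y \<cdot> h) = z \<cdot> (w \<cdot> h)"
  using assms Comp_assoc_simp [of h y x] Comp_assoc_simp [of h w z] by simp

lemma inverse_arrows_unique:
  assumes "inverse_arrows C f g" "inverse_arrows C f g'" shows "g = g'"
proof -
  have "g = g \<cdot> (f \<cdot> g')" using assms by (auto simp: inverse_arrows_def Hom_iff)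
  also have "\<dots> = (g \<cdot> f) \<cdot> g'"
    using assms Comp_assoc_simp [of g' f g] by (simp add: inverse_arrows_def Hom_iff)
  also have "\<dots> = g'" using assms by (auto simp: inverse_arrows_def Hom_iff)
  finally show ?thesis .
qed

lemma inv_arr_eqI: "inverse_arrows C f g \<Longrightarrow> inv_arr C f = g"
  unfolding inv_arr_def using inverse_arrows_unique by blast

lemma inv_arr_inverse: "is_iso C f \<Longrightarrow> inverse_arrows C f (inv_arr C f)"
  using inv_arr_eqI by (auto simp: is_iso_def)

lemma iso_Arr: "is_iso C f \<Longrightarrow> f \<in> Arr C"
  by (auto simp: is_iso_def inverse_arrows_def)

lemma inv_arr_simps [simp]:
  assumes "is_iso C f"
  shows "inv_arr C f \<in> Arr C" "Dom C (inv_arr C f) = Cod C f" "Cod C (inv_arr C f) = Dom C f"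
    "inv_arr C f \<cdot> f = Ide C (Dom C f)" "f \<cdot> inv_arr C f = Ide C (Cod C f)"
  using inv_arr_inverse [OF assms] by (auto simp: inverse_arrows_def Hom_iff)

lemma inv_arr_cancel [simp]:
  assumes "is_iso C f" "h \<in> Arr C"
  shows "Cod C h = Dom C f \<Longrightarrow> inv_arr C f \<cdot> (f \<cdot> h) = h"
    "Cod C h = Cod C f \<Longrightarrow> f \<cdot> (inv_arr C f \<cdot> h) = h"
proof -
  show "inv_arr C f \<cdot> (f \<cdot> h) = h" if "Cod C h = Dom C f"
    by (subst Comp_assoc_simp [symmetric]) (use that assms iso_Arr in simp_all)
  show "f \<cdot> (inv_arr C f \<cdot> h) = h" if "Cod C h = Cod C f"
    by (subst Comp_assoc_simp [symmetric]) (use that assms iso_Arr in simp_all)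
qed

lemma is_isoI:
  assumes "f \<in> Arr C" "g \<in> Arr C" "Dom C g = Cod C f" "Cod C g = Dom C f"
    "g \<cdot> f = Ide C (Dom C f)" "f \<cdot> g = Ide C (Cod C f)"
  shows "is_iso C f" "inv_arr C f = g"
proof -
  have "inverse_arrows C f g" using assms by (auto simp: inverse_arrows_def Hom_iff)
  then show "is_iso C f" "inv_arr C f = g" by (auto simp: is_iso_def inv_arr_eqI)
qed

lemma is_iso_inv [simp]:
  assumes "is_iso C f" shows "is_iso C (inv_arr C f)" "inv_arr C (inv_arr C f) = f"
proof -
  note f = assms iso_Arr [OF assms]
  have "inv_arr C f \<cdot> f = Ide C (Cod C (inv_arr C f))" "f \<cdot> inv_arr C f = Ide C (Dom C (inv_arr C f))"
    using f by simp_all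
  then show "is_iso C (inv_arr C f)" "inv_arr C (inv_arr C f) = f"
    using is_isoI [of "inv_arr C f" f] f by simp_all
qed

lemma is_iso_Ide [simp]:
  assumes "x \<in> Obj C" shows "is_iso C (Ide C x)" "inv_arr C (Ide C x) = Ide C x"
  using is_isoI [of "Ide C x" "Ide C x"] assms by simp_all

lemma is_iso_Comp [simp]:
  assumes "is_iso C f" "is_iso C g" "Cod C f = Dom C g"
  shows "is_iso C (g \<cdot> f)" "inv_arr C (g \<cdot> f) = inv_arr C f \<cdot> inv_arr C g"
  using is_isoI [of "g \<cdot> f" "inv_arr C f \<cdot> inv_arr C g"] assms iso_Arr [OF assms(1)] iso_Arr [OF assms(2)]
  by simp_all

lemma iso_cancel_left:
  assumes "is_iso C f" "g \<in> Arr C" "h \<in> Arr C" "Cod C g = Dom C f" "Cod C h = Dom C f" "f \<cdot> g = f \<cdot> h"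
  shows "g = h"
  using assms by (metis inv_arr_cancel(1))

lemma iso_cancel_right:
  assumes "is_iso C f" "g \<in> Arr C" "h \<in> Arr C" "Dom C g = Cod C f" "Dom C h = Cod C f" "g \<cdot> f = h \<cdot> f"
  shows "g = h"
proof -
  have "(g \<cdot> f) \<cdot> inv_arr C f = (h \<cdot> f) \<cdot> inv_arr C f" using assms(6) by simp
  then show ?thesis using assms(1-5) iso_Arr [OF assms(1)] by simp
qed

end

section \<open>Equivalences of categories\<close>

text \<open>A quasi-inverse is chosen object by object; full faithfulness then makes it functorial, since an
equation between arrows of \<open>A\<close> may be checked after applying \<open>F\<close>.\<close>

lemma equivalence_of_fully_faithful:
  fixes A :: "('o1, 'a1) cat" and D :: "('o2, 'a2) cat"
  assumes F: "cat_functor A D F"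
    and faithful: "\<And>f g x y. \<lbrakk>f \<in> Hom A x y; g \<in> Hom A x y; amap F f = amap F g\<rbrakk> \<Longrightarrow> f = g"
    and full: "\<And>h x y. \<lbrakk>x \<in> Obj A; y \<in> Obj A; h \<in> Hom D (omap F x) (omap F y)\<rbrakk>
                 \<Longrightarrow> \<exists>f\<in>Hom A x y. amap F f = h"
    and ess_surj: "\<And>z. z \<in> Obj D \<Longrightarrow> \<exists>x\<in>Obj A. \<exists>e\<in>Hom D (omap F x) z. is_iso D e"
  shows "equivalence_of_categories A D F"
proof -
  interpret F: cat_functor A D F by (rule F)
  note [simp] = F.omap_Obj
  have amap_simps [simp]: "amap F f \<in> Arr D" "Dom D (amap F f) = omap F (Dom A f)" "Cod D (amap F f) = omap F (Cod A f)"
    if "f \<in> Arr A" for f using F.amap_Hom F.S.Arr_Hom [OF that] by (auto simp: F.T.Hom_iff)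
  have Comp: "amap F (g \<cdot>\<^bsub>A\<^esub> f) = amap F g \<cdot>\<^bsub>D\<^esub> amap F f"
    if "f \<in> Arr A" "g \<in> Arr A" "Cod A f = Dom A g" for f g
    using F.amap_Comp that by (auto simp: F.S.Hom_iff)
  have faith: "f = g" if "f \<in> Arr A" "g \<in> Arr A" "Dom A f = Dom A g" "Cod A f = Cod A g" "amap F f = amap F g" for f g
    using faithful that by (auto simp: F.S.Hom_iff)
  \<comment> \<open>\<open>P\<close>, \<open>Q\<close>: the quasi-inverse on objects and arrows; \<open>e\<close>: its counit; below, \<open>u\<close>: its unit\<close>
  obtain P where P: "\<And>z. z \<in> Obj D \<Longrightarrow> P z \<in> Obj A \<and> (\<exists>e\<in>Hom D (omap F (P z)) z. is_iso D e)"
    using ess_surj by metis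
  then obtain e where e: "\<And>z. z \<in> Obj D \<Longrightarrow> e z \<in> Hom D (omap F (P z)) z \<and> is_iso D (e z)"
    by metis
  have [simp]: "P z \<in> Obj A" "e z \<in> Arr D" "Dom D (e z) = omap F (P z)" "Cod D (e z) = z" "is_iso D (e z)"
    if "z \<in> Obj D" for z using P e that by (auto simp: F.T.Hom_iff)
  have "\<exists>f\<in>Hom A (P (Dom D h)) (P (Cod D h)). amap F f = inv_arr D (e (Cod D h)) \<cdot>\<^bsub>D\<^esub> h \<cdot>\<^bsub>D\<^esub> e (Dom D h)"
    if "h \<in> Arr D" for h using that by (intro full) (auto simp: F.T.Hom_iff)
  then obtain Q where "\<And>h. h \<in> Arr D \<Longrightarrow> Q h \<in> Hom A (P (Dom D h)) (P (Cod D h)) \<and>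
      amap F (Q h) = inv_arr D (e (Cod D h)) \<cdot>\<^bsub>D\<^esub> h \<cdot>\<^bsub>D\<^esub> e (Dom D h)"
    by metis
  then have [simp]: "Q h \<in> Arr A" "Dom A (Q h) = P (Dom D h)" "Cod A (Q h) = P (Cod D h)"
    "amap F (Q h) = inv_arr D (e (Cod D h)) \<cdot>\<^bsub>D\<^esub> h \<cdot>\<^bsub>D\<^esub> e (Dom D h)"
    if "h \<in> Arr D" for h using that by (auto simp: F.S.Hom_iff)
  define G where "G = \<lparr>omap = restrict P (Obj D), amap = restrict Q (Arr D)\<rparr>"
  have G: "cat_functor D A G"
  proof
    show "amap G (Ide D x) = Ide A (omap G x)" if "x \<in> Obj D" for x
      by (rule faith) (use that F.amap_Ide in \<open>auto simp: G_def\<close>)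
    show "amap G (g \<cdot>\<^bsub>D\<^esub> f) = amap G g \<cdot>\<^bsub>A\<^esub> amap G f" if "f \<in> Hom D x y" "g \<in> Hom D y z" for f g x y z
      by (rule faith) (use that in \<open>auto simp: G_def F.T.Hom_iff Comp\<close>)
  qed (auto simp: G_def F.T.Hom_iff F.S.Hom_iff)
  have "\<exists>f\<in>Hom A (P (omap F x)) x. amap F f = e (omap F x)" if "x \<in> Obj A" for x
    by (rule full) (use that in \<open>auto simp: F.T.Hom_iff\<close>)
  then obtain u where "\<And>x. x \<in> Obj A \<Longrightarrow> u x \<in> Hom A (P (omap F x)) x \<and> amap F (u x) = e (omap F x)"
    by metis
  then have u [simp]: "u x \<in> Arr A" "Dom A (u x) = P (omap F x)" "Cod A (u x) = x" "amap F (u x) = e (omap F x)"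
    if "x \<in> Obj A" for x using that by (auto simp: F.S.Hom_iff)
  have u_iso: "is_iso A (u x)" if x: "x \<in> Obj A" for x
  proof -
    have "\<exists>v\<in>Hom A x (P (omap F x)). amap F v = inv_arr D (e (omap F x))"
      by (rule full) (use x in \<open>auto simp: F.T.Hom_iff\<close>)
    then obtain v where [simp]: "v \<in> Arr A" "Dom A v = x" "Cod A v = P (omap F x)"
      "amap F v = inv_arr D (e (omap F x))" by (auto simp: F.S.Hom_iff)
    show ?thesis
      by (rule F.S.is_isoI(1)[of _ v]; (rule faith)?) (use x in \<open>simp_all add: Comp F.amap_Ide\<close>)
  qed
  have 1: "naturally_isomorphic A A (comp_functor A G F) (id_functor A)"
    unfolding naturally_isomorphic_def nat_trans_def
  proof (intro exI [of _ "restrict u (Obj A)"] conjI allI ballI)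
    fix x y f assume f: "f \<in> Hom A x y"
    show "restrict u (Obj A) y \<cdot>\<^bsub>A\<^esub> amap (comp_functor A G F) f = amap (id_functor A) f \<cdot>\<^bsub>A\<^esub> restrict u (Obj A) x"
      by (rule faith) (use f in \<open>auto simp: comp_functor_def id_functor_def G_def F.S.Hom_iff Comp\<close>)
  qed (auto simp: comp_functor_def id_functor_def G_def F.S.Hom_iff u_iso)
  have 2: "naturally_isomorphic D D (comp_functor D F G) (id_functor D)"
    unfolding naturally_isomorphic_def nat_trans_def
    by (intro exI [of _ "restrict e (Obj D)"])
      (auto simp: comp_functor_def id_functor_def G_def F.T.Hom_iff)
  show ?thesis unfolding equivalence_of_categories_def using F G 1 2 by blast
qed

section \<open>Monoidal categories and their unit constraints\<close>

context monoidal_category begin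

declare tens_Obj [simp] unit_Obj [simp] tens_Ide [simp]

lemma tens_simps [simp]:
  assumes "f \<in> Arr C" "g \<in> Arr C"
  shows "f \<boxtimes> g \<in> Arr C" "Dom C (f \<boxtimes> g) = Dom C f \<boxdot> Dom C g" "Cod C (f \<boxtimes> g) = Cod C f \<boxdot> Cod C g"
  using tens_Hom [OF Arr_Hom [OF assms(1)] Arr_Hom [OF assms(2)]] by (auto simp: Hom_iff)

lemma structure_simps [simp]:
  assumes "x \<in> Obj C"
  shows "\<lbrakk>y \<in> Obj C; z \<in> Obj C\<rbrakk> \<Longrightarrow> assoc C x y z \<in> Arr C"
    "\<lbrakk>y \<in> Obj C; z \<in> Obj C\<rbrakk> \<Longrightarrow> Dom C (assoc C x y z) = (x \<boxdot> y) \<boxdot> z"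
    "\<lbrakk>y \<in> Obj C; z \<in> Obj C\<rbrakk> \<Longrightarrow> Cod C (assoc C x y z) = x \<boxdot> (y \<boxdot> z)"
    "lunit C x \<in> Arr C" "Dom C (lunit C x) = unit_obj C \<boxdot> x" "Cod C (lunit C x) = x"
    "runit C x \<in> Arr C" "Dom C (runit C x) = x \<boxdot> unit_obj C" "Cod C (runit C x) = x"
  using assoc_Hom [OF assms] lunit_Hom [OF assms] runit_Hom [OF assms] by (auto simp: Hom_iff)

declare assoc_iso [simp] lunit_iso [simp] runit_iso [simp]

text \<open>Directed from two tensor products to one: as a rewrite rule it merges adjacent factors, which brings
expressions without associators into a normal form.\<close>

lemma interchange:
  assumes "f \<in> Arr C" "g \<in> Arr C" "f' \<in> Arr C" "g' \<in> Arr C" "Cod C f = Dom C g" "Cod C f' = Dom C g'"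
  shows "(g \<boxtimes> g') \<cdot> (f \<boxtimes> f') = (g \<cdot> f) \<boxtimes> (g' \<cdot> f')"
    and "\<lbrakk>h \<in> Arr C; Cod C h = Dom C f \<boxdot> Dom C f'\<rbrakk>
      \<Longrightarrow> (g \<boxtimes> g') \<cdot> ((f \<boxtimes> f') \<cdot> h) = ((g \<cdot> f) \<boxtimes> (g' \<cdot> f')) \<cdot> h"
proof -
  show *: "(g \<boxtimes> g') \<cdot> (f \<boxtimes> f') = (g \<cdot> f) \<boxtimes> (g' \<cdot> f')"
    using tens_Comp [of f "Dom C f" "Dom C g" g "Cod C g" f' "Dom C f'" "Dom C g'" g' "Cod C g'"] assms
    by (auto simp: Hom_iff)
  show "(g \<boxtimes> g') \<cdot> ((f \<boxtimes> f') \<cdot> h) = ((g \<cdot> f) \<boxtimes> (g' \<cdot> f')) \<cdot> h"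
    if "h \<in> Arr C" "Cod C h = Dom C f \<boxdot> Dom C f'"
    unfolding * [symmetric] using that assms by simp
qed

lemma is_iso_tens [simp]:
  assumes "is_iso C f" "is_iso C g"
  shows "is_iso C (f \<boxtimes> g)" "inv_arr C (f \<boxtimes> g) = inv_arr C f \<boxtimes> inv_arr C g"
  using is_isoI [of "f \<boxtimes> g" "inv_arr C f \<boxtimes> inv_arr C g"] assms iso_Arr [OF assms(1)] iso_Arr [OF assms(2)]
  by (simp_all add: interchange)

lemma assoc_nat:
  assumes "f \<in> Arr C" "g \<in> Arr C" "h \<in> Arr C"
  shows "assoc C (Cod C f) (Cod C g) (Cod C h) \<cdot> ((f \<boxtimes> g) \<boxtimes> h)
    = (f \<boxtimes> (g \<boxtimes> h)) \<cdot> assoc C (Dom C f) (Dom C g) (Dom C h)"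
  using assoc_natural assms Arr_Hom by blast

text \<open>Naturality of \<open>lunit\<close> recovers \<open>f\<close> from \<open>id\<^sub>I \<otimes> f\<close>.\<close>

lemma unit_tens_faithful:
  assumes "f \<in> Arr C" "g \<in> Arr C" "Dom C f = Dom C g" "Cod C f = Cod C g"
    "Ide C (unit_obj C) \<boxtimes> f = Ide C (unit_obj C) \<boxtimes> g"
  shows "f = g"
proof (rule iso_cancel_right)
  show "f \<cdot> lunit C (Dom C f) = g \<cdot> lunit C (Dom C f)"
    using lunit_natural [OF Arr_Hom [OF assms(1)]] lunit_natural [OF Arr_Hom [OF assms(2)]] assms by simp
qed (use assms in auto)

lemma tens_unit_faithful:
  assumes "f \<in> Arr C" "g \<in> Arr C" "Dom C f = Dom C g" "Cod C f = Cod C g"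
    "f \<boxtimes> Ide C (unit_obj C) = g \<boxtimes> Ide C (unit_obj C)"
  shows "f = g"
proof (rule iso_cancel_right)
  show "f \<cdot> runit C (Dom C f) = g \<cdot> runit C (Dom C f)"
    using runit_natural [OF Arr_Hom [OF assms(1)]] runit_natural [OF Arr_Hom [OF assms(2)]] assms by simp
qed (use assms in auto)

text \<open>Kelly's first redundant unit axiom. After tensoring with \<open>I\<close> on the left, which loses nothing, the
pentagon for \<open>I, I, x, y\<close> reduces it to the triangle.\<close>

lemma lunit_tens:
  assumes [simp]: "x \<in> Obj C" "y \<in> Obj C"
  shows "lunit C (x \<boxdot> y) \<cdot> assoc C (unit_obj C) x y = lunit C x \<boxtimes> Ide C y" (is "?l = ?r")
proof (rule unit_tens_faithful)
  let ?I = "unit_obj C" and ?i = "Ide C (unit_obj C)"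
  let ?u = "assoc C ?I (?I \<boxdot> x) y \<cdot> (assoc C ?I ?I x \<boxtimes> Ide C y)"
  show "?i \<boxtimes> ?l = ?i \<boxtimes> ?r"
  proof (rule iso_cancel_right [of ?u])
    have "(?i \<boxtimes> ?l) \<cdot> ?u = (?i \<boxtimes> lunit C (x \<boxdot> y)) \<cdot> ((?i \<boxtimes> assoc C ?I x y) \<cdot> ?u)"
      by (simp add: interchange)
    also have "\<dots> = ((?i \<boxtimes> lunit C (x \<boxdot> y)) \<cdot> assoc C ?I ?I (x \<boxdot> y)) \<cdot> assoc C (?I \<boxdot> ?I) x y"
      by (simp add: pentagon)
    also have "\<dots> = (runit C ?I \<boxtimes> (Ide C x \<boxtimes> Ide C y)) \<cdot> assoc C (?I \<boxdot> ?I) x y"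
      by (simp only: triangle assms tens_Obj tens_Ide unit_Obj)
    also have "\<dots> = assoc C ?I x y \<cdot> ((runit C ?I \<boxtimes> Ide C x) \<boxtimes> Ide C y)"
      using assoc_nat [of "runit C ?I" "Ide C x" "Ide C y"] by simp
    also have "\<dots> = assoc C ?I x y \<cdot> (((?i \<boxtimes> lunit C x) \<boxtimes> Ide C y) \<cdot> (assoc C ?I ?I x \<boxtimes> Ide C y))"
      by (simp add: interchange triangle)
    also have "\<dots> = (assoc C ?I x y \<cdot> ((?i \<boxtimes> lunit C x) \<boxtimes> Ide C y)) \<cdot> (assoc C ?I ?I x \<boxtimes> Ide C y)"
      by simp
    also have "\<dots> = ((?i \<boxtimes> ?r) \<cdot> assoc C ?I (?I \<boxdot> x) y) \<cdot> (assoc C ?I ?I x \<boxtimes> Ide C y)"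
      using assoc_nat [of ?i "lunit C x" "Ide C y"] by (simp only: structure_simps Ide_simps assms unit_Obj)
    also have "\<dots> = (?i \<boxtimes> ?r) \<cdot> ?u" by simp
    finally show "(?i \<boxtimes> ?l) \<cdot> ?u = (?i \<boxtimes> ?r) \<cdot> ?u" .
  qed simp_all
qed simp_all

text \<open>The mirror image of \<open>lunit_tens\<close>, from the pentagon for \<open>x, y, I, I\<close>.\<close>

lemma runit_tens:
  assumes [simp]: "x \<in> Obj C" "y \<in> Obj C"
  shows "(Ide C x \<boxtimes> runit C y) \<cdot> assoc C x y (unit_obj C) = runit C (x \<boxdot> y)" (is "?l = ?r")
proof (rule tens_unit_faithful)
  let ?I = "unit_obj C" and ?i = "Ide C (unit_obj C)" and ?x = "Ide C x" and ?y = "Ide C y"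
  let ?a = "assoc C x y ?I"
  show "?l \<boxtimes> ?i = ?r \<boxtimes> ?i"
  proof (rule iso_cancel_left [of ?a])
    have "?a \<cdot> (?l \<boxtimes> ?i) = (?a \<cdot> ((?x \<boxtimes> runit C y) \<boxtimes> ?i)) \<cdot> (?a \<boxtimes> ?i)"
      by (simp add: interchange)
    also have "\<dots> = ((?x \<boxtimes> (runit C y \<boxtimes> ?i)) \<cdot> assoc C x (y \<boxdot> ?I) ?I) \<cdot> (?a \<boxtimes> ?i)"
      using assoc_nat [of ?x "runit C y" ?i] by simp
    also have "\<dots> = ((?x \<boxtimes> (?y \<boxtimes> lunit C ?I)) \<cdot> (?x \<boxtimes> assoc C y ?I ?I)) \<cdot> (assoc C x (y \<boxdot> ?I) ?I \<cdot> (?a \<boxtimes> ?i))"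
      by (simp add: interchange triangle)
    also have "\<dots> = (?x \<boxtimes> (?y \<boxtimes> lunit C ?I)) \<cdot> ((?x \<boxtimes> assoc C y ?I ?I) \<cdot> (assoc C x (y \<boxdot> ?I) ?I \<cdot> (?a \<boxtimes> ?i)))"
      by simp
    also have "\<dots> = ((?x \<boxtimes> (?y \<boxtimes> lunit C ?I)) \<cdot> assoc C x y (?I \<boxdot> ?I)) \<cdot> assoc C (x \<boxdot> y) ?I ?I"
      by (simp add: pentagon)
    also have "\<dots> = (?a \<cdot> (Ide C (x \<boxdot> y) \<boxtimes> lunit C ?I)) \<cdot> assoc C (x \<boxdot> y) ?I ?I"
      using assoc_nat [of ?x ?y "lunit C ?I"] by simp
    also have "\<dots> = ?a \<cdot> (?r \<boxtimes> ?i)"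
      using triangle [of "x \<boxdot> y" ?I] by simp
    finally show "?a \<cdot> (?l \<boxtimes> ?i) = ?a \<cdot> (?r \<boxtimes> ?i)" .
  qed simp_all
qed simp_all

text \<open>By naturality of \<open>lunit\<close> at itself, \<open>lunit (I \<otimes> I) = id\<^sub>I \<otimes> lunit I\<close>; comparing \<open>lunit_tens\<close> with the
triangle at \<open>I, I\<close> gives the claim after tensoring with \<open>I\<close>.\<close>

lemma lunit_unit_eq_runit_unit: "lunit C (unit_obj C) = runit C (unit_obj C)"
proof (rule tens_unit_faithful)
  let ?I = "unit_obj C" and ?i = "Ide C (unit_obj C)"
  have "lunit C (?I \<boxdot> ?I) = ?i \<boxtimes> lunit C ?I"
    by (rule iso_cancel_left [of "lunit C ?I"])
      (use lunit_natural [of "lunit C ?I" "?I \<boxdot> ?I" ?I] in \<open>simp_all add: Hom_iff\<close>)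
  then show "lunit C ?I \<boxtimes> ?i = runit C ?I \<boxtimes> ?i"
    using lunit_tens [of ?I ?I] triangle [of ?I ?I] by simp
qed simp_all

end

section \<open>The braid relations in a group\<close>

context group begin

lemma inv_mult_cancel:
  assumes "x \<in> carrier G" "y \<in> carrier G"
  shows "inv x \<otimes> (x \<otimes> y) = y" "x \<otimes> (inv x \<otimes> y) = y"
  using assms by (simp_all flip: m_assoc)

lemma commute_inv:
  assumes "x \<otimes> y = y \<otimes> x" "x \<in> carrier G" "y \<in> carrier G"
  shows "x \<otimes> inv y = inv y \<otimes> x"
proof -
  have "x \<otimes> inv y = inv y \<otimes> (y \<otimes> x) \<otimes> inv y" using assms(2,3) by (simp add: inv_mult_cancel)
  also have "\<dots> = inv y \<otimes> x" unfolding assms(1) [symmetric] using assms(2,3) by (simp add: m_assoc)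
  finally show ?thesis .
qed

lemma commute_mult:
  assumes "x \<otimes> y = y \<otimes> x" "x \<otimes> z = z \<otimes> x" "x \<in> carrier G" "y \<in> carrier G" "z \<in> carrier G"
  shows "x \<otimes> (y \<otimes> z) = (y \<otimes> z) \<otimes> x"
  using assms by (metis m_assoc)

text \<open>If \<open>g\<close> commutes with \<open>m\<close>, then conjugation by \<open>m\<close> preserves the statement that \<open>g\<close> conjugates \<open>x\<close> to
\<open>y\<close>. It carries the induction steps for the elements \<open>band i d\<close> below.\<close>

lemma conj_intertwine:
  assumes "g \<otimes> m = m \<otimes> g" "g \<otimes> x = y \<otimes> g" "g \<in> carrier G" "m \<in> carrier G" "x \<in> carrier G" "y \<in> carrier G"
  shows "g \<otimes> (m \<otimes> x \<otimes> inv m) = (m \<otimes> y \<otimes> inv m) \<otimes> g"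
proof -
  have "g \<otimes> (m \<otimes> x \<otimes> inv m) = (g \<otimes> m) \<otimes> x \<otimes> inv m" using assms(3-6) by (simp add: m_assoc)
  also have "\<dots> = m \<otimes> (g \<otimes> x) \<otimes> inv m" unfolding assms(1) using assms(3-6) by (simp add: m_assoc)
  also have "\<dots> = m \<otimes> y \<otimes> (g \<otimes> inv m)" unfolding assms(2) using assms(3-6) by (simp add: m_assoc)
  also have "\<dots> = (m \<otimes> y \<otimes> inv m) \<otimes> g"
    using commute_inv [OF assms(1,3,4)] assms(3-6) by (simp add: m_assoc)
  finally show ?thesis .
qed

lemma commute_conj_iff:
  assumes "x \<in> carrier G" "y \<in> carrier G" "m \<in> carrier G"
  shows "x \<otimes> (m \<otimes> y \<otimes> inv m) = (m \<otimes> y \<otimes> inv m) \<otimes> x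
    \<longleftrightarrow> (inv m \<otimes> x \<otimes> m) \<otimes> y = y \<otimes> (inv m \<otimes> x \<otimes> m)" (is "?l = ?r \<longleftrightarrow> ?l' = ?r'")
proof -
  have "?l' = inv m \<otimes> ?l \<otimes> m" "?r' = inv m \<otimes> ?r \<otimes> m"
    using assms by (simp_all add: m_assoc inv_mult_cancel)
  moreover have "?l = ?r \<longleftrightarrow> inv m \<otimes> ?l \<otimes> m = inv m \<otimes> ?r \<otimes> m" using assms by simp
  ultimately show ?thesis by simp
qed

text \<open>The centralizer of the generators contains the subgroup they generate; used once for each factor.\<close>

lemma commuting_generate:
  assumes S: "S \<subseteq> carrier G" and comm: "\<And>x y. \<lbrakk>x \<in> S; y \<in> S\<rbrakk> \<Longrightarrow> x \<otimes> y = y \<otimes> x"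
    and x: "x \<in> generate G S" and y: "y \<in> generate G S"
  shows "x \<otimes> y = y \<otimes> x"
proof -
  have centralizer: "x \<otimes> y = y \<otimes> x"
    if "\<And>y. y \<in> S \<Longrightarrow> x \<otimes> y = y \<otimes> x" "x \<in> carrier G" "y \<in> generate G S" for x y
    using that(3)
  proof induction
    case (inv h)
    then show ?case using that(1,2) S commute_inv by blast
  next
    case (eng h1 h2)
    then show ?case using that(2) commute_mult [of x h1 h2] generate_in_carrier [OF S] by simp
  qed (use that S in auto)
  have "x \<otimes> y = y \<otimes> x" if "y \<in> S" for y
    using centralizer [of y x] comm that x S by force
  then show ?thesis using centralizer x y generate_in_carrier [OF S] by blast
qed

text \<open>The two forms in which the braid relation moves a generator past its neighbour by conjugation.\<close>

lemma braid_conj: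
  assumes [simp]: "a \<in> carrier G" "b \<in> carrier G" and "a \<otimes> b \<otimes> a = b \<otimes> a \<otimes> b"
  shows "inv b \<otimes> a \<otimes> b = a \<otimes> b \<otimes> inv a" "b \<otimes> a \<otimes> inv b = inv a \<otimes> b \<otimes> a"
proof -
  have e: "b \<otimes> (a \<otimes> b) = a \<otimes> (b \<otimes> a)" using assms by (simp add: m_assoc)
  then have "inv b \<otimes> (b \<otimes> (a \<otimes> b)) \<otimes> inv a = inv b \<otimes> (a \<otimes> (b \<otimes> a)) \<otimes> inv a" by simp
  then show "inv b \<otimes> a \<otimes> b = a \<otimes> b \<otimes> inv a" by (simp add: m_assoc inv_mult_cancel)
  have "inv a \<otimes> (b \<otimes> (a \<otimes> b)) \<otimes> inv b = inv a \<otimes> (a \<otimes> (b \<otimes> a)) \<otimes> inv b" using e by simp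
  then show "b \<otimes> a \<otimes> inv b = inv a \<otimes> b \<otimes> a" by (simp add: m_assoc inv_mult_cancel)
qed

lemma braid_conj_square:
  assumes [simp]: "a \<in> carrier G" "b \<in> carrier G" and "a \<otimes> b \<otimes> a = b \<otimes> a \<otimes> b"
  shows "inv b \<otimes> (a \<otimes> a) \<otimes> b = a \<otimes> (b \<otimes> b) \<otimes> inv a"
proof -
  have "inv b \<otimes> (a \<otimes> a) \<otimes> b = (inv b \<otimes> a \<otimes> b) \<otimes> (inv b \<otimes> a \<otimes> b)"
    by (simp add: m_assoc inv_mult_cancel)
  also have "\<dots> = a \<otimes> (b \<otimes> b) \<otimes> inv a"
    unfolding braid_conj(1) [OF assms] by (simp add: m_assoc inv_mult_cancel)
  finally show ?thesis .
qed

text \<open>Both sides say that \<open>b a\<^sup>2 b\<^sup>-\<^sup>1 = b\<^sup>-\<^sup>1 a\<^sup>2 b\<close>: on the left this follows by rewriting \<open>b a b\<^sup>-\<^sup>1\<close> as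
\<open>a\<^sup>-\<^sup>1 b a\<close> and \<open>a b\<^sup>2 a\<^sup>-\<^sup>1\<close> as \<open>b\<^sup>-\<^sup>1 a\<^sup>2 b\<close>.\<close>

lemma pseudosymmetric_iff_squares_commute:
  assumes [simp]: "a \<in> carrier G" "b \<in> carrier G" and br: "a \<otimes> b \<otimes> a = b \<otimes> a \<otimes> b"
  shows "a \<otimes> inv b \<otimes> a = b \<otimes> inv a \<otimes> b \<longleftrightarrow> (a \<otimes> a) \<otimes> (b \<otimes> b) = (b \<otimes> b) \<otimes> (a \<otimes> a)"
proof -
  have "a \<otimes> inv b \<otimes> a = b \<otimes> inv a \<otimes> b \<longleftrightarrow> b \<otimes> (a \<otimes> inv b \<otimes> a) = b \<otimes> (b \<otimes> inv a \<otimes> b)"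
    by simp
  also have "b \<otimes> (a \<otimes> inv b \<otimes> a) = (b \<otimes> a \<otimes> inv b) \<otimes> a" by (simp add: m_assoc)
  also have "\<dots> = inv a \<otimes> b \<otimes> a \<otimes> a" unfolding braid_conj(2) [OF assms] by (simp add: m_assoc)
  also have "inv a \<otimes> b \<otimes> a \<otimes> a = b \<otimes> (b \<otimes> inv a \<otimes> b)
    \<longleftrightarrow> a \<otimes> (inv a \<otimes> b \<otimes> a \<otimes> a) \<otimes> inv b = a \<otimes> (b \<otimes> (b \<otimes> inv a \<otimes> b)) \<otimes> inv b"
    by simp
  also have "a \<otimes> (inv a \<otimes> b \<otimes> a \<otimes> a) \<otimes> inv b = b \<otimes> (a \<otimes> a) \<otimes> inv b"
    by (simp add: m_assoc inv_mult_cancel)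
  also have "a \<otimes> (b \<otimes> (b \<otimes> inv a \<otimes> b)) \<otimes> inv b = inv b \<otimes> (a \<otimes> a) \<otimes> b"
    unfolding braid_conj_square [OF assms] by (simp add: m_assoc)
  also have "b \<otimes> (a \<otimes> a) \<otimes> inv b = inv b \<otimes> (a \<otimes> a) \<otimes> b
    \<longleftrightarrow> b \<otimes> (b \<otimes> (a \<otimes> a) \<otimes> inv b) \<otimes> b = b \<otimes> (inv b \<otimes> (a \<otimes> a) \<otimes> b) \<otimes> b"
    by simp
  also have "b \<otimes> (b \<otimes> (a \<otimes> a) \<otimes> inv b) \<otimes> b = (b \<otimes> b) \<otimes> (a \<otimes> a)"
    by (simp add: m_assoc inv_mult_cancel)
  also have "b \<otimes> (inv b \<otimes> (a \<otimes> a) \<otimes> b) \<otimes> b = (a \<otimes> a) \<otimes> (b \<otimes> b)"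
    by (simp add: m_assoc inv_mult_cancel)
  finally show ?thesis by auto
qed

end

section \<open>Braid words and the braid groups\<close>

lemma braid_words_simps [simp]:
  "[] \<in> braid_words n" "u @ v \<in> braid_words n \<longleftrightarrow> u \<in> braid_words n \<and> v \<in> braid_words n"
  "x # u \<in> braid_words n \<longleftrightarrow> fst x \<in> {1..<n} \<and> u \<in> braid_words n"
  by (auto simp: braid_words_def mem_Times_iff)

locale braid_representation = group G for G (structure) +
  fixes n :: nat and s :: "nat \<Rightarrow> 'a"
  assumes gen_closed: "i \<in> {1..<n} \<Longrightarrow> s i \<in> carrier G"
    and gen_far: "\<lbrakk>i \<in> {1..<n}; j \<in> {1..<n}; i + 2 \<le> j\<rbrakk> \<Longrightarrow> s i \<otimes> s j = s j \<otimes> s i"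
    and gen_braid: "\<lbrakk>i \<in> {1..<n}; i + 1 \<in> {1..<n}\<rbrakk>
      \<Longrightarrow> s i \<otimes> s (i + 1) \<otimes> s i = s (i + 1) \<otimes> s i \<otimes> s (i + 1)"
begin

definition letter_val :: "nat \<times> bool \<Rightarrow> 'a" where
  "letter_val l = (if snd l then s (fst l) else inv s (fst l))"

definition word_val :: "braid_word \<Rightarrow> 'a" where
  "word_val w = foldr (\<lambda>l x. letter_val l \<otimes> x) w \<one>"

lemma letter_val_simps [simp]: "letter_val (i, True) = s i" "letter_val (i, False) = inv s i"
  by (simp_all add: letter_val_def)

lemma gen_closed' [simp]: "1 \<le> i \<Longrightarrow> i < n \<Longrightarrow> s i \<in> carrier G"
  using gen_closed [of i] by simp

lemma letter_val_closed [simp]: "fst l \<in> {1..<n} \<Longrightarrow> letter_val l \<in> carrier G"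
  by (simp add: letter_val_def)

lemma word_val_simps [simp]: "word_val [] = \<one>" "word_val (l # w) = letter_val l \<otimes> word_val w"
  by (simp_all add: word_val_def)

lemma word_val_closed [simp]: "w \<in> braid_words n \<Longrightarrow> word_val w \<in> carrier G"
  by (induction w) auto

lemma word_val_append [simp]:
  "\<lbrakk>u \<in> braid_words n; v \<in> braid_words n\<rbrakk> \<Longrightarrow> word_val (u @ v) = word_val u \<otimes> word_val v"
  by (induction u) (auto simp: m_assoc)

end

lemma braid_eq_words: "braid_eq n u v \<Longrightarrow> u \<in> braid_words n \<and> v \<in> braid_words n"
  by (induction rule: braid_eq.induct) auto

lemma (in braid_representation) word_val_cong: "braid_eq n u v \<Longrightarrow> word_val u = word_val v"
proof (induction rule: braid_eq.induct)
  case (append u u' v v')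
  then show ?case using braid_eq_words by simp
next
  case (cancel i b)
  then show ?case by (cases b) auto
next
  case (far i j)
  then show ?case using gen_far by simp
next
  case (braid i)
  then show ?case using gen_braid [of i] by (simp add: m_assoc)
qed auto

lemma equiv_braid_rel: "equiv (braid_words n) (braid_rel n)"
  by (rule equivI)
    (auto simp: braid_rel_def refl_on_def sym_def trans_def dest: braid_eq_words
      intro: braid_eq.refl braid_eq.sym braid_eq.trans)

lemma braid_class_eq_iff:
  assumes "u \<in> braid_words n" "v \<in> braid_words n"
  shows "braid_class n u = braid_class n v \<longleftrightarrow> braid_eq n u v"
  using eq_equiv_class_iff [OF equiv_braid_rel assms] by (simp add: braid_class_def braid_rel_def)

lemma mem_braid_class [simp]: "v \<in> braid_class n u \<longleftrightarrow> braid_eq n u v"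
  by (simp add: braid_class_def braid_rel_def)

lemma carrier_braid_group: "carrier (braid_group n) = braid_class n ` braid_words n"
  by (auto simp: braid_group_def quotient_def braid_class_def)

lemma braid_class_closed [simp]: "w \<in> braid_words n \<Longrightarrow> braid_class n w \<in> carrier (braid_group n)"
  by (simp add: carrier_braid_group)

lemma one_braid_group: "\<one>\<^bsub>braid_group n\<^esub> = braid_class n []"
  by (simp add: braid_group_def)

text \<open>The operations on braid classes are unions over representatives. Such a union of a family that is
constant on the classes is its common value.\<close>

lemma UN_braid_class:
  assumes u: "u \<in> braid_words m" and v: "v \<in> braid_words n"
    and cong: "\<And>u' v'. \<lbrakk>braid_eq m u u'; braid_eq n v v'\<rbrakk> \<Longrightarrow> f u' v' = f u v"
  shows "(\<Union>u'\<in>braid_class m u. \<Union>v'\<in>braid_class n v. f u' v') = f u v"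
proof -
  have "(\<Union>u'\<in>braid_class m u. \<Union>v'\<in>braid_class n v. f u' v')
      = (\<Union>u'\<in>braid_class m u. \<Union>v'\<in>braid_class n v. f u v)"
    using cong by (intro SUP_cong) auto
  also have "\<dots> = f u v"
  proof -
    have "u \<in> braid_class m u" "v \<in> braid_class n v" using u v by (simp_all add: braid_eq.refl)
    then show ?thesis by blast
  qed
  finally show ?thesis .
qed

lemma braid_class_mult:
  assumes "u \<in> braid_words n" "v \<in> braid_words n"
  shows "braid_class n u \<otimes>\<^bsub>braid_group n\<^esub> braid_class n v = braid_class n (u @ v)"
proof -
  have "braid_class n (u' @ v') = braid_class n (u @ v)" if "braid_eq n u u'" "braid_eq n v v'" for u' v'
    using that assms braid_eq_words [OF that(1)] braid_eq_words [OF that(2)]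
    by (simp add: braid_class_eq_iff braid_eq.append braid_eq.sym)
  then show ?thesis using UN_braid_class [OF assms, of "\<lambda>u v. braid_class n (u @ v)"]
    by (simp add: braid_group_def)
qed

definition inverse_word :: "braid_word \<Rightarrow> braid_word" where
  "inverse_word w = rev (map (\<lambda>(i, b). (i, \<not> b)) w)"

lemma inverse_word_words [simp]: "inverse_word w \<in> braid_words n \<longleftrightarrow> w \<in> braid_words n"
  by (auto simp: inverse_word_def braid_words_def in_lists_conv_set)

lemma inverse_word_cancel: "w \<in> braid_words n \<Longrightarrow> braid_eq n (inverse_word w @ w) []"
proof (induction w)
  case Nil
  then show ?case by (simp add: inverse_word_def braid_eq.refl)
next
  case (Cons l w)
  obtain i b where l: "l = (i, b)" by force
  have "braid_eq n ([(i, \<not> b), (i, b)] @ w) ([] @ w)"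
    using Cons.prems braid_eq.cancel [of i n "\<not> b"] by (intro braid_eq.append braid_eq.refl) (auto simp: l)
  then have "braid_eq n (inverse_word w @ ([(i, \<not> b), (i, b)] @ w)) (inverse_word w @ w)"
    using Cons.prems by (intro braid_eq.append braid_eq.refl) auto
  then show ?case using Cons braid_eq.trans by (auto simp: inverse_word_def l)
qed

lemma group_braid_group [simp]: "group (braid_group n)"
proof (rule groupI)
  fix x assume "x \<in> carrier (braid_group n)"
  then obtain w where w: "w \<in> braid_words n" "x = braid_class n w" by (auto simp: carrier_braid_group)
  then show "\<exists>y\<in>carrier (braid_group n). y \<otimes>\<^bsub>braid_group n\<^esub> x = \<one>\<^bsub>braid_group n\<^esub>"
    by (intro bexI [of _ "braid_class n (inverse_word w)"])
      (auto simp: braid_class_mult one_braid_group braid_class_eq_iff inverse_word_cancel)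
qed (auto simp: carrier_braid_group one_braid_group braid_class_mult)

text \<open>The universal property of Artin's presentation.\<close>

lemma (in braid_representation) ex_braid_hom:
  obtains h where "h \<in> hom (braid_group n) G" "\<And>w. w \<in> braid_words n \<Longrightarrow> h (braid_class n w) = word_val w"
proof -
  have "\<exists>h. \<forall>w\<in>braid_words n. h (braid_class n w) = word_val w"
    using function_factors_left_gen [of "\<lambda>w. w \<in> braid_words n" "braid_class n" word_val] word_val_cong
    by (auto simp: braid_class_eq_iff)
  then obtain h where h: "\<And>w. w \<in> braid_words n \<Longrightarrow> h (braid_class n w) = word_val w" by blast
  have "h \<in> hom (braid_group n) G"
    by (rule homI) (auto simp: carrier_braid_group braid_class_mult h)
  with h show thesis using that by blast
qed

section \<open>The permutation of a braid\<close>

lemma word_perm_simps [simp]: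
  "word_perm [] = id" "word_perm ((i, b) # w) = Transposition.transpose i (Suc i) \<circ> word_perm w"
  by (simp_all add: word_perm_def)

lemma transpose_sym_group [simp]:
  "\<lbrakk>1 \<le> i; i < n\<rbrakk> \<Longrightarrow> Transposition.transpose i (Suc i) \<in> carrier (sym_group n)"
  by (auto simp: sym_group_carrier intro: permutes_swap_id)

lemma sym_representation: "braid_representation (sym_group n) n (\<lambda>i. Transposition.transpose i (Suc i))"
proof -
  interpret group "sym_group n" by (rule sym_group_is_group)
  show ?thesis
    by unfold_locales (auto simp: sym_group_mult fun_eq_iff Transposition.transpose_def)
qed

interpretation sym: braid_representation "sym_group n" n "\<lambda>i. Transposition.transpose i (Suc i)" for n
  by (rule sym_representation)

lemma sym_word_val: "w \<in> braid_words n \<Longrightarrow> sym.word_val n w = word_perm w"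
proof (induction w)
  case (Cons l w)
  then show ?case by (cases l; cases "snd l") (auto simp: sym_group_mult)
qed (simp add: sym_group_one)

lemma braid_perm_class: assumes "w \<in> braid_words n" shows "braid_perm (braid_class n w) = word_perm w"
proof -
  have "word_perm ` braid_class n w = {word_perm w}"
    using assms sym.word_val_cong [of n] braid_eq.refl sym_word_val [of _ n] braid_eq_words
    by (auto simp: image_iff)
  then show ?thesis by (simp add: braid_perm_def)
qed

lemma braid_perm_hom: "group_hom (braid_group n) (sym_group n) braid_perm"
proof -
  have "braid_perm \<in> hom (braid_group n) (sym_group n)"
  proof (rule homI)
    fix x y assume "x \<in> carrier (braid_group n)" "y \<in> carrier (braid_group n)"
    then show "braid_perm x \<in> carrier (sym_group n)"
      "braid_perm (x \<otimes>\<^bsub>braid_group n\<^esub> y) = braid_perm x \<otimes>\<^bsub>sym_group n\<^esub> braid_perm y"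
      by (auto simp: carrier_braid_group braid_class_mult braid_perm_class simp flip: sym_word_val)
  qed
  then show ?thesis by (simp add: group_hom_def group_hom_axioms_def sym_group_is_group)
qed

lemma mem_pure_braid_group:
  "x \<in> pure_braid_group n \<longleftrightarrow> (\<exists>w\<in>braid_words n. word_perm w = id \<and> x = braid_class n w)"
  by (auto simp: pure_braid_group_def kernel_def carrier_braid_group braid_perm_class sym_group_one)

lemma pure_braid_group_normal: "pure_braid_group n \<lhd> braid_group n"
  unfolding pure_braid_group_def by (rule group_hom.normal_kernel [OF braid_perm_hom])

lemma pure_commutator_normal: "pure_commutator n \<lhd> braid_group n"
  unfolding pure_commutator_def by (rule group.derived_is_normal [OF group_braid_group pure_braid_group_normal])

section \<open>Generators of the pure braid group\<close>

locale coxeter_representation = braid_representation +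
  assumes gen_involution: "i \<in> {1..<n} \<Longrightarrow> s i \<otimes> s i = \<one>"
begin

lemma inv_gen [simp]: "1 \<le> i \<Longrightarrow> i < n \<Longrightarrow> inv s i = s i"
  using gen_involution [of i] by (intro inv_equality) auto

text \<open>The word \<open>\<sigma>\<^bsub>k-1\<^esub> \<sigma>\<^bsub>k-2\<^esub> \<cdots> \<sigma>\<^sub>j\<close>, empty for \<open>j = k\<close>. Its permutation sends \<open>j\<close> to \<open>k\<close>, so these words
represent the cosets of the symmetric group on \<open>k - 1\<close> letters in that on \<open>k\<close> letters.\<close>

definition descent :: "nat \<Rightarrow> nat \<Rightarrow> braid_word" where
  "descent k j = map (\<lambda>i. (i, True)) (rev [j..<k])"

lemma descent_step: "j < k \<Longrightarrow> descent k j = descent k (Suc j) @ [(j, True)]"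
  by (simp add: descent_def upt_conv_Cons)

lemma descent_words [simp]: "\<lbrakk>1 \<le> j; k \<le> n\<rbrakk> \<Longrightarrow> descent k j \<in> braid_words n"
  by (auto simp: descent_def braid_words_def in_lists_conv_set)

lemma val_descent_step:
  "\<lbrakk>1 \<le> j; j < k; k \<le> n\<rbrakk> \<Longrightarrow> word_val (descent k j) = word_val (descent k (Suc j)) \<otimes> s j"
  by (simp add: descent_step)

lemma val_descent_refl [simp]: "word_val (descent k k) = \<one>"
  by (simp add: descent_def)

lemma descent_commute:
  assumes "1 \<le> i" "k \<le> n" "j \<le> k" "Suc i < j"
  shows "s i \<otimes> word_val (descent k j) = word_val (descent k j) \<otimes> s i"
  using assms(3,4)
proof (induction j rule: inc_induct)
  case base
  then show ?case using assms by simp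
next
  case (step j)
  then show ?case using assms gen_far [of i j]
    by (simp add: val_descent_step commute_mult)
qed

lemma descent_shift:
  assumes "i < k" "k \<le> n" "j < i" "1 \<le> j"
  shows "word_val (descent k j) \<otimes> s i = s (i - 1) \<otimes> word_val (descent k j)"
proof -
  obtain m where i: "i = Suc m" using assms by (cases i) auto
  have "j \<le> m" using assms i by simp
  then show ?thesis
  proof (induction j rule: inc_induct)
    case base
    let ?D = "word_val (descent k (Suc (Suc m)))"
    have D: "?D \<in> carrier G" using assms by simp
    have D': "word_val (descent k m) = ?D \<otimes> s (Suc m) \<otimes> s m"
      using assms i by (simp add: val_descent_step)
    have "word_val (descent k m) \<otimes> s i = ?D \<otimes> (s (Suc m) \<otimes> s m \<otimes> s (Suc m))"
      using assms i D by (simp add: D' m_assoc)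
    also have "\<dots> = ?D \<otimes> (s m \<otimes> s (Suc m) \<otimes> s m)"
      using gen_braid [of m] assms i by simp
    also have "\<dots> = (?D \<otimes> s m) \<otimes> s (Suc m) \<otimes> s m" using D assms i by (simp add: m_assoc)
    \<comment> \<open>\<open>s m\<close> is too far below the letters of \<open>?D\<close>, all at least \<open>m + 2\<close>, to interact with them\<close>
    also have "?D \<otimes> s m = s m \<otimes> ?D" using descent_commute [of m k "Suc (Suc m)"] assms i by simp
    finally show ?case using D assms i by (simp add: D' m_assoc)
  next
    case (step l)
    then have "1 \<le> l" using assms by simp
    then have "word_val (descent k l) \<otimes> s i = word_val (descent k (Suc l)) \<otimes> (s l \<otimes> s i)"
      using step assms i by (simp add: val_descent_step m_assoc)
    also have "s l \<otimes> s i = s i \<otimes> s l" using gen_far [of l i] step \<open>1 \<le> l\<close> assms i by simp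
    also have "word_val (descent k (Suc l)) \<otimes> (s i \<otimes> s l) = (word_val (descent k (Suc l)) \<otimes> s i) \<otimes> s l"
      using step.hyps \<open>1 \<le> l\<close> assms i by (simp add: m_assoc)
    also have "\<dots> = (s (i - 1) \<otimes> word_val (descent k (Suc l))) \<otimes> s l" by (simp only: step.IH)
    also have "\<dots> = s (i - 1) \<otimes> word_val (descent k l)"
      using step \<open>1 \<le> l\<close> assms i by (simp add: val_descent_step m_assoc)
    finally show ?case .
  qed
qed

text \<open>The products of a word on \<open>k - 1\<close> strands with some \<open>descent k j\<close> are closed under right multiplication
by a generator \<open>\<sigma>\<^sub>i\<close>. It passes to the left of the descent if \<open>i + 1 < j\<close>, lengthens it if \<open>i + 1 = j\<close>,
cancels its last letter if \<open>i = j\<close>, and passes to the left as \<open>\<sigma>\<^bsub>i-1\<^esub>\<close> if \<open>j < i\<close>.\<close>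

lemma normal_form:
  assumes k: "1 \<le> k" "k \<le> n" and w: "w \<in> braid_words k"
  shows "\<exists>j\<in>{1..k}. \<exists>u\<in>braid_words (k - 1). word_val w = word_val u \<otimes> word_val (descent k j)"
  using w
proof (induction w rule: rev_induct)
  case Nil
  show ?case using k by (intro bexI [of _ k] bexI [of _ "[]"]) auto
next
  case (snoc l w)
  have mono: "u \<in> braid_words n" if "u \<in> braid_words (k - 1)" for u
    using that k by (fastforce simp: braid_words_def in_lists_conv_set)
  have monok: "u \<in> braid_words n" if "u \<in> braid_words k" for u
    using that k by (fastforce simp: braid_words_def in_lists_conv_set)
  obtain i b where l: "l = (i, b)" by force
  then have i: "1 \<le> i" "i < k" "i < n" using snoc.prems k by auto
  from snoc obtain j u where j: "1 \<le> j" "j \<le> k" and u: "u \<in> braid_words (k - 1)"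
    and w: "word_val w = word_val u \<otimes> word_val (descent k j)" by auto
  have "letter_val l = s i" using i by (cases b) (auto simp: l)
  then have wl: "word_val (w @ [l]) = word_val u \<otimes> (word_val (descent k j) \<otimes> s i)"
    using monok [of w] mono [OF u] snoc.prems i j k by (simp add: l w m_assoc)
  consider "Suc i < j" | "Suc i = j" | "i = j" | "j < i" by linarith
  then show ?case
  proof cases
    case 1
    with descent_commute [of i k j] i j k have "word_val (descent k j) \<otimes> s i = s i \<otimes> word_val (descent k j)" by simp
    then have "word_val (w @ [l]) = word_val (u @ [(i, True)]) \<otimes> word_val (descent k j)"
      using wl mono [OF u] i j k by (simp add: m_assoc)
    then show ?thesis using j u i 1 by (intro bexI [of _ j] bexI [of _ "u @ [(i, True)]"]) auto
  next
    case 2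
    then have "word_val (w @ [l]) = word_val u \<otimes> word_val (descent k i)"
      using wl i j k by (simp add: val_descent_step)
    then show ?thesis using u i by (intro bexI [of _ i] bexI [of _ u]) auto
  next
    case 3
    then have "word_val (descent k j) \<otimes> s i = word_val (descent k (Suc i))"
      using i j k gen_involution [of i] by (simp add: val_descent_step m_assoc)
    then have "word_val (w @ [l]) = word_val u \<otimes> word_val (descent k (Suc i))"
      using wl by simp
    then show ?thesis using u i by (intro bexI [of _ "Suc i"] bexI [of _ u]) auto
  next
    case 4
    then have "Suc 0 \<le> i - Suc 0" "i - Suc 0 < n" using i j by simp_all
    with 4 have "word_val (w @ [l]) = word_val (u @ [(i - 1, True)]) \<otimes> word_val (descent k j)"
      using wl mono [OF u] descent_shift [of i k j] i j k by (simp add: m_assoc)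
    then show ?thesis using j u i 4 by (intro bexI [of _ j] bexI [of _ "u @ [(i - 1, True)]"]) auto
  qed
qed

end

lemma word_perm_append [simp]: "word_perm (u @ v) = word_perm u \<circ> word_perm v"
  by (induction u) (auto simp: comp_assoc)

lemma word_perm_above: "\<lbrakk>w \<in> braid_words m; m < k\<rbrakk> \<Longrightarrow> word_perm w k = k"
  by (induction w) auto

lemma braid_words_le_1: "\<lbrakk>w \<in> braid_words m; m \<le> 1\<rbrakk> \<Longrightarrow> w = []"
  by (cases w) auto

lemma braid_representation_DirProd:
  assumes "braid_representation G n s" "braid_representation H n t"
  shows "braid_representation (G \<times>\<times> H) n (\<lambda>i. (s i, t i))"
proof -
  interpret G: braid_representation G n s by fact
  interpret H: braid_representation H n t by fact
  interpret group "G \<times>\<times> H" by (simp add: DirProd_group G.group_axioms H.group_axioms)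
  show ?thesis
    by unfold_locales (use G.gen_far H.gen_far G.gen_braid H.gen_braid in \<open>auto simp: DirProd_def\<close>)
qed

lemma transpose_involution: "Transposition.transpose i (Suc i) \<otimes>\<^bsub>sym_group n\<^esub> Transposition.transpose i (Suc i) = \<one>\<^bsub>sym_group n\<^esub>"
  by (simp add: sym_group_mult sym_group_one)

text \<open>The Coxeter relations present the symmetric group: a word with trivial permutation has value one.
In the normal form \<open>u \<cdot> descent k j\<close> the permutation of \<open>u\<close> fixes \<open>k\<close>, so a trivial permutation forces
\<open>j = k\<close>, and the word can be replaced by one on fewer strands.\<close>

lemma (in coxeter_representation) word_val_eq_one:
  assumes "w \<in> braid_words n" "word_perm w = id"
  shows "word_val w = \<one>"
proof -
  let ?S = "sym_group n" and ?t = "\<lambda>i. Transposition.transpose i (Suc i)"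
  interpret S: braid_representation ?S n ?t by (rule sym_representation)
  \<comment> \<open>Working in the product with the symmetric group makes the normal form hold for the value and
    for the permutation of a word at the same time.\<close>
  interpret P: braid_representation "G \<times>\<times> ?S" n "\<lambda>i. (s i, ?t i)"
    by (intro braid_representation_DirProd braid_representation_axioms sym_representation)
  interpret P: coxeter_representation "G \<times>\<times> ?S" n "\<lambda>i. (s i, ?t i)"
    by unfold_locales (auto simp: gen_involution transpose_involution)
  have P: "P.word_val w = (word_val w, word_perm w)" if "w \<in> braid_words n" for w
    using that
  proof (induction w)
    case (Cons l w)
    obtain i b where l: "l = (i, b)" by force
    have "P.letter_val l = (s i, ?t i)" "letter_val l = s i" 
      using Cons.prems P.inv_gen inv_gen by (cases b; auto simp: l)+
    then show ?case using Cons by (simp add: l sym_group_mult fun_eq_iff)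
  qed (simp add: sym_group_one)
  have descent_perm: "word_perm (descent k j) j = k" if "j \<le> k" for j k
    using that by (induction j rule: inc_induct) (auto simp: descent_step, simp add: descent_def)
  have "word_val w = \<one>" if "k \<le> n" "w \<in> braid_words k" "word_perm w = id" for k
    using that
  proof (induction k arbitrary: w)
    case 0
    then show ?case using braid_words_le_1 [of w 0] by simp
  next
    case (Suc k)
    have mono: "u \<in> braid_words n" if "u \<in> braid_words k" for u
      using that Suc.prems(1) by (fastforce simp: braid_words_def in_lists_conv_set)
    have monok: "w \<in> braid_words n"
      using Suc.prems by (fastforce simp: braid_words_def in_lists_conv_set)
    have "P.descent = descent" by (intro ext) (simp add: P.descent_def descent_def)
    with P.normal_form [of "Suc k" w] Suc.prems obtain j u where j: "1 \<le> j" "j \<le> Suc k"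
      and u: "u \<in> braid_words k"
      and w: "P.word_val w = P.word_val u \<otimes>\<^bsub>G \<times>\<times> ?S\<^esub> P.word_val (descent (Suc k) j)" by auto
    have val: "word_val w = word_val u \<otimes> word_val (descent (Suc k) j)"
      and perm: "word_perm w = word_perm u \<circ> word_perm (descent (Suc k) j)"
      using w monok mono [OF u] j Suc.prems(1) by (auto simp: P sym_group_mult)
    have "word_perm w j = Suc k"
      unfolding perm using descent_perm [OF j(2)] word_perm_above [OF u] by simp
    then have jk: "j = Suc k" using Suc.prems by simp
    then have "word_perm w = word_perm u" by (simp add: perm descent_def)
    then have "word_perm u = id" using Suc.prems(3) by metis
    then show ?case using Suc.IH [of u] u Suc.prems(1) val mono [OF u] by (simp add: jk)
  qed
  then show ?thesis using assms by blast
qed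

definition gen_conjugates :: "nat \<Rightarrow> braid_word set set" where
  "gen_conjugates n = {g \<otimes>\<^bsub>braid_group n\<^esub> (x \<otimes>\<^bsub>braid_group n\<^esub> x) \<otimes>\<^bsub>braid_group n\<^esub> inv\<^bsub>braid_group n\<^esub> g | g x i.
     g \<in> carrier (braid_group n) \<and> i \<in> {1..<n} \<and> x = braid_class n [(i, True)]}"

lemma braid_group_representation: "braid_representation (braid_group n) n (\<lambda>i. braid_class n [(i, True)])"
proof -
  interpret group "braid_group n" by simp
  show ?thesis
    by unfold_locales (auto simp: braid_class_mult braid_class_eq_iff braid_eq.far braid_eq.braid [simplified])
qed

interpretation B: braid_representation "braid_group n" n "\<lambda>i. braid_class n [(i, True)]" for n
  by (rule braid_group_representation)

lemma inv_braid_class_gen: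
  assumes "1 \<le> i" "i < n"
  shows "inv\<^bsub>braid_group n\<^esub> braid_class n [(i, True)] = braid_class n [(i, False)]"
  using assms braid_eq.cancel [of i n False]
  by (intro B.inv_equality) (auto simp: braid_class_mult one_braid_group braid_class_eq_iff)

lemma B_word_val: "w \<in> braid_words n \<Longrightarrow> B.word_val n w = braid_class n w"
proof (induction w)
  case (Cons l w)
  then show ?case
    by (cases l; cases "snd l") (auto simp: inv_braid_class_gen braid_class_mult)
qed (simp add: one_braid_group)

text \<open>The quotient of the braid group by the normal closure of the squares of its generators satisfies the
Coxeter relations, so a pure braid is trivial there.\<close>

lemma pure_braid_group_generated: "pure_braid_group n \<subseteq> generate (braid_group n) (gen_conjugates n)"
proof
  let ?B = "braid_group n"
  let ?N = "generate ?B (gen_conjugates n)"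
  let ?q = "\<lambda>x. ?N #>\<^bsub>?B\<^esub> x"
  have sub: "gen_conjugates n \<subseteq> carrier ?B" by (auto simp: gen_conjugates_def)
  have N: "?N \<lhd> ?B"
  proof (rule B.normal_generateI [OF sub])
    fix h g assume "h \<in> gen_conjugates n" and g: "g \<in> carrier ?B"
    then obtain g' x i where h: "h = g' \<otimes>\<^bsub>?B\<^esub> (x \<otimes>\<^bsub>?B\<^esub> x) \<otimes>\<^bsub>?B\<^esub> inv\<^bsub>?B\<^esub> g'" and i: "i \<in> {1..<n}"
      and g': "g' \<in> carrier ?B" and x: "x = braid_class n [(i, True)]" by (auto simp: gen_conjugates_def)
    have "x \<in> carrier ?B" using i x by simp
    then have "g \<otimes>\<^bsub>?B\<^esub> h \<otimes>\<^bsub>?B\<^esub> inv\<^bsub>?B\<^esub> g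
        = (g \<otimes>\<^bsub>?B\<^esub> g') \<otimes>\<^bsub>?B\<^esub> (x \<otimes>\<^bsub>?B\<^esub> x) \<otimes>\<^bsub>?B\<^esub> inv\<^bsub>?B\<^esub> (g \<otimes>\<^bsub>?B\<^esub> g')"
      using g g' by (simp add: h B.inv_mult_group B.m_assoc)
    then show "g \<otimes>\<^bsub>?B\<^esub> h \<otimes>\<^bsub>?B\<^esub> inv\<^bsub>?B\<^esub> g \<in> gen_conjugates n"
      using g g' i x by (auto simp: gen_conjugates_def)
  qed
  interpret N: normal ?N ?B by (rule N)
  interpret Q: group "?B Mod ?N" by (rule N.factorgroup_is_group)
  have q: "?q \<in> hom ?B (?B Mod ?N)" by (rule N.r_coset_hom_Mod)
  interpret q: group_hom ?B "?B Mod ?N" ?q by unfold_locales (rule q)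
  interpret Q: braid_representation "?B Mod ?N" n "\<lambda>i. ?q (braid_class n [(i, True)])"
  proof
    fix i j :: nat assume "i \<in> {1..<n}" "j \<in> {1..<n}" "i + 2 \<le> j"
    then show "?q (braid_class n [(i, True)]) \<otimes>\<^bsub>?B Mod ?N\<^esub> ?q (braid_class n [(j, True)])
        = ?q (braid_class n [(j, True)]) \<otimes>\<^bsub>?B Mod ?N\<^esub> ?q (braid_class n [(i, True)])"
      using arg_cong [OF B.gen_far, of i n j ?q] by (simp del: mult_FactGroup)
  next
    fix i :: nat assume "i \<in> {1..<n}" "i + 1 \<in> {1..<n}"
    then show "?q (braid_class n [(i, True)]) \<otimes>\<^bsub>?B Mod ?N\<^esub> ?q (braid_class n [(i + 1, True)])
          \<otimes>\<^bsub>?B Mod ?N\<^esub> ?q (braid_class n [(i, True)])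
        = ?q (braid_class n [(i + 1, True)]) \<otimes>\<^bsub>?B Mod ?N\<^esub> ?q (braid_class n [(i, True)])
          \<otimes>\<^bsub>?B Mod ?N\<^esub> ?q (braid_class n [(i + 1, True)])"
      using arg_cong [OF B.gen_braid, of i n ?q] by (simp del: mult_FactGroup)
  qed (simp add: q.hom_closed)
  have square: "?q (braid_class n [(i, True)] \<otimes>\<^bsub>?B\<^esub> braid_class n [(i, True)]) = \<one>\<^bsub>?B Mod ?N\<^esub>" if i: "i \<in> {1..<n}" for i
  proof -
    have "braid_class n [(i, True)] \<otimes>\<^bsub>?B\<^esub> braid_class n [(i, True)] \<in> gen_conjugates n"
      unfolding gen_conjugates_def
      by (rule CollectI, rule exI [of _ "\<one>\<^bsub>?B\<^esub>"], rule exI [of _ "braid_class n [(i, True)]"], rule exI [of _ i])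
        (use i in simp)
    then show ?thesis by (simp add: N.rcos_const [OF group_braid_group] generate.incl)
  qed
  interpret Q: coxeter_representation "?B Mod ?N" n "\<lambda>i. ?q (braid_class n [(i, True)])"
    by unfold_locales (use square in \<open>simp del: mult_FactGroup one_FactGroup flip: q.hom_mult\<close>)
  have val: "Q.word_val w = ?q (braid_class n w)" if "w \<in> braid_words n" for w
    using that
  proof (induction w)
    case (Cons l w)
    obtain i b where l: "l = (i, b)" by force
    have "Q.letter_val l = ?q (braid_class n [l])"
    proof (cases b)
      case False
      then show ?thesis using Cons.prems q.hom_inv [of "braid_class n [(i, True)]"]
        by (simp add: l inv_braid_class_gen)
    qed (simp add: l)
    then show ?case using Cons q.hom_mult [of "braid_class n [l]" "braid_class n w"]
      by (simp add: l braid_class_mult del: mult_FactGroup)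
  next
    case Nil
    then show ?case using q.hom_one by (simp add: one_braid_group)
  qed
  fix x assume "x \<in> pure_braid_group n"
  then obtain w where w: "w \<in> braid_words n" "word_perm w = id" "x = braid_class n w"
    by (auto simp: mem_pure_braid_group)
  then have "?q x = ?N" using Q.word_val_eq_one [of w] val [of w] by simp
  then show "x \<in> ?N"
    using group.coset_join1 [OF group_braid_group, where H = ?N and x = x] w N.subgroup_axioms by simp
qed

section \<open>Pure braids commute in pseudosymmetric representations\<close>

locale pseudosymmetric_representation = braid_representation +
  assumes gen_pseudo: "\<lbrakk>i \<in> {1..<n}; i + 1 \<in> {1..<n}\<rbrakk>
      \<Longrightarrow> s i \<otimes> inv s (i + 1) \<otimes> s i = s (i + 1) \<otimes> inv s i \<otimes> s (i + 1)"
begin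

text \<open>The image of the pure braid \<open>A\<^bsub>i,j\<^esub>\<close> for \<open>j = i + d + 1\<close>, in which strands \<open>i\<close> and \<open>j\<close> are linked once and
every other strand goes straight. The next lemmas compute its conjugates by the generators \<open>\<sigma>\<^sub>k\<close>,
according to the position of \<open>k\<close> relative to \<open>i\<close> and \<open>j\<close>.\<close>

fun band :: "nat \<Rightarrow> nat \<Rightarrow> 'a" where
  "band i 0 = s i \<otimes> s i"
| "band i (Suc d) = s (i + d + 1) \<otimes> band i d \<otimes> inv s (i + d + 1)"

lemma band_closed [simp]: "\<lbrakk>1 \<le> i; i + d < n\<rbrakk> \<Longrightarrow> band i d \<in> carrier G"
  by (induction d) auto

lemma gen_commute: "\<lbrakk>1 \<le> i; 1 \<le> j; i < n; j < n; i + 1 < j \<or> j + 1 < i\<rbrakk> \<Longrightarrow> s i \<otimes> s j = s j \<otimes> s i"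
  using gen_far [of i j] gen_far [of j i] by (cases "i < j") auto

lemma squares_commute:
  assumes "1 \<le> i" "i + 1 < n"
  shows "(s i \<otimes> s i) \<otimes> (s (i + 1) \<otimes> s (i + 1)) = (s (i + 1) \<otimes> s (i + 1)) \<otimes> (s i \<otimes> s i)"
  using pseudosymmetric_iff_squares_commute [of "s i" "s (i + 1)"] gen_braid [of i] gen_pseudo [of i] assms
  by simp

lemma band_far:
  assumes "1 \<le> i" "i + d < n" "1 \<le> k" "k < n" "k + 1 < i \<or> i + d + 1 < k"
  shows "s k \<otimes> band i d = band i d \<otimes> s k"
  using assms
proof (induction d)
  case 0
  then show ?case using gen_commute [of k i] commute_mult [of "s k" "s i" "s i"] by auto
next
  case (Suc d)
  then show ?case using gen_commute [of k "i + d + 1"] by (auto intro!: conj_intertwine)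
qed

lemma band_right_up:
  assumes "1 \<le> i" "i + d + 1 < n"
  shows "s (i + d + 1) \<otimes> band i d = band i (Suc d) \<otimes> s (i + d + 1)"
  using assms by (simp add: m_assoc)

text \<open>This gives \<open>\<sigma>\<^sub>j A\<^bsub>i,j+1\<^esub> \<sigma>\<^sub>j\<^sup>-\<^sup>1 = A\<^bsub>i,j\<^esub>\<close>, the inverse direction of the recursion for \<open>A\<^bsub>i,j+1\<^esub>\<close>. In the induction step
the claim for \<open>b = \<sigma>\<^bsub>j+1\<^esub>\<close> and \<open>a x a\<^sup>-\<^sup>1\<close>, where \<open>a = \<sigma>\<^sub>j\<close> and \<open>x = A\<^bsub>i,j\<^esub>\<close>, is conjugated by \<open>a\<^sup>-\<^sup>1\<close>. By the
braid relation \<open>a\<^sup>-\<^sup>1 b\<^sup>2 a = b a\<^sup>2 b\<^sup>-\<^sup>1\<close>, and \<open>b\<close> commutes with \<open>x\<close>, so what remains is the induction hypothesis.\<close>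

lemma square_band_right:
  assumes "1 \<le> i" "i + d + 1 < n"
  shows "(s (i + d + 1) \<otimes> s (i + d + 1)) \<otimes> band i d = band i d \<otimes> (s (i + d + 1) \<otimes> s (i + d + 1))"
  using assms
proof (induction d)
  case 0
  then show ?case using squares_commute [of i] by simp
next
  case (Suc d)
  define a b x where "a = s (i + d + 1)" and "b = s (i + d + 2)" and "x = band i d"
  have cl: "a \<in> carrier G" "b \<in> carrier G" "x \<in> carrier G"
    using Suc.prems by (simp_all add: a_def b_def x_def)
  have br: "b \<otimes> a \<otimes> b = a \<otimes> b \<otimes> a"
    using gen_braid [of "i + d + 1"] Suc.prems by (simp add: a_def b_def)
  have IH: "(a \<otimes> a) \<otimes> x = x \<otimes> (a \<otimes> a)" using Suc by (simp add: a_def x_def)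
  have far: "b \<otimes> x = x \<otimes> b" using band_far [of i d "i + d + 2"] Suc.prems by (simp add: b_def x_def)
  have "(b \<otimes> b) \<otimes> (a \<otimes> x \<otimes> inv a) = (a \<otimes> x \<otimes> inv a) \<otimes> (b \<otimes> b)
    \<longleftrightarrow> (inv a \<otimes> (b \<otimes> b) \<otimes> a) \<otimes> x = x \<otimes> (inv a \<otimes> (b \<otimes> b) \<otimes> a)"
    by (rule commute_conj_iff) (use cl in simp_all)
  also have "inv a \<otimes> (b \<otimes> b) \<otimes> a = b \<otimes> (a \<otimes> a) \<otimes> inv b"
    by (rule braid_conj_square) (use cl br in simp_all)
  finally have *: "(b \<otimes> b) \<otimes> (a \<otimes> x \<otimes> inv a) = (a \<otimes> x \<otimes> inv a) \<otimes> (b \<otimes> b)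
    \<longleftrightarrow> b \<otimes> (a \<otimes> a) \<otimes> inv b \<otimes> x = x \<otimes> (b \<otimes> (a \<otimes> a) \<otimes> inv b)" .
  have "x \<otimes> (b \<otimes> (a \<otimes> a) \<otimes> inv b) = (b \<otimes> (a \<otimes> a) \<otimes> inv b) \<otimes> x"
    by (rule conj_intertwine) (use cl IH far in simp_all)
  then show ?case using * by (simp add: a_def b_def x_def)
qed

lemma band_right_down:
  assumes "1 \<le> i" "i + d + 1 < n"
  shows "s (i + d + 1) \<otimes> band i (Suc d) = band i d \<otimes> s (i + d + 1)"
proof -
  let ?a = "s (i + d + 1)" and ?x = "band i d"
  have cl: "?a \<in> carrier G" "?x \<in> carrier G" using assms by simp_all
  have "?a \<otimes> band i (Suc d) = (?a \<otimes> ?a) \<otimes> ?x \<otimes> inv ?a" using cl by (simp add: m_assoc)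
  also have "\<dots> = ?x \<otimes> ?a" unfolding square_band_right [OF assms] using cl by (simp add: m_assoc)
  finally show ?thesis .
qed

lemma band_left_up:
  assumes "1 \<le> i" "i + d + 1 < n"
  shows "s i \<otimes> band i (Suc d) = band (i + 1) d \<otimes> s i"
  using assms
proof (induction d)
  case 0
  define a b where "a = s i" and "b = s (i + 1)"
  have cl: "a \<in> carrier G" "b \<in> carrier G" using 0 by (simp_all add: a_def b_def)
  have br: "a \<otimes> b \<otimes> a = b \<otimes> a \<otimes> b" using gen_braid [of i] 0 by (simp add: a_def b_def)
  have "a \<otimes> (b \<otimes> (a \<otimes> a) \<otimes> inv b) = (a \<otimes> b \<otimes> a) \<otimes> a \<otimes> inv b" using cl by (simp add: m_assoc)
  also have "\<dots> = (b \<otimes> a \<otimes> b) \<otimes> a \<otimes> inv b" by (simp only: br)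
  also have "\<dots> = b \<otimes> (a \<otimes> b \<otimes> a) \<otimes> inv b" using cl by (simp add: m_assoc)
  also have "\<dots> = (b \<otimes> b) \<otimes> a" unfolding br using cl by (simp add: m_assoc)
  finally show ?case by (simp add: a_def b_def)
next
  case (Suc d)
  have "s i \<otimes> (s (i + d + 2) \<otimes> band i (Suc d) \<otimes> inv s (i + d + 2))
      = (s (i + d + 2) \<otimes> band (i + 1) d \<otimes> inv s (i + d + 2)) \<otimes> s i"
    by (rule conj_intertwine) (use Suc gen_commute [of i "i + d + 2"] in \<open>simp_all del: band.simps\<close>)
  then show ?case by simp
qed

lemma band_left_down:
  assumes "1 \<le> i" "i + d + 1 < n"
  shows "s i \<otimes> band (i + 1) d = band i (Suc d) \<otimes> s i"
  using assms
proof (induction d)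
  case 0
  define a b where "a = s i" and "b = s (i + 1)"
  have cl: "a \<in> carrier G" "b \<in> carrier G" using 0 by (simp_all add: a_def b_def)
  have br: "b \<otimes> a \<otimes> b = a \<otimes> b \<otimes> a" using gen_braid [of i] 0 by (simp add: a_def b_def)
  have ps: "a \<otimes> inv b \<otimes> a = b \<otimes> inv a \<otimes> b" using gen_pseudo [of i] 0 by (simp add: a_def b_def)
  have "b \<otimes> (a \<otimes> a) \<otimes> inv b \<otimes> a = b \<otimes> a \<otimes> (a \<otimes> inv b \<otimes> a)" using cl by (simp add: m_assoc)
  also have "\<dots> = (b \<otimes> a \<otimes> b) \<otimes> inv a \<otimes> b" unfolding ps using cl by (simp add: m_assoc)
  also have "\<dots> = a \<otimes> (b \<otimes> b)" unfolding br using cl by (simp add: m_assoc inv_mult_cancel)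
  finally show ?case by (simp add: a_def b_def)
next
  case (Suc d)
  have "s i \<otimes> (s (i + d + 2) \<otimes> band (i + 1) d \<otimes> inv s (i + d + 2))
      = (s (i + d + 2) \<otimes> band i (Suc d) \<otimes> inv s (i + d + 2)) \<otimes> s i"
    by (rule conj_intertwine) (use Suc gen_commute [of i "i + d + 2"] in \<open>simp_all del: band.simps\<close>)
  then show ?case by simp
qed

lemma band_inner:
  assumes "1 \<le> i" "i + d + e + 2 < n"
  shows "s (i + e + 1) \<otimes> band i (e + 2 + d) = band i (e + 2 + d) \<otimes> s (i + e + 1)"
  using assms
proof (induction d)
  case 0
  define a b x where "a = s (i + e + 1)" and "b = s (i + e + 2)" and "x = band i e"
  have cl: "a \<in> carrier G" "b \<in> carrier G" "x \<in> carrier G"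
    using 0 by (simp_all add: a_def b_def x_def)
  have br: "a \<otimes> b \<otimes> a = b \<otimes> a \<otimes> b" using gen_braid [of "i + e + 1"] 0 by (simp add: a_def b_def)
  have far: "b \<otimes> x = x \<otimes> b" using band_far [of i e "i + e + 2"] 0 by (simp add: b_def x_def)
  have x: "band i (e + 2 + 0) = b \<otimes> (a \<otimes> x \<otimes> inv a) \<otimes> inv b"
    by (simp add: a_def b_def x_def)
  have "a \<otimes> (b \<otimes> (a \<otimes> x \<otimes> inv a) \<otimes> inv b) = (a \<otimes> b \<otimes> a) \<otimes> x \<otimes> inv (b \<otimes> a)"
    using cl by (simp add: m_assoc inv_mult_group)
  also have "\<dots> = b \<otimes> a \<otimes> (b \<otimes> x) \<otimes> inv (b \<otimes> a)" unfolding br using cl by (simp add: m_assoc)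
  also have "\<dots> = (b \<otimes> a \<otimes> x) \<otimes> inv (b \<otimes> a) \<otimes> ((b \<otimes> a) \<otimes> b \<otimes> inv (b \<otimes> a))"
    unfolding far using cl by (simp add: m_assoc inv_mult_group inv_mult_cancel)
  also have "(b \<otimes> a) \<otimes> b \<otimes> inv (b \<otimes> a) = a"
    unfolding br [symmetric] using cl by (simp add: m_assoc inv_mult_group inv_mult_cancel)
  finally show ?case unfolding x a_def [symmetric] using cl by (simp add: m_assoc inv_mult_group)
next
  case (Suc d)
  have "s (i + e + 1) \<otimes> (s (i + e + d + 3) \<otimes> band i (e + 2 + d) \<otimes> inv s (i + e + d + 3))
      = (s (i + e + d + 3) \<otimes> band i (e + 2 + d) \<otimes> inv s (i + e + d + 3)) \<otimes> s (i + e + 1)"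
    by (rule conj_intertwine) (use Suc gen_commute [of "i + e + 1" "i + e + d + 3"] in \<open>simp_all del: band.simps\<close>)
  then show ?case by (simp add: eval_nat_numeral add_ac)
qed

definition bands :: "'a set" where
  "bands = {band i d | i d. 1 \<le> i \<and> i + d < n}"

lemma bands_closed: "x \<in> bands \<Longrightarrow> x \<in> carrier G"
  by (auto simp: bands_def)

text \<open>The generator \<open>\<sigma>\<^sub>k\<close> acts on the pairs of strands as the transposition of \<open>k\<close> and \<open>k + 1\<close>. That it is an
involution on the bands is what makes its square central among them.\<close>

lemma gen_permutes_bands:
  assumes k: "1 \<le> k" "k < n" and x: "x \<in> bands"
  shows "\<exists>y\<in>bands. s k \<otimes> x = y \<otimes> s k \<and> s k \<otimes> y = x \<otimes> s k"
proof -
  obtain i d where x: "x = band i d" and i: "1 \<le> i" "i + d < n" using x by (auto simp: bands_def)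
  have mem: "band j e \<in> bands" if "1 \<le> j" "j + e < n" for j e using that by (auto simp: bands_def)
  \<comment> \<open>With \<open>j = i + d + 1\<close>, the cases are: \<open>k\<close> and \<open>k + 1\<close> outside of \<open>i, \<dots>, j\<close>; \<open>k = i - 1\<close>; \<open>k = i\<close>, with
    \<open>j = i + 1\<close> or not; \<open>k\<close> and \<open>k + 1\<close> strictly between; \<open>k = j - 1 > i\<close>; \<open>k = j\<close>.\<close>
  consider "k + 1 < i \<or> i + d + 1 < k" | "k + 1 = i" | "k = i" "d = 0" | e where "k = i" "d = Suc e"
    | e c where "k = i + e + 1" "d = e + 2 + c" | e where "k = i + e + 1" "d = Suc e" | "k = i + d + 1"
  proof -
    have "\<exists>e. (k = i + e + 1 \<and> (\<exists>c. d = e + 2 + c)) \<or> (k = i + e + 1 \<and> d = Suc e)"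
      if "i < k" "k \<le> i + d"
    proof (cases "k = i + d")
      case True
      with that show ?thesis by (intro exI [of _ "d - 1"]) simp
    next
      case False
      with that have "d = (k - i - 1) + 2 + (i + d - k - 1)" "k = i + (k - i - 1) + 1" by simp_all
      then show ?thesis by blast
    qed
    moreover have "(k + 1 < i \<or> i + d + 1 < k) \<or> k + 1 = i \<or> k = i \<or> (i < k \<and> k \<le> i + d) \<or> k = i + d + 1"
      by linarith
    ultimately show thesis using that by (cases d) blast+
  qed
  then show ?thesis
  proof cases
    case 1
    then show ?thesis using band_far [OF i k] mem [OF i] x by auto
  next
    case 2
    then show ?thesis using band_left_up [of k d] band_left_down [of k d] mem [of k "Suc d"] i k x by fastforce
  next
    case 3
    then show ?thesis using mem [OF i] x k by (intro bexI [of _ x]) (auto simp: m_assoc)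
  next
    case 4
    then show ?thesis using band_left_up [of i e] band_left_down [of i e] mem [of "i + 1" e] i x by fastforce
  next
    case 5
    then show ?thesis using band_inner [of i c e] mem [OF i] i x by fastforce
  next
    case 6
    then show ?thesis using band_right_up [of i e] band_right_down [of i e] mem [of i e] i x by fastforce
  next
    case 7
    then show ?thesis using band_right_up [of i d] band_right_down [of i d] mem [of i "Suc d"] i k x by fastforce
  qed
qed

lemma letter_conj_bands:
  assumes l: "fst l \<in> {1..<n}" and x: "x \<in> bands"
  shows "letter_val l \<otimes> x \<otimes> inv letter_val l \<in> bands"
proof -
  obtain i b where lib: "l = (i, b)" by force
  have i: "1 \<le> i" "i < n" using l lib by auto
  from gen_permutes_bands [OF i x] obtain y where y: "y \<in> bands" "s i \<otimes> x = y \<otimes> s i" "s i \<otimes> y = x \<otimes> s i" by blast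
  have cl: "x \<in> carrier G" "y \<in> carrier G" "s i \<in> carrier G" using x y bands_closed i by auto
  have "s i \<otimes> x \<otimes> inv s i = y" unfolding y(2) using cl by (simp add: m_assoc)
  moreover have "inv s i \<otimes> x \<otimes> s i = y"
    using y(3) cl by (simp add: m_assoc inv_mult_cancel flip: y(3))
  ultimately show ?thesis using y(1) i by (cases b) (auto simp: lib)
qed

lemma word_conj_bands:
  "\<lbrakk>w \<in> braid_words n; x \<in> bands\<rbrakk> \<Longrightarrow> word_val w \<otimes> x \<otimes> inv word_val w \<in> bands"
proof (induction w)
  case Nil
  then show ?case using bands_closed by simp
next
  case (Cons l w)
  then have "letter_val l \<otimes> (word_val w \<otimes> x \<otimes> inv word_val w) \<otimes> inv letter_val l \<in> bands"
    by (intro letter_conj_bands) auto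
  then show ?case using Cons.prems bands_closed by (simp add: m_assoc inv_mult_group)
qed

lemma square_in_bands: "\<lbrakk>1 \<le> i; i < n\<rbrakk> \<Longrightarrow> s i \<otimes> s i \<in> bands"
  unfolding bands_def by (force intro: exI [of _ 0])

lemma square_commutes_band:
  assumes k: "1 \<le> k" "k < n" and x: "x \<in> bands"
  shows "(s k \<otimes> s k) \<otimes> x = x \<otimes> (s k \<otimes> s k)"
proof -
  from gen_permutes_bands [OF k x] obtain y where y: "y \<in> bands" "s k \<otimes> x = y \<otimes> s k" "s k \<otimes> y = x \<otimes> s k" by blast
  have cl: "x \<in> carrier G" "y \<in> carrier G" "s k \<in> carrier G" using x y bands_closed k by auto
  have "(s k \<otimes> s k) \<otimes> x = (s k \<otimes> y) \<otimes> s k" using cl y(2) by (simp add: m_assoc)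
  also have "\<dots> = x \<otimes> (s k \<otimes> s k)" unfolding y(3) using cl by (simp add: m_assoc)
  finally show ?thesis .
qed

text \<open>Conjugating both elements by \<open>u\<^sup>-\<^sup>1\<close> turns the first into a square and keeps the second a band.\<close>

lemma conj_squares_commute:
  assumes "u \<in> braid_words n" "v \<in> braid_words n" "i \<in> {1..<n}" "j \<in> {1..<n}"
  defines "x \<equiv> word_val u \<otimes> (s i \<otimes> s i) \<otimes> inv word_val u"
    and "y \<equiv> word_val v \<otimes> (s j \<otimes> s j) \<otimes> inv word_val v"
  shows "y \<otimes> x = x \<otimes> y"
proof -
  have cl: "word_val u \<in> carrier G" "word_val v \<in> carrier G" "s i \<in> carrier G" "s j \<in> carrier G"
    using assms by simp_all
  have y: "y \<in> bands" unfolding y_def using assms word_conj_bands square_in_bands by simp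
  have inv_u: "inv word_val u = word_val (inverse_word u)"
  proof (rule inv_equality)
    show "word_val (inverse_word u) \<otimes> word_val u = \<one>"
      using word_val_cong [OF inverse_word_cancel [OF assms(1)]] assms(1) by simp
  qed (use assms in simp_all)
  have "inv word_val u \<otimes> y \<otimes> word_val u \<in> bands"
    using word_conj_bands [of "inverse_word u" y] y assms(1) cl by (simp flip: inv_u)
  then have "(inv word_val u \<otimes> y \<otimes> word_val u) \<otimes> (s i \<otimes> s i) = (s i \<otimes> s i) \<otimes> (inv word_val u \<otimes> y \<otimes> word_val u)"
    using square_commutes_band [of i] assms(3) by simp
  then show ?thesis
    unfolding x_def using commute_conj_iff [of y "s i \<otimes> s i" "word_val u"] cl bands_closed [OF y] by simp
qed

lemma pure_commute:
  assumes "u \<in> braid_words n" "v \<in> braid_words n" "word_perm u = id" "word_perm v = id"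
  shows "word_val u \<otimes> word_val v = word_val v \<otimes> word_val u"
proof -
  let ?B = "braid_group n"
  obtain h where h: "h \<in> hom ?B G" "\<And>w. w \<in> braid_words n \<Longrightarrow> h (braid_class n w) = word_val w"
    using ex_braid_hom by blast
  interpret h: group_hom ?B G h by unfold_locales (use h group_braid_group in \<open>auto simp: group_hom_def\<close>)
  have sub: "gen_conjugates n \<subseteq> carrier ?B" by (auto simp: gen_conjugates_def)
  have image: "\<exists>w i. w \<in> braid_words n \<and> i \<in> {1..<n} \<and> y = word_val w \<otimes> (s i \<otimes> s i) \<otimes> inv word_val w"
    if "y \<in> h ` gen_conjugates n" for y
  proof -
    from that obtain w i where w: "w \<in> braid_words n" and i: "i \<in> {1..<n}"
      and y: "y = h (braid_class n w \<otimes>\<^bsub>?B\<^esub> (braid_class n [(i, True)] \<otimes>\<^bsub>?B\<^esub> braid_class n [(i, True)])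
        \<otimes>\<^bsub>?B\<^esub> inv\<^bsub>?B\<^esub> braid_class n w)"
      by (auto simp: gen_conjugates_def carrier_braid_group)
    have "y = word_val w \<otimes> (s i \<otimes> s i) \<otimes> inv word_val w"
      using w i h(2) [of w] h(2) [of "[(i, True)]"] by (simp add: y)
    then show ?thesis using w i by blast
  qed
  have comm: "x \<otimes> y = y \<otimes> x" if x: "x \<in> h ` gen_conjugates n" and y: "y \<in> h ` gen_conjugates n" for x y
    using image [OF x] image [OF y] conj_squares_commute by metis
  have "word_val w \<in> generate G (h ` gen_conjugates n)" if "w \<in> braid_words n" "word_perm w = id" for w
  proof -
    have "braid_class n w \<in> generate ?B (gen_conjugates n)"
      using pure_braid_group_generated [of n] that mem_pure_braid_group by blast
    then have "h (braid_class n w) \<in> generate G (h ` gen_conjugates n)"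
      unfolding h.generate_img [OF sub] by (rule imageI)
    then show ?thesis using that(1) h(2) by simp
  qed
  moreover have "h ` gen_conjugates n \<subseteq> carrier G" using sub h.hom_closed by blast
  ultimately show ?thesis
    using commuting_generate [of "h ` gen_conjugates n" "word_val u" "word_val v", OF _ comm] assms by simp
qed

end

section \<open>The group \<open>PS\<^sub>n\<close> and its presentation\<close>

text \<open>A homomorphism kills \<open>[P\<^sub>n, P\<^sub>n]\<close> as soon as the images of pure braids commute.\<close>

lemma pure_commutator_kernel:
  assumes "group_hom (braid_group n) G h"
    and comm: "\<And>u v. \<lbrakk>u \<in> braid_words n; v \<in> braid_words n; word_perm u = id; word_perm v = id\<rbrakk>
      \<Longrightarrow> h (braid_class n u) \<otimes>\<^bsub>G\<^esub> h (braid_class n v) = h (braid_class n v) \<otimes>\<^bsub>G\<^esub> h (braid_class n u)"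
  shows "pure_commutator n \<subseteq> kernel (braid_group n) G h"
proof -
  interpret h: group_hom "braid_group n" G h by fact
  have "derived_set (braid_group n) (pure_braid_group n) \<subseteq> kernel (braid_group n) G h"
  proof clarify
    fix x y assume "x \<in> pure_braid_group n" "y \<in> pure_braid_group n"
    then have cl: "x \<in> carrier (braid_group n)" "y \<in> carrier (braid_group n)"
      and xy: "h x \<otimes>\<^bsub>G\<^esub> h y = h y \<otimes>\<^bsub>G\<^esub> h x"
      using comm by (auto simp: mem_pure_braid_group)
    have "h x \<otimes>\<^bsub>G\<^esub> h y \<otimes>\<^bsub>G\<^esub> inv\<^bsub>G\<^esub> h x \<otimes>\<^bsub>G\<^esub> inv\<^bsub>G\<^esub> h y = \<one>\<^bsub>G\<^esub>"
      unfolding xy using cl by (simp add: h.H.m_assoc h.H.inv_mult_cancel)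
    then show "x \<otimes>\<^bsub>braid_group n\<^esub> y \<otimes>\<^bsub>braid_group n\<^esub> inv\<^bsub>braid_group n\<^esub> x \<otimes>\<^bsub>braid_group n\<^esub> inv\<^bsub>braid_group n\<^esub> y
        \<in> kernel (braid_group n) G h"
      using cl by (simp add: kernel_def)
  qed
  then show ?thesis
    unfolding pure_commutator_def derived_def
    by (rule group.generate_subgroup_incl [OF group_braid_group _ h.subgroup_kernel])
qed

lemma ex_PS_hom:
  assumes "group_hom (braid_group n) G h"
    and comm: "\<And>u v. \<lbrakk>u \<in> braid_words n; v \<in> braid_words n; word_perm u = id; word_perm v = id\<rbrakk>
      \<Longrightarrow> h (braid_class n u) \<otimes>\<^bsub>G\<^esub> h (braid_class n v) = h (braid_class n v) \<otimes>\<^bsub>G\<^esub> h (braid_class n u)"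
  obtains g where "g \<in> hom (PS_group n) G"
    "\<And>x. x \<in> carrier (braid_group n) \<Longrightarrow> g (PS_class n x) = h x"
proof (rule group_hom.FactGroup_universal_kernel [OF assms(1) pure_commutator_normal pure_commutator_kernel [OF assms]])
  fix g assume "g \<in> hom (braid_group n Mod pure_commutator n) G"
    "\<And>x. x \<in> carrier (braid_group n) \<Longrightarrow> g (pure_commutator n #>\<^bsub>braid_group n\<^esub> x) = h x"
  then show thesis using that [of g] by (simp add: PS_group_def PS_class_def)
qed

interpretation PC: normal "pure_commutator n" "braid_group n" for n
  by (rule pure_commutator_normal)

lemma group_PS_group [simp]: "group (PS_group n)"
  unfolding PS_group_def by (rule PC.factorgroup_is_group)

lemma PS_class_hom: "group_hom (braid_group n) (PS_group n) (PS_class n)"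
proof -
  have "PS_class n \<in> hom (braid_group n) (PS_group n)"
    unfolding PS_group_def using PC.r_coset_hom_Mod [of n] by (simp add: PS_class_def [abs_def])
  then show ?thesis by (simp add: group_hom_def group_hom_axioms_def)
qed

interpretation PS_class: group_hom "braid_group n" "PS_group n" "PS_class n" for n
  by (rule PS_class_hom)

text \<open>The element of \<open>PS\<^sub>n\<close> represented by a word. Every operation on \<open>\<P>\<S>\<close> becomes an operation on words.\<close>

definition PS_word :: "nat \<Rightarrow> braid_word \<Rightarrow> braid_word set set" where
  "PS_word n w = PS_class n (braid_class n w)"

lemma carrier_PS_group: "carrier (PS_group n) = PS_word n ` braid_words n"
  by (auto simp: PS_group_def carrier_FactGroup carrier_braid_group PS_word_def PS_class_def)

lemma PS_word_closed [simp]: "w \<in> braid_words n \<Longrightarrow> PS_word n w \<in> carrier (PS_group n)"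
  by (simp add: carrier_PS_group)

lemma PS_word_mult:
  "\<lbrakk>u \<in> braid_words n; v \<in> braid_words n\<rbrakk> \<Longrightarrow> PS_word n u \<otimes>\<^bsub>PS_group n\<^esub> PS_word n v = PS_word n (u @ v)"
  unfolding PS_word_def by (simp flip: PS_class.hom_mult add: braid_class_mult)

lemma one_PS_group: "\<one>\<^bsub>PS_group n\<^esub> = PS_word n []"
  unfolding PS_word_def using PS_class.hom_one [of n] by (simp add: one_braid_group)

lemma PS_word_cong: "braid_eq n u v \<Longrightarrow> PS_word n u = PS_word n v"
  unfolding PS_word_def using braid_class_eq_iff braid_eq_words by metis

lemma pure_in_PS_commute:
  assumes "u \<in> braid_words n" "v \<in> braid_words n" "word_perm u = id" "word_perm v = id"
  shows "PS_word n u \<otimes>\<^bsub>PS_group n\<^esub> PS_word n v = PS_word n v \<otimes>\<^bsub>PS_group n\<^esub> PS_word n u"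
proof -
  let ?B = "braid_group n" and ?x = "braid_class n u" and ?y = "braid_class n v"
  have cl: "?x \<in> carrier ?B" "?y \<in> carrier ?B" using assms by simp_all
  have "?x \<in> pure_braid_group n" "?y \<in> pure_braid_group n"
    using assms by (auto simp: mem_pure_braid_group)
  then have "?x \<otimes>\<^bsub>?B\<^esub> ?y \<otimes>\<^bsub>?B\<^esub> inv\<^bsub>?B\<^esub> ?x \<otimes>\<^bsub>?B\<^esub> inv\<^bsub>?B\<^esub> ?y \<in> pure_commutator n"
    unfolding pure_commutator_def derived_def by (intro generate.incl) blast
  moreover have "?x \<otimes>\<^bsub>?B\<^esub> ?y \<otimes>\<^bsub>?B\<^esub> inv\<^bsub>?B\<^esub> ?x \<otimes>\<^bsub>?B\<^esub> inv\<^bsub>?B\<^esub> ?y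
      = (?x \<otimes>\<^bsub>?B\<^esub> ?y) \<otimes>\<^bsub>?B\<^esub> inv\<^bsub>?B\<^esub> (?y \<otimes>\<^bsub>?B\<^esub> ?x)"
    using cl by (simp add: B.inv_mult_group B.m_assoc)
  ultimately have "pure_commutator n #>\<^bsub>?B\<^esub> ((?x \<otimes>\<^bsub>?B\<^esub> ?y) \<otimes>\<^bsub>?B\<^esub> inv\<^bsub>?B\<^esub> (?y \<otimes>\<^bsub>?B\<^esub> ?x)) = pure_commutator n"
    using PC.rcos_const [OF group_braid_group] by simp
  then have "PS_class n (?x \<otimes>\<^bsub>?B\<^esub> ?y) = PS_class n (?y \<otimes>\<^bsub>?B\<^esub> ?x)"
    unfolding PS_class_def using cl
    by (intro group.coset_mult_inv1 [OF group_braid_group]) (auto intro: PC.mem_carrier)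
  then show ?thesis using cl by (simp add: PS_word_def)
qed

text \<open>The squares of the generators are pure braids, so they commute in \<open>PS\<^sub>n\<close>.\<close>

lemma PS_representation: "pseudosymmetric_representation (PS_group n) n (\<lambda>i. PS_word n [(i, True)])"
proof -

  interpret braid_representation "PS_group n" n "\<lambda>i. PS_word n [(i, True)]"
    by unfold_locales (auto simp: PS_word_mult intro!: PS_word_cong braid_eq.far braid_eq.braid [simplified])
  show ?thesis
  proof
    fix i assume i: "i \<in> {1..<n}" "i + 1 \<in> {1..<n}"
    then show "PS_word n [(i, True)] \<otimes>\<^bsub>PS_group n\<^esub> inv\<^bsub>PS_group n\<^esub> PS_word n [(i + 1, True)] \<otimes>\<^bsub>PS_group n\<^esub> PS_word n [(i, True)]
      = PS_word n [(i + 1, True)] \<otimes>\<^bsub>PS_group n\<^esub> inv\<^bsub>PS_group n\<^esub> PS_word n [(i, True)] \<otimes>\<^bsub>PS_group n\<^esub> PS_word n [(i + 1, True)]"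
      using PS_class.H.pseudosymmetric_iff_squares_commute [of "PS_word n [(i, True)]" n "PS_word n [(i + 1, True)]"] gen_braid [of i]
        pure_in_PS_commute [of "[(i, True), (i, True)]" n "[(i + 1, True), (i + 1, True)]"]
      by (simp add: PS_word_mult)
  qed
qed

interpretation PS: pseudosymmetric_representation "PS_group n" n "\<lambda>i. PS_word n [(i, True)]" for n
  by (rule PS_representation)

lemma inv_PS_word_gen:
  assumes "1 \<le> i" "i < n"
  shows "inv\<^bsub>PS_group n\<^esub> PS_word n [(i, True)] = PS_word n [(i, False)]"
  using assms by (simp add: PS_word_def PS_class.hom_inv [symmetric] inv_braid_class_gen)

lemma PS_word_val: "w \<in> braid_words n \<Longrightarrow> PS.word_val n w = PS_word n w"
proof (induction w)
  case (Cons l w)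
  then show ?case
    by (cases l; cases "snd l") (auto simp: inv_PS_word_gen PS_word_mult)
qed (simp add: one_PS_group)

text \<open>The universal property of \<open>PS\<^sub>n\<close>: it is the braid group modulo the pseudosymmetric relations.
A homomorphism on \<open>B\<^sub>n\<close> that respects them makes pure braids commute, so it kills \<open>[P\<^sub>n, P\<^sub>n]\<close>.\<close>

theorem (in pseudosymmetric_representation) PS_universal:
  obtains g where "g \<in> hom (PS_group n) G" "\<And>w. w \<in> braid_words n \<Longrightarrow> g (PS_word n w) = word_val w"
proof -
  obtain h where h: "h \<in> hom (braid_group n) G" "\<And>w. w \<in> braid_words n \<Longrightarrow> h (braid_class n w) = word_val w"
    using ex_braid_hom by blast
  interpret h: group_hom "braid_group n" G h by unfold_locales (use h group_braid_group in \<open>auto simp: group_hom_def\<close>)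
  obtain g where "g \<in> hom (PS_group n) G" "\<And>x. x \<in> carrier (braid_group n) \<Longrightarrow> g (PS_class n x) = h x"
    using ex_PS_hom [OF h.group_hom_axioms] pure_commute h(2) by metis
  then show thesis using that h(2) by (simp add: PS_word_def)
qed

section \<open>Juxtaposition\<close>

lemma shift_word_simps [simp]: "shift_word m [] = []" "shift_word m ((i, b) # w) = (m + i, b) # shift_word m w"
  "shift_word m (u @ v) = shift_word m u @ shift_word m v" "shift_word 0 w = w"
  "shift_word m (shift_word k w) = shift_word (m + k) w"
  by (auto simp: shift_word_def map_prod_def comp_def case_prod_unfold add.assoc)

lemma shift_word_words: "w \<in> braid_words n \<Longrightarrow> shift_word m w \<in> braid_words (m + n)"
  by (induction w) (auto simp: shift_word_def)

lemma braid_words_mono: "\<lbrakk>w \<in> braid_words m; m \<le> n\<rbrakk> \<Longrightarrow> w \<in> braid_words n"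
  by (induction w) auto

lemma braid_eq_mono: "\<lbrakk>braid_eq m u v; m \<le> n\<rbrakk> \<Longrightarrow> braid_eq n u v"
proof (induction rule: braid_eq.induct)
  case (refl w)
  then show ?case using braid_words_mono [of w m n] by (simp add: braid_eq.refl)
next
  case (sym u v)
  then show ?case by (meson braid_eq.sym)
next
  case (trans u v w)
  then show ?case by (meson braid_eq.trans)
next
  case (braid i)
  then show ?case using braid_eq.braid [of i n] by simp
qed (simp_all add: braid_eq.append braid_eq.cancel braid_eq.far)

lemma braid_eq_shift: "braid_eq n u v \<Longrightarrow> braid_eq (m + n) (shift_word m u) (shift_word m v)"
proof (induction rule: braid_eq.induct)
  case (refl w)
  then show ?case by (intro braid_eq.refl shift_word_words)
next
  case (sym u v)
  then show ?case by (meson braid_eq.sym)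
next
  case (trans u v w)
  then show ?case by (meson braid_eq.trans)
next
  case (braid i)
  then show ?case using braid_eq.braid [of "m + i" "m + n"] by simp
qed (simp_all add: braid_eq.append braid_eq.cancel braid_eq.far)

lemma juxtapose_class:
  assumes "u \<in> braid_words m" "v \<in> braid_words n"
  shows "juxtapose m n (braid_class m u) (braid_class n v) = braid_class (m + n) (u @ shift_word m v)"
  unfolding juxtapose_def
proof (rule UN_braid_class [OF assms])
  fix u' v' assume eq: "braid_eq m u u'" "braid_eq n v v'"
  have "braid_eq (m + n) (u @ shift_word m v) (u' @ shift_word m v')"
    using eq by (intro braid_eq.append braid_eq_shift) (auto intro: braid_eq_mono)
  then show "braid_class (m + n) (u' @ shift_word m v') = braid_class (m + n) (u @ shift_word m v)"
    using braid_class_eq_iff braid_eq_words by metis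
qed

text \<open>Braids on disjoint sets of strands commute. This is the interchange law for juxtaposition.\<close>

lemma (in braid_representation) separated_words_commute:
  assumes "u \<in> braid_words m" "v \<in> braid_words k" "m + k \<le> n"
  shows "word_val u \<otimes> word_val (shift_word m v) = word_val (shift_word m v) \<otimes> word_val u"
proof -
  have letters: "letter_val (i, b) \<otimes> letter_val (m + j, c) = letter_val (m + j, c) \<otimes> letter_val (i, b)"
    if "1 \<le> i" "i < m" "1 \<le> j" "j < k" for i j b c
  proof -
    have "s i \<otimes> s (m + j) = s (m + j) \<otimes> s i" using gen_far [of i "m + j"] that assms(3) by simp
    then show ?thesis using commute_inv [of "s i" "s (m + j)"] commute_inv [of "s (m + j)" "s i"]
        commute_inv [of "inv s (m + j)" "s i"] that assms(3) by (cases b; cases c) auto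
  qed
  have closed: "word_val (shift_word m w) \<in> carrier G" if "w \<in> braid_words k" for w
    using braid_words_mono [OF shift_word_words [OF that] assms(3)] by simp
  have letter_word: "letter_val (i, b) \<otimes> word_val (shift_word m v) = word_val (shift_word m v) \<otimes> letter_val (i, b)"
    if "1 \<le> i" "i < m" for i b
    using assms(2)
  proof (induction v)
    case (Cons l v)
    obtain j c where l: "l = (j, c)" by force
    have "word_val (shift_word m v) \<in> carrier G" using Cons.prems closed by simp
    then show ?case using Cons l letters [OF that, of j b c] that assms(3) by (auto intro!: commute_mult)
  qed (use that assms(3) in auto)
  have v: "word_val (shift_word m v) \<in> carrier G" using assms(2) closed by simp
  show ?thesis using assms(1)
  proof (induction u)
    case (Cons l u)
    obtain j c where l: "l = (j, c)" by force
    have "word_val u \<in> carrier G"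
      using Cons.prems assms(3) braid_words_mono [of u m n] by simp
    then have "word_val (shift_word m v) \<otimes> word_val (l # u) = word_val (l # u) \<otimes> word_val (shift_word m v)"
      using Cons l letter_word [of j c] v assms(3) by (auto intro!: commute_mult)
    then show ?case by simp
  qed (use v in auto)
qed

lemma braid_class_commute:
  assumes "u \<in> braid_words m" "v \<in> braid_words n"
  shows "braid_class (m + n) (u @ shift_word m v) = braid_class (m + n) (shift_word m v @ u)"
  using B.separated_words_commute [OF assms, of "m + n"] assms shift_word_words [of v n m] braid_words_mono [of u m "m + n"]
  by (simp add: B_word_val braid_class_mult)

lemma PS_class_sub: 
  assumes "x' \<in> PS_class n x" "x \<in> carrier (braid_group n)"
  shows "x' \<in> carrier (braid_group n)" "PS_class n x' = PS_class n x"
proof -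
  show "x' \<in> carrier (braid_group n)" 
    using assms B.r_coset_subset_G [of "pure_commutator n" n x] PC.subset unfolding PS_class_def by blast
  show "PS_class n x' = PS_class n x"
    using assms B.repr_independence [OF _ _ PC.subgroup_axioms] unfolding PS_class_def by metis
qed

lemma (in pseudosymmetric_representation) shifted_representation:
  assumes "k + m \<le> n"
  shows "pseudosymmetric_representation G m (\<lambda>i. s (k + i))"
proof
  fix i assume i: "i \<in> {1..<m}"
  then show "s (k + i) \<in> carrier G" using assms by simp
  show "s (k + i) \<otimes> s (k + j) = s (k + j) \<otimes> s (k + i)" if "j \<in> {1..<m}" "i + 2 \<le> j" for j
    using gen_far [of "k + i" "k + j"] that i assms by simp
  assume i': "i + 1 \<in> {1..<m}"
  show "s (k + i) \<otimes> s (k + (i + 1)) \<otimes> s (k + i) = s (k + (i + 1)) \<otimes> s (k + i) \<otimes> s (k + (i + 1))"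
    using gen_braid [of "k + i"] i i' assms by simp
  show "s (k + i) \<otimes> inv s (k + (i + 1)) \<otimes> s (k + i) = s (k + (i + 1)) \<otimes> inv s (k + i) \<otimes> s (k + (i + 1))"
    using gen_pseudo [of "k + i"] i i' assms by simp
qed

lemma (in pseudosymmetric_representation) shifted_word_val:
  assumes "k + m \<le> n" "w \<in> braid_words m"
  shows "braid_representation.word_val G (\<lambda>i. s (k + i)) w = word_val (shift_word k w)"
proof -
  interpret R: pseudosymmetric_representation G m "\<lambda>i. s (k + i)"
    by (rule shifted_representation [OF assms(1)])
  show ?thesis using assms(2)
  proof (induction w)
    case (Cons l w)
    then show ?case by (cases l; cases "snd l") auto
  qed simp
qed

text \<open>Placing a braid on the left or on the right of others induces homomorphisms from \<open>PS\<^sub>m\<close> and \<open>PS\<^sub>n\<close>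
to \<open>PS\<^bsub>m+n\<^esub>\<close>, by the universal property. Hence juxtaposition is independent of representatives.\<close>

lemma PS_juxtapose_word:
  assumes u: "u \<in> braid_words m" and v: "v \<in> braid_words n"
  shows "PS_juxtapose m n (PS_word m u) (PS_word n v) = PS_word (m + n) (u @ shift_word m v)"
proof -
  let ?G = "PS_group (m + n)"
  interpret L: pseudosymmetric_representation ?G m "\<lambda>i. PS_word (m + n) [(i, True)]"
    using PS.shifted_representation [of 0 m "m + n"] by simp
  interpret R: pseudosymmetric_representation ?G n "\<lambda>i. PS_word (m + n) [(m + i, True)]"
    using PS.shifted_representation [of m n "m + n"] by simp
  have L_val: "L.word_val w = PS_word (m + n) w" if "w \<in> braid_words m" for w
    using PS.shifted_word_val [of 0 m "m + n" w] that braid_words_mono [of w m "m + n"] by (simp add: PS_word_val)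
  have R_val: "R.word_val w = PS_word (m + n) (shift_word m w)" if "w \<in> braid_words n" for w
    using PS.shifted_word_val [of m n "m + n" w] that shift_word_words by (simp add: PS_word_val)
  obtain f where f: "\<And>w. w \<in> braid_words m \<Longrightarrow> f (PS_word m w) = PS_word (m + n) w"
    using L.PS_universal L_val by metis
  obtain g where g: "\<And>w. w \<in> braid_words n \<Longrightarrow> g (PS_word n w) = PS_word (m + n) (shift_word m w)"
    using R.PS_universal R_val by metis
  have const: "PS_class (m + n) (juxtapose m n x y) = PS_word (m + n) (u @ shift_word m v)"
    if x: "x \<in> PS_word m u" and y: "y \<in> PS_word n v" for x y
  proof -
    have "x \<in> carrier (braid_group m)" "PS_class m x = PS_word m u"
      using PS_class_sub [of x m "braid_class m u"] x u by (simp_all add: PS_word_def)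
    then obtain u' where u': "u' \<in> braid_words m" "x = braid_class m u'" "PS_word m u' = PS_word m u"
      by (auto simp: carrier_braid_group PS_word_def)
    have "y \<in> carrier (braid_group n)" "PS_class n y = PS_word n v"
      using PS_class_sub [of y n "braid_class n v"] y v by (simp_all add: PS_word_def)
    then obtain v' where v': "v' \<in> braid_words n" "y = braid_class n v'" "PS_word n v' = PS_word n v"
      by (auto simp: carrier_braid_group PS_word_def)
    have words: "w \<in> braid_words (m + n)" if "w \<in> braid_words m" for w using that braid_words_mono by simp
    have "PS_class (m + n) (juxtapose m n x y) = PS_word (m + n) (u' @ shift_word m v')"
      using u' v' by (simp add: juxtapose_class PS_word_def)
    also have "\<dots> = f (PS_word m u') \<otimes>\<^bsub>?G\<^esub> g (PS_word n v')"
      using u'(1) v'(1) words shift_word_words by (simp add: f g PS_word_mult)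
    also have "\<dots> = PS_word (m + n) (u @ shift_word m v)"
      unfolding u'(3) v'(3) using u v words shift_word_words by (simp add: f g PS_word_mult)
    finally show ?thesis .
  qed
  have "braid_class m u \<in> PS_word m u" "braid_class n v \<in> PS_word n v"
    using u v B.rcos_self [OF _ PC.subgroup_axioms] by (simp_all add: PS_word_def PS_class_def)
  then show ?thesis unfolding PS_juxtapose_def using const by blast
qed

section \<open>The monoidal categories \<open>\<B>\<close> and \<open>\<P>\<S>\<close>\<close>

text \<open>Both \<open>\<B>\<close> and \<open>\<P>\<S>\<close> consist of quotients of the monoids of braid words whose multiplication is induced
by concatenation and whose tensor product is induced by shifting. The monoidal axioms hold on words, up
to commutation of separated words.\<close>

locale word_quotient =
  fixes G :: "nat \<Rightarrow> 'g monoid" and J :: "nat \<Rightarrow> nat \<Rightarrow> 'g \<Rightarrow> 'g \<Rightarrow> 'g" and q :: "nat \<Rightarrow> braid_word \<Rightarrow> 'g"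
  assumes carrier_q: "carrier (G n) = q n ` braid_words n"
    and one_q: "\<one>\<^bsub>G n\<^esub> = q n []"
    and mult_q: "\<lbrakk>u \<in> braid_words n; v \<in> braid_words n\<rbrakk> \<Longrightarrow> q n u \<otimes>\<^bsub>G n\<^esub> q n v = q n (u @ v)"
    and J_q: "\<lbrakk>u \<in> braid_words m; v \<in> braid_words n\<rbrakk> \<Longrightarrow> J m n (q m u) (q n v) = q (m + n) (u @ shift_word m v)"
    and q_commute: "\<lbrakk>u \<in> braid_words m; v \<in> braid_words n\<rbrakk> \<Longrightarrow> q (m + n) (shift_word m v @ u) = q (m + n) (u @ shift_word m v)"
begin

abbreviation S :: "(nat, nat \<times> 'g) moncat" where
  "S \<equiv> strict_nat_moncat G J"

lemma S_simps [simp]: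
  "Obj S = UNIV" "Dom S = fst" "Cod S = fst" "Ide S n = (n, q n [])"
  "tens_obj S = (+)" "unit_obj S = 0" "assoc S m n k = (m + n + k, q (m + n + k) [])"
  "lunit S n = (n, q n [])" "runit S n = (n, q n [])"
  by (simp_all add: strict_nat_moncat_def one_q)

lemma Arr_S: "Arr S = {(n, q n w) | n w. w \<in> braid_words n}"
  by (auto simp: strict_nat_moncat_def carrier_q)

lemma Arr_S_I [simp]: "w \<in> braid_words n \<Longrightarrow> (n, q n w) \<in> Arr S"
  by (auto simp: Arr_S)

lemma Hom_S: "Hom S m n = (if m = n then {(n, q n w) | w. w \<in> braid_words n} else {})"
  by (auto simp: Hom_def Arr_S)

lemma Comp_S [simp]:
  "\<lbrakk>u \<in> braid_words n; v \<in> braid_words n\<rbrakk> \<Longrightarrow> (n, q n u) \<cdot>\<^bsub>S\<^esub> (n, q n v) = (n, q n (u @ v))"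
  by (simp add: strict_nat_moncat_def mult_q)

lemma tens_S [simp]:
  "\<lbrakk>u \<in> braid_words m; v \<in> braid_words n\<rbrakk>
    \<Longrightarrow> (m, q m u) \<boxtimes>\<^bsub>S\<^esub> (n, q n v) = (m + n, q (m + n) (u @ shift_word m v))"
  by (simp add: strict_nat_moncat_def J_q)

lemma juxtaposed_words [simp]:
  "\<lbrakk>u \<in> braid_words m; v \<in> braid_words n\<rbrakk> \<Longrightarrow> u \<in> braid_words (m + n) \<and> shift_word m v \<in> braid_words (m + n)"
  using braid_words_mono [of u m "m + n"] shift_word_words by simp

lemma q_append_cong:
  assumes "q n v = q n v'" "u \<in> braid_words n" "v \<in> braid_words n" "v' \<in> braid_words n" "w \<in> braid_words n"
  shows "q n (u @ v @ w) = q n (u @ v' @ w)"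
  using assms by (simp flip: mult_q)

lemma category_S: "category S"
  by unfold_locales (auto simp: Hom_S Arr_S split: if_splits)

sublocale S: category S by (rule category_S)

lemma monoidal_category_S: "monoidal_category S"
proof -
  have iso: "Defs.is_iso S (n, q n [])" for n
    using S.is_iso_Ide [of n] by simp
  show ?thesis
  proof
    fix f x y g z f' x' y' g' z'
    assume "f \<in> Hom S x y" "g \<in> Hom S y z" "f' \<in> Hom S x' y'" "g' \<in> Hom S y' z'"
    then obtain u v u' v' where eqs: "y = x" "z = x" "y' = x'" "z' = x'"
      "f = (x, q x u)" "g = (x, q x v)" "f' = (x', q x' u')" "g' = (x', q x' v')"
      and w: "u \<in> braid_words x" "v \<in> braid_words x" "u' \<in> braid_words x'" "v' \<in> braid_words x'"
      by (auto simp: Hom_S split: if_splits)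
    \<comment> \<open>the interchange law\<close>
    have "q (x + x') (v @ (shift_word x v' @ u) @ shift_word x u') = q (x + x') (v @ (u @ shift_word x v') @ shift_word x u')"
      using w juxtaposed_words [of u x v' x'] juxtaposed_words [of v x u' x']
      by (intro q_append_cong q_commute) auto
    then show "(g \<cdot>\<^bsub>S\<^esub> f) \<boxtimes>\<^bsub>S\<^esub> (g' \<cdot>\<^bsub>S\<^esub> f') = (g \<boxtimes>\<^bsub>S\<^esub> g') \<cdot>\<^bsub>S\<^esub> (f \<boxtimes>\<^bsub>S\<^esub> f')"
      using w juxtaposed_words [of u x v' x'] juxtaposed_words [of v x u' x'] by (simp add: eqs)
  next
    fix f x x' g y y' h z z'
    assume "f \<in> Hom S x x'" "g \<in> Hom S y y'" "h \<in> Hom S z z'"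
    then obtain u v w where eqs: "x' = x" "y' = y" "z' = z" "f = (x, q x u)" "g = (y, q y v)" "h = (z, q z w)"
      and w: "u \<in> braid_words x" "v \<in> braid_words y" "w \<in> braid_words z"
      by (auto simp: Hom_S split: if_splits)
    have uv: "u @ shift_word x v \<in> braid_words (x + y)" and vw: "v @ shift_word y w \<in> braid_words (y + z)"
      using w by simp_all
    let ?h = "(x + (y + z), q (x + (y + z)) (u @ shift_word x (v @ shift_word y w)))"
    have h: "?h \<in> Arr S"
      using w juxtaposed_words [OF w(1) vw] by (intro Arr_S_I) simp
    have "(f \<boxtimes>\<^bsub>S\<^esub> g) \<boxtimes>\<^bsub>S\<^esub> h = ?h" using w tens_S [OF uv w(3)] by (simp add: eqs add.assoc)
    moreover have "f \<boxtimes>\<^bsub>S\<^esub> (g \<boxtimes>\<^bsub>S\<^esub> h) = ?h" using w tens_S [OF w(1) vw] by (simp add: eqs)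
    moreover have "Ide S (x + (y + z)) \<cdot>\<^bsub>S\<^esub> ?h = ?h" "?h \<cdot>\<^bsub>S\<^esub> Ide S (x + (y + z)) = ?h"
      by (rule S.Comp_Ide_simps [OF h], simp)+
    ultimately show "assoc S x' y' z' \<cdot>\<^bsub>S\<^esub> ((f \<boxtimes>\<^bsub>S\<^esub> g) \<boxtimes>\<^bsub>S\<^esub> h) = (f \<boxtimes>\<^bsub>S\<^esub> (g \<boxtimes>\<^bsub>S\<^esub> h)) \<cdot>\<^bsub>S\<^esub> assoc S x y z"
      by (simp add: eqs add.assoc)
  qed (auto simp: Hom_S iso split: if_splits simp flip: add.assoc)
qed

sublocale S: monoidal_category S by (rule monoidal_category_S)

end

lemma braid_cat_quotient: "word_quotient braid_group juxtapose braid_class"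
  by unfold_locales
    (simp_all add: carrier_braid_group one_braid_group braid_class_mult juxtapose_class braid_class_commute)

lemma PS_cat_quotient: "word_quotient PS_group PS_juxtapose PS_word"
  by unfold_locales
    (simp_all add: carrier_PS_group one_PS_group PS_word_mult PS_juxtapose_word, simp add: PS_word_def braid_class_commute)

interpretation BC: word_quotient braid_group juxtapose braid_class
  rewrites "strict_nat_moncat braid_group juxtapose = braid_cat"
  by (rule braid_cat_quotient) (simp add: braid_cat_def)

interpretation PSC: word_quotient PS_group PS_juxtapose PS_word
  rewrites "strict_nat_moncat PS_group PS_juxtapose = PS_cat"
  by (rule PS_cat_quotient) (simp add: PS_cat_def)

section \<open>Categories of monoidal functors and of pseudosymmetric operators\<close>

lemma (in cat_functor) amap_simps [simp]:
  assumes "f \<in> Arr A"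
  shows "amap F f \<in> Arr D" "Dom D (amap F f) = omap F (Dom A f)" "Cod D (amap F f) = omap F (Cod A f)"
  using amap_Hom [OF S.Arr_Hom [OF assms]] by (auto simp: T.Hom_iff)

lemma Tens_simps [simp]:
  "F \<in> Obj (Tens A C) \<longleftrightarrow> monoidal_functor A C F"
  "(F, t, G) \<in> Arr (Tens A C) \<longleftrightarrow> monoidal_functor A C F \<and> monoidal_functor A C G \<and> monoidal_nat_trans A C F G t"
  "Dom (Tens A C) (F, t, G) = F" "Cod (Tens A C) (F, t, G) = G"
  "Ide (Tens A C) F = (F, (\<lambda>x\<in>Obj A. Ide C (omap F x)), F)"
  "(G', u, H) \<cdot>\<^bsub>Tens A C\<^esub> (F, t, G) = (F, (\<lambda>x\<in>Obj A. u x \<cdot>\<^bsub>C\<^esub> t x), H)"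
  by (simp_all add: Tens_def)

lemma monoidal_nat_transE:
  assumes "monoidal_nat_trans A C F G t" "category C"
  shows "x \<in> Obj A \<Longrightarrow> t x \<in> Arr C" "x \<in> Obj A \<Longrightarrow> Dom C (t x) = omap F x" "x \<in> Obj A \<Longrightarrow> Cod C (t x) = omap G x"
    "f \<in> Hom A x y \<Longrightarrow> t y \<cdot>\<^bsub>C\<^esub> amap F f = amap G f \<cdot>\<^bsub>C\<^esub> t x"
    "t (unit_obj A) \<cdot>\<^bsub>C\<^esub> phi0 F = phi0 G"
    "\<lbrakk>x \<in> Obj A; y \<in> Obj A\<rbrakk> \<Longrightarrow> t (x \<boxdot>\<^bsub>A\<^esub> y) \<cdot>\<^bsub>C\<^esub> phi2 F (x, y) = phi2 G (x, y) \<cdot>\<^bsub>C\<^esub> (t x \<boxtimes>\<^bsub>C\<^esub> t y)"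
    "t \<in> extensional (Obj A)"
  using assms by (auto simp: monoidal_nat_trans_def nat_trans_def category.Hom_iff)

lemma (in monoidal_functor) phi_simps [simp]:
  "phi0 F \<in> Arr C" "Dom C (phi0 F) = unit_obj C" "Cod C (phi0 F) = omap F (unit_obj A)" "is_iso C (phi0 F)"
  "\<lbrakk>x \<in> Obj A; y \<in> Obj A\<rbrakk> \<Longrightarrow> phi2 F (x, y) \<in> Arr C"
  "\<lbrakk>x \<in> Obj A; y \<in> Obj A\<rbrakk> \<Longrightarrow> Dom C (phi2 F (x, y)) = omap F x \<boxdot>\<^bsub>C\<^esub> omap F y"
  "\<lbrakk>x \<in> Obj A; y \<in> Obj A\<rbrakk> \<Longrightarrow> Cod C (phi2 F (x, y)) = omap F (x \<boxdot>\<^bsub>A\<^esub> y)"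
  "\<lbrakk>x \<in> Obj A; y \<in> Obj A\<rbrakk> \<Longrightarrow> is_iso C (phi2 F (x, y))"
  using phi0_Hom phi0_iso phi2_Hom [of x y] phi2_iso [of x y] by (auto simp: T.Hom_iff)

declare (in cat_functor) omap_Obj [simp]

lemma monoidal_nat_trans_Ide:
  assumes "monoidal_functor A C F"
  shows "monoidal_nat_trans A C F F (\<lambda>x\<in>Obj A. Ide C (omap F x))"
proof -
  interpret F: monoidal_functor A C F by fact
  show ?thesis
    by (auto simp: monoidal_nat_trans_def nat_trans_def F.S.Hom_iff F.T.Hom_iff)
qed

lemma monoidal_nat_trans_Comp:
  fixes C (structure)
  assumes "monoidal_functor A C F" "monoidal_functor A C G" "monoidal_functor A C H"
    and t: "monoidal_nat_trans A C F G t" and u: "monoidal_nat_trans A C G H u"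
  shows "monoidal_nat_trans A C F H (\<lambda>x\<in>Obj A. u x \<cdot> t x)"
proof -
  interpret F: monoidal_functor A C F by fact
  interpret G: monoidal_functor A C G by fact
  interpret H: monoidal_functor A C H by fact
  note t' [simp] = monoidal_nat_transE(1-3) [OF t F.T.category_axioms]
  note u' [simp] = monoidal_nat_transE(1-3) [OF u F.T.category_axioms]
  have nat: "(u y \<cdot> t y) \<cdot> amap F f = amap H f \<cdot> (u x \<cdot> t x)" if f: "f \<in> Hom A x y" for x y f
  proof -
    have [simp]: "f \<in> Arr A" "Dom A f = x" "Cod A f = y" "x \<in> Obj A" "y \<in> Obj A"
      using f F.S.Dom_Obj F.S.Cod_Obj by (auto simp: F.S.Hom_iff)
    have "(u y \<cdot> t y) \<cdot> amap F f = u y \<cdot> (t y \<cdot> amap F f)" by simp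
    also have "\<dots> = (u y \<cdot> amap G f) \<cdot> t x"
      using monoidal_nat_transE(4) [OF t F.T.category_axioms f] by simp
    also have "\<dots> = amap H f \<cdot> (u x \<cdot> t x)"
      using monoidal_nat_transE(4) [OF u F.T.category_axioms f] by simp
    finally show ?thesis .
  qed
  have unit: "(u (unit_obj A) \<cdot> t (unit_obj A)) \<cdot> phi0 F = phi0 H"
    using monoidal_nat_transE(5) [OF t F.T.category_axioms] monoidal_nat_transE(5) [OF u F.T.category_axioms] by simp
  have tens: "(u (x \<boxdot>\<^bsub>A\<^esub> y) \<cdot> t (x \<boxdot>\<^bsub>A\<^esub> y)) \<cdot> phi2 F (x, y)
      = phi2 H (x, y) \<cdot> ((u x \<cdot> t x) \<boxtimes> (u y \<cdot> t y))" if [simp]: "x \<in> Obj A" "y \<in> Obj A" for x y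
  proof -
    have "(u (x \<boxdot>\<^bsub>A\<^esub> y) \<cdot> t (x \<boxdot>\<^bsub>A\<^esub> y)) \<cdot> phi2 F (x, y) = u (x \<boxdot>\<^bsub>A\<^esub> y) \<cdot> (t (x \<boxdot>\<^bsub>A\<^esub> y) \<cdot> phi2 F (x, y))"
      by simp
    also have "\<dots> = (u (x \<boxdot>\<^bsub>A\<^esub> y) \<cdot> phi2 G (x, y)) \<cdot> (t x \<boxtimes> t y)"
      using monoidal_nat_transE(6) [OF t F.T.category_axioms] by simp
    also have "\<dots> = phi2 H (x, y) \<cdot> ((u x \<cdot> t x) \<boxtimes> (u y \<cdot> t y))"
      using monoidal_nat_transE(6) [OF u F.T.category_axioms] by (simp add: F.C.interchange)
    finally show ?thesis .
  qed
  show ?thesis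
    using nat unit tens F.S.Dom_Obj F.S.Cod_Obj by (auto simp: monoidal_nat_trans_def nat_trans_def F.T.Hom_iff F.S.Hom_iff)
qed

lemma category_Tens:
  assumes "monoidal_category A" "monoidal_category C"
  shows "category (Tens A C)"
proof -
  interpret A: monoidal_category A by fact
  interpret C: monoidal_category C by fact
  note E = monoidal_nat_transE [OF _ C.category_axioms]
  show ?thesis
  proof
    fix F G f assume f: "f \<in> Hom (Tens A C) F G"
    then obtain t where t: "f = (F, t, G)" "monoidal_nat_trans A C F G t"
      by (cases f) (auto simp: Hom_def)
    show "Ide (Tens A C) G \<cdot>\<^bsub>Tens A C\<^esub> f = f" "f \<cdot>\<^bsub>Tens A C\<^esub> Ide (Tens A C) F = f"
      using E(1-3) [OF t(2)] by (simp_all add: t(1) extensionalityI [OF _ E(7) [OF t(2)]])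
  next
    fix F G H K f g h
    assume "f \<in> Hom (Tens A C) F G" "g \<in> Hom (Tens A C) G H" "h \<in> Hom (Tens A C) H K"
    then obtain t u v where tuv: "f = (F, t, G)" "monoidal_nat_trans A C F G t" "g = (G, u, H)" "monoidal_nat_trans A C G H u"
      "h = (H, v, K)" "monoidal_nat_trans A C H K v"
      by (cases f; cases g; cases h) (auto simp: Hom_def)
    show "(h \<cdot>\<^bsub>Tens A C\<^esub> g) \<cdot>\<^bsub>Tens A C\<^esub> f = h \<cdot>\<^bsub>Tens A C\<^esub> (g \<cdot>\<^bsub>Tens A C\<^esub> f)"
      using E(1-3) [OF tuv(2)] E(1-3) [OF tuv(4)] E(1-3) [OF tuv(6)] by (simp add: tuv cong: restrict_cong)
  next
    fix F G H f g
    assume "f \<in> Hom (Tens A C) F G" "g \<in> Hom (Tens A C) G H"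
    then show "g \<cdot>\<^bsub>Tens A C\<^esub> f \<in> Hom (Tens A C) F H"
      by (cases f; cases g) (auto simp: Hom_def intro: monoidal_nat_trans_Comp)
  next
    fix f assume "f \<in> Arr (Tens A C)"
    then show "Dom (Tens A C) f \<in> Obj (Tens A C)" "Cod (Tens A C) f \<in> Obj (Tens A C)"
      by (cases f; simp)+
  next
    fix F assume "F \<in> Obj (Tens A C)"
    then show "Ide (Tens A C) F \<in> Hom (Tens A C) F F"
      by (simp add: Hom_def monoidal_nat_trans_Ide)
  qed
qed

lemma PSYB_simps [simp]:
  "X \<in> Obj (PSYB C) \<longleftrightarrow> fst X \<in> Obj C \<and> pseudosymmetric_yang_baxter C (fst X) (snd X)"
  "(X, f, Y) \<in> Arr (PSYB C) \<longleftrightarrow> X \<in> Obj (PSYB C) \<and> Y \<in> Obj (PSYB C) \<and> f \<in> Hom C (fst X) (fst Y)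
     \<and> (f \<boxtimes>\<^bsub>C\<^esub> f) \<cdot>\<^bsub>C\<^esub> snd X = snd Y \<cdot>\<^bsub>C\<^esub> (f \<boxtimes>\<^bsub>C\<^esub> f)"
  "Dom (PSYB C) (X, f, Y) = X" "Cod (PSYB C) (X, f, Y) = Y"
  "Ide (PSYB C) X = (X, Ide C (fst X), X)"
  "(Y', g, Z) \<cdot>\<^bsub>PSYB C\<^esub> (X, f, Y) = (X, g \<cdot>\<^bsub>C\<^esub> f, Z)"
  by (auto simp: PSYB_def full_subcategory_def YB_def pseudosymmetric_yang_baxter_def split: prod.splits)

text \<open>The common shape of the Yang-Baxter and the pseudosymmetric relation: \<open>q\<close> is \<open>\<sigma>\<close> in the first and \<open>\<sigma>\<^sup>-\<^sup>1\<close> in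
the second, with \<open>p = r = \<sigma>\<close> in both.\<close>

definition yang_baxter_relation ::
    "('o, 'a, 'e) moncat_scheme \<Rightarrow> 'o \<Rightarrow> 'a \<Rightarrow> 'a \<Rightarrow> 'a \<Rightarrow> bool" where
  "yang_baxter_relation C V p q r \<longleftrightarrow> (let a = assoc C V V V; a' = inv_arr C a; i = Ide C V in
     a \<cdot>\<^bsub>C\<^esub> (p \<boxtimes>\<^bsub>C\<^esub> i) \<cdot>\<^bsub>C\<^esub> a' \<cdot>\<^bsub>C\<^esub> (i \<boxtimes>\<^bsub>C\<^esub> q) \<cdot>\<^bsub>C\<^esub> a \<cdot>\<^bsub>C\<^esub> (r \<boxtimes>\<^bsub>C\<^esub> i)
     = (i \<boxtimes>\<^bsub>C\<^esub> r) \<cdot>\<^bsub>C\<^esub> a \<cdot>\<^bsub>C\<^esub> (q \<boxtimes>\<^bsub>C\<^esub> i) \<cdot>\<^bsub>C\<^esub> a' \<cdot>\<^bsub>C\<^esub> (i \<boxtimes>\<^bsub>C\<^esub> p) \<cdot>\<^bsub>C\<^esub> a)"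

lemma pseudosymmetric_yang_baxter_iff:
  "pseudosymmetric_yang_baxter C V s \<longleftrightarrow> s \<in> Hom C (V \<boxdot>\<^bsub>C\<^esub> V) (V \<boxdot>\<^bsub>C\<^esub> V) \<and> Defs.is_iso C s \<and>
     yang_baxter_relation C V s s s \<and> yang_baxter_relation C V s (inv_arr C s) s"
  by (auto simp: pseudosymmetric_yang_baxter_def yang_baxter_def yang_baxter_relation_def Let_def)

context monoidal_category begin

lemma pseudosymmetric_Arr:
  assumes "pseudosymmetric_yang_baxter C V s"
  shows "s \<in> Arr C" "Dom C s = V \<boxdot> V" "Cod C s = V \<boxdot> V" "is_iso C s"
  using assms by (auto simp: pseudosymmetric_yang_baxter_def yang_baxter_def Hom_iff)

lemma category_PSYB: "category (PSYB C)"
proof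
  fix X Y Z f g assume "f \<in> Hom (PSYB C) X Y" "g \<in> Hom (PSYB C) Y Z"
  then obtain f' g' where f: "f = (X, f', Y)" "g = (Y, g', Z)" "X \<in> Obj (PSYB C)" "Y \<in> Obj (PSYB C)" "Z \<in> Obj (PSYB C)"
    "f' \<in> Hom C (fst X) (fst Y)" "(f' \<boxtimes> f') \<cdot> snd X = snd Y \<cdot> (f' \<boxtimes> f')"
    "g' \<in> Hom C (fst Y) (fst Z)" "(g' \<boxtimes> g') \<cdot> snd Y = snd Z \<cdot> (g' \<boxtimes> g')"
    by (cases f; cases g) (auto simp: Hom_def)
  note [simp] = f(6,8) [unfolded Hom_iff]
  have ps: "pseudosymmetric_yang_baxter C (fst X) (snd X)" "pseudosymmetric_yang_baxter C (fst Y) (snd Y)"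
    "pseudosymmetric_yang_baxter C (fst Z) (snd Z)" using f by simp_all
  note [simp] = pseudosymmetric_Arr(1-3) [OF ps(1)] pseudosymmetric_Arr(1-3) [OF ps(2)] pseudosymmetric_Arr(1-3) [OF ps(3)]
  have "((g' \<cdot> f') \<boxtimes> (g' \<cdot> f')) \<cdot> snd X = (g' \<boxtimes> g') \<cdot> ((f' \<boxtimes> f') \<cdot> snd X)"
    by (simp add: interchange)
  also have "\<dots> = ((g' \<boxtimes> g') \<cdot> snd Y) \<cdot> (f' \<boxtimes> f')" by (simp add: f(7))
  also have "\<dots> = snd Z \<cdot> ((g' \<cdot> f') \<boxtimes> (g' \<cdot> f'))" by (simp add: f(9) interchange)
  finally show "g \<cdot>\<^bsub>PSYB C\<^esub> f \<in> Hom (PSYB C) X Z"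
    using f(1-5) by (simp add: Hom_def [of "PSYB C"]) (simp add: Hom_iff)
next
  fix x assume "x \<in> Obj (PSYB C)"
  then show "Ide (PSYB C) x \<in> Hom (PSYB C) x x"
    using pseudosymmetric_Arr [of "fst x" "snd x"]
    by (simp add: Hom_def [of "PSYB C"]) (auto simp: Hom_iff)
next
  fix f assume "f \<in> Arr (PSYB C)" 
  then show "Dom (PSYB C) f \<in> Obj (PSYB C)" "Cod (PSYB C) f \<in> Obj (PSYB C)"
    by (cases f; simp)+
next
  fix f x y assume "f \<in> Hom (PSYB C) x y"
  then show "Ide (PSYB C) y \<cdot>\<^bsub>PSYB C\<^esub> f = f" "f \<cdot>\<^bsub>PSYB C\<^esub> Ide (PSYB C) x = f"
    by (cases f; auto simp: Hom_def [of "PSYB C"] Hom_iff)+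
next
  fix f g h w x y z assume "f \<in> Hom (PSYB C) w x" "g \<in> Hom (PSYB C) x y" "h \<in> Hom (PSYB C) y z"
  then show "(h \<cdot>\<^bsub>PSYB C\<^esub> g) \<cdot>\<^bsub>PSYB C\<^esub> f = h \<cdot>\<^bsub>PSYB C\<^esub> (g \<cdot>\<^bsub>PSYB C\<^esub> f)"
    by (cases f; cases g; cases h) (auto simp: Hom_def [of "PSYB C"] Hom_iff)
qed

end

text \<open>The Yang-Baxter relation on \<open>(V \<otimes> V) \<otimes> V\<close> is the braid relation seen through a pair of isomorphisms \<open>\<theta>\<close>
and \<open>\<theta>'\<close> from the two bracketings to a common object. It is used once to read the relation off a monoidal
functor, and once to obtain the braid relation on tensor powers; independent operators in the six
positions let it cover the pseudosymmetric relation as well.\<close>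

lemma (in category) braid_word_transport:
  assumes "is_iso C \<theta>" "is_iso C \<theta>'" "is_iso C a" "Cod C \<theta> = X" "Cod C \<theta>' = X" "Dom C \<theta> = A" "Dom C \<theta>' = A'"
    "Dom C a = A" "Cod C a = A'" and triangle: "\<theta>' \<cdot> a = \<theta>"
    and P: "P1 \<in> Hom C A A" "P2 \<in> Hom C A A" "P3 \<in> Hom C A A"
    and Q: "Q1 \<in> Hom C A' A'" "Q2 \<in> Hom C A' A'" "Q3 \<in> Hom C A' A'"
    and p: "p1 \<in> Hom C X X" "p2 \<in> Hom C X X" "p3 \<in> Hom C X X"
    and q: "q1 \<in> Hom C X X" "q2 \<in> Hom C X X" "q3 \<in> Hom C X X"
    and P_eq: "p1 \<cdot> \<theta> = \<theta> \<cdot> P1" "p3 \<cdot> \<theta> = \<theta> \<cdot> P3" "q2 \<cdot> \<theta> = \<theta> \<cdot> P2"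
    and Q_eq: "q1 \<cdot> \<theta>' = \<theta>' \<cdot> Q1" "q3 \<cdot> \<theta>' = \<theta>' \<cdot> Q3" "p2 \<cdot> \<theta>' = \<theta>' \<cdot> Q2"
  shows "a \<cdot> P1 \<cdot> inv_arr C a \<cdot> Q2 \<cdot> a \<cdot> P3 = Q1 \<cdot> a \<cdot> P2 \<cdot> inv_arr C a \<cdot> Q3 \<cdot> a
    \<longleftrightarrow> p1 \<cdot> p2 \<cdot> p3 = q1 \<cdot> q2 \<cdot> q3" (is "?l = ?r \<longleftrightarrow> ?l' = ?r'")
proof -
  note [simp] = assms(1-9) iso_Arr [OF assms(1)] iso_Arr [OF assms(2)] iso_Arr [OF assms(3)]
    P [unfolded Hom_iff] Q [unfolded Hom_iff] p [unfolded Hom_iff] q [unfolded Hom_iff]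
  have a: "\<theta>' \<cdot> (a \<cdot> h) = \<theta> \<cdot> h" if "h \<in> Arr C" "Cod C h = A" for h
    unfolding triangle [symmetric] using that by simp
  have a': "\<theta> \<cdot> (inv_arr C a \<cdot> h) = \<theta>' \<cdot> h" if "h \<in> Arr C" "Cod C h = A'" for h
    unfolding triangle [symmetric] using that by simp
  have P': "\<theta> \<cdot> (P1 \<cdot> h) = p1 \<cdot> (\<theta> \<cdot> h)" "\<theta> \<cdot> (P3 \<cdot> h) = p3 \<cdot> (\<theta> \<cdot> h)" "\<theta> \<cdot> (P2 \<cdot> h) = q2 \<cdot> (\<theta> \<cdot> h)"
    if "h \<in> Arr C" "Cod C h = A" for h
    using that by (simp_all add: Comp_eq_extend [OF P_eq(1)] Comp_eq_extend [OF P_eq(2)] Comp_eq_extend [OF P_eq(3)])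
  have Q': "\<theta>' \<cdot> (Q1 \<cdot> h) = q1 \<cdot> (\<theta>' \<cdot> h)" "\<theta>' \<cdot> (Q3 \<cdot> h) = q3 \<cdot> (\<theta>' \<cdot> h)" "\<theta>' \<cdot> (Q2 \<cdot> h) = p2 \<cdot> (\<theta>' \<cdot> h)"
    if "h \<in> Arr C" "Cod C h = A'" for h
    using that by (simp_all add: Comp_eq_extend [OF Q_eq(1)] Comp_eq_extend [OF Q_eq(2)] Comp_eq_extend [OF Q_eq(3)])
  have l: "\<theta>' \<cdot> ?l = ?l' \<cdot> \<theta>" by (simp add: a a' P' Q' P_eq(2) [symmetric])
  have r: "\<theta>' \<cdot> ?r = ?r' \<cdot> \<theta>" by (simp add: a a' P' Q' triangle)
  have "?l = ?r \<longleftrightarrow> \<theta>' \<cdot> ?l = \<theta>' \<cdot> ?r"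
    using iso_cancel_left [of \<theta>' ?l ?r] by auto
  also have "\<dots> \<longleftrightarrow> ?l' = ?r'"
    unfolding l r
  proof
    assume "?l' \<cdot> \<theta> = ?r' \<cdot> \<theta>"
    then show "?l' = ?r'" by (rule iso_cancel_right [of \<theta>, rotated -1]) simp_all
  qed (simp only:)
  finally show ?thesis .
qed

section \<open>The pseudosymmetric operator of a monoidal functor on \<open>\<P>\<S>\<close>\<close>

text \<open>A monoidal functor on \<open>\<P>\<S>\<close>, with its value on arrows expressed through words.\<close>

locale PS_monoidal_functor = monoidal_functor PS_cat C F
  for C :: "('o, 'a) moncat" (structure)
    and F :: "(nat, nat \<times> braid_word set set, 'o, 'a) monfun_data"
begin

abbreviation V :: "nat \<Rightarrow> 'o" where
  "V n \<equiv> omap F n"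

definition act :: "nat \<Rightarrow> braid_word \<Rightarrow> 'a" where
  "act n w = amap F (n, PS_word n w)"

abbreviation phi :: "nat \<Rightarrow> nat \<Rightarrow> 'a" where
  "phi m n \<equiv> phi2 F (m, n)"

lemma V_Obj [simp]: "V n \<in> Obj C"
  by simp

lemma act_simps [simp]:
  assumes "w \<in> braid_words n"
  shows "act n w \<in> Arr C" "Dom C (act n w) = V n" "Cod C (act n w) = V n"
  using assms by (simp_all add: act_def)

lemma act_Nil [simp]: "act n [] = Ide C (V n)"
  using amap_Ide [of n] by (simp add: act_def)

lemma act_append: "\<lbrakk>u \<in> braid_words n; v \<in> braid_words n\<rbrakk> \<Longrightarrow> act n (u @ v) = act n u \<cdot> act n v"
  using amap_Comp [of "(n, PS_word n v)" n n "(n, PS_word n u)" n] by (auto simp: act_def PSC.Hom_S)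

lemma act_Cons: "\<lbrakk>fst l \<in> {1..<n}; w \<in> braid_words n\<rbrakk> \<Longrightarrow> act n (l # w) = act n [l] \<cdot> act n w"
  using act_append [of "[l]" n w] by simp

lemma act_cong: "braid_eq n u v \<Longrightarrow> act n u = act n v"
  by (simp add: act_def PS_word_cong)

lemma act_cancel:
  assumes "1 \<le> i" "i < n"
  shows "act n [(i, b)] \<cdot> act n [(i, \<not> b)] = Ide C (V n)"
  using act_cong [OF braid_eq.cancel [of i n b]] act_append [of "[(i, b)]" n "[(i, \<not> b)]"] assms by simp

lemma phi_natural:
  "\<lbrakk>u \<in> braid_words m; v \<in> braid_words n\<rbrakk>
    \<Longrightarrow> phi m n \<cdot> (act m u \<boxtimes> act n v) = act (m + n) (u @ shift_word m v) \<cdot> phi m n"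
  using phi2_natural [of "(m, PS_word m u)" m m "(n, PS_word n v)" n n] by (auto simp: act_def PSC.Hom_S)

lemma phi_assoc:
  "phi x (y + z) \<cdot> ((Ide C (V x) \<boxtimes> phi y z) \<cdot> assoc C (V x) (V y) (V z))
    = phi (x + y) z \<cdot> (phi x y \<boxtimes> Ide C (V z))"
  using phi2_assoc [of x y z] act_Nil [of "x + y + z"] by (simp add: act_def add.assoc)

lemma phi_lunit: "phi 0 x \<cdot> (phi0 F \<boxtimes> Ide C (V x)) = lunit C (V x)"
  using phi2_lunit [of x] act_Nil [of x] by (simp add: act_def)

lemma phi_runit: "phi x 0 \<cdot> (Ide C (V x) \<boxtimes> phi0 F) = runit C (V x)"
  using phi2_runit [of x] act_Nil [of x] by (simp add: act_def)

text \<open>Keeps numbers of strands in numeral form, so that the objects \<open>V (1 + 1)\<close> and \<open>V 2\<close> are recognised as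
equal by simplification.\<close>

lemma two_strands [simp]: "Suc (Suc 0) = 2"
  by simp

text \<open>The operator that the crossing, or for \<open>False\<close> its inverse, induces on \<open>F(1) \<otimes> F(1)\<close>.\<close>

definition opr :: "bool \<Rightarrow> 'a" where
  "opr b = inv_arr C (phi 1 1) \<cdot> (act 2 [(1, b)] \<cdot> phi 1 1)"

lemma opr_simps [simp]: "opr b \<in> Arr C" "Dom C (opr b) = V 1 \<boxdot> V 1" "Cod C (opr b) = V 1 \<boxdot> V 1"
  by (simp_all add: opr_def)

lemma phi_opr: "phi 1 1 \<cdot> opr b = act 2 [(1, b)] \<cdot> phi 1 1"
  by (simp add: opr_def)

lemma opr_cancel: "opr b \<cdot> opr (\<not> b) = Ide C (V 1 \<boxdot> V 1)"
proof -
  have "opr b \<cdot> opr (\<not> b) = inv_arr C (phi 1 1) \<cdot> ((act 2 [(1, b)] \<cdot> act 2 [(1, \<not> b)]) \<cdot> phi 1 1)"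
    by (simp add: opr_def)
  also have "act 2 [(1, b)] \<cdot> act 2 [(1, \<not> b)] = Ide C (V 2)"
    by (rule act_cancel) simp_all
  also have "inv_arr C (phi 1 1) \<cdot> (Ide C (V 2) \<cdot> phi 1 1) = Ide C (V 1 \<boxdot> V 1)" by simp
  finally show ?thesis .
qed

lemma opr_iso [simp]: "is_iso C (opr b)" "inv_arr C (opr b) = opr (\<not> b)"
  using T.is_isoI [of "opr b" "opr (\<not> b)"] opr_cancel [of b] opr_cancel [of "\<not> b"] by simp_all

abbreviation merge_left :: 'a where
  "merge_left \<equiv> phi 2 1 \<cdot> (phi 1 1 \<boxtimes> Ide C (V 1))"

abbreviation merge_right :: 'a where
  "merge_right \<equiv> phi 1 2 \<cdot> (Ide C (V 1) \<boxtimes> phi 1 1)"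

text \<open>The two ways of identifying the triple tensor power of \<open>F(1)\<close> with \<open>F(3)\<close> differ by the associator; they
translate the operators on the first and the last two factors into the generators of \<open>PS\<^sub>3\<close>.\<close>

lemma merge_left_triangle: "merge_right \<cdot> assoc C (V 1) (V 1) (V 1) = merge_left"
  using phi_assoc [of 1 1 1] by simp

lemma merge_left_act: "act 3 [(1, b)] \<cdot> merge_left = merge_left \<cdot> (opr b \<boxtimes> Ide C (V 1))"
proof -
  have "merge_left \<cdot> (opr b \<boxtimes> Ide C (V 1)) = phi 2 1 \<cdot> ((phi 1 1 \<cdot> opr b) \<boxtimes> Ide C (V 1))"
    by (simp add: C.interchange)
  also have "\<dots> = (phi 2 1 \<cdot> (act 2 [(1, b)] \<boxtimes> act 1 [])) \<cdot> (phi 1 1 \<boxtimes> Ide C (V 1))"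
    by (simp add: C.interchange phi_opr [simplified])
  also have "\<dots> = act 3 [(1, b)] \<cdot> merge_left"
    using phi_natural [of "[(1, b)]" 2 "[]" 1] by simp
  finally show ?thesis by simp
qed

lemma merge_right_act: "act 3 [(2, b)] \<cdot> merge_right = merge_right \<cdot> (Ide C (V 1) \<boxtimes> opr b)"
proof -
  have "merge_right \<cdot> (Ide C (V 1) \<boxtimes> opr b) = phi 1 2 \<cdot> (Ide C (V 1) \<boxtimes> (phi 1 1 \<cdot> opr b))"
    by (simp add: C.interchange)
  also have "\<dots> = (phi 1 2 \<cdot> (act 1 [] \<boxtimes> act 2 [(1, b)])) \<cdot> (Ide C (V 1) \<boxtimes> phi 1 1)"
    by (simp add: C.interchange phi_opr [simplified])
  also have "\<dots> = act 3 [(2, b)] \<cdot> merge_right"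
    using phi_natural [of "[]" 1 "[(1, b)]" 2] by simp
  finally show ?thesis by simp
qed

text \<open>A relation of braid type between the two generators of \<open>PS\<^sub>3\<close> becomes a relation of Yang-Baxter type.\<close>

lemma opr_relation:
  assumes "PS_word 3 [(1, b), (2, c), (1, d)] = PS_word 3 [(2, d), (1, c), (2, b)]"
  shows "yang_baxter_relation C (V 1) (opr b) (opr c) (opr d)"
proof -
  have eq: "act 3 [(1, b)] \<cdot> act 3 [(2, c)] \<cdot> act 3 [(1, d)] = act 3 [(2, d)] \<cdot> act 3 [(1, c)] \<cdot> act 3 [(2, b)]"
    using arg_cong [OF assms, of "\<lambda>x. amap F (3, x)"]
      act_Cons [of "(1, b)" 3 "[(2, c), (1, d)]"] act_Cons [of "(2, c)" 3 "[(1, d)]"]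
      act_Cons [of "(2, d)" 3 "[(1, c), (2, b)]"] act_Cons [of "(1, c)" 3 "[(2, b)]"]
    by (simp add: act_def [symmetric])
  show ?thesis
    unfolding yang_baxter_relation_def Let_def
    by (rule T.braid_word_transport [of merge_left merge_right _ "V 3", THEN iffD2, OF _ _ _ _ _ _ _ _ _ _ _ _ _ _ _ _ _ _ _ _ _ _
          merge_left_act merge_left_act merge_left_act merge_right_act merge_right_act merge_right_act eq])
      (use merge_left_triangle in \<open>simp_all add: T.Hom_iff\<close>)
qed

lemma pseudosymmetric_opr: "pseudosymmetric_yang_baxter C (V 1) (opr True)"
proof -
  have 1: "PS_word 3 [(1, True), (2, True), (1, True)] = PS_word 3 [(2, True), (1, True), (2, True)]"
    using PS_word_cong [OF braid_eq.braid [of 1 3]] by simp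
  have 2: "PS_word 3 [(1, True), (2, False), (1, True)] = PS_word 3 [(2, True), (1, False), (2, True)]"
    using PS.gen_pseudo [of 1 3] by (simp add: inv_PS_word_gen PS_word_mult)
  show ?thesis
    using opr_relation [OF 1] opr_relation [OF 2]
    by (auto simp: pseudosymmetric_yang_baxter_iff T.Hom_iff)
qed

end

lemma proj_simps [simp]: "amap proj (n, x) = (if x \<in> carrier (braid_group n) then (n, PS_class n x) else undefined)"
  "omap proj n = n" "phi0 proj = (0, PS_word 0 [])" "phi2 proj (m, n) = (m + n, PS_word (m + n) [])"
  by (auto simp: proj_def braid_cat_def strict_nat_moncat_def PS_cat_def one_PS_group)

text \<open>Precomposition with \<open>\<pi>\<close> only changes the value on arrows, as \<open>\<pi>\<close> is strict and the identity on objects.\<close>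

lemma comp_monfun_proj:
  assumes "PS_monoidal_functor C F"
  shows "comp_monfun braid_cat C F proj = \<lparr>omap = omap F,
    amap = (\<lambda>(n, x)\<in>Arr braid_cat. amap F (n, PS_class n x)), phi0 = phi0 F, phi2 = phi2 F\<rparr>"
proof -
  interpret PS_monoidal_functor C F by fact
  have [simp]: "amap F (n, PS_word n []) = Ide C (V n)" for n using act_Nil [of n] by (simp add: act_def)
  show ?thesis
    by (auto simp: comp_monfun_def fun_eq_iff BC.Arr_S restrict_def)
qed

lemma monoidal_functor_comp_proj:
  fixes C (structure)
  assumes "PS_monoidal_functor C F"
  shows "monoidal_functor braid_cat C (comp_monfun braid_cat C F proj)"
proof -
  interpret PS_monoidal_functor C F by fact
  define P where "P = comp_monfun braid_cat C F proj"
  have P [simp]: "omap P = omap F" "phi0 P = phi0 F" "phi2 P = phi2 F"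
    "w \<in> braid_words n \<Longrightarrow> amap P (n, braid_class n w) = act n w" for n w
    by (simp_all add: P_def comp_monfun_proj [OF assms] act_def PS_word_def)
  have P_functor: "cat_functor braid_cat C P"
  proof
    show "amap P \<in> extensional (Arr braid_cat)"
      by (auto simp: P_def comp_monfun_def)
    show "omap P \<in> extensional (Obj braid_cat)" by simp
    show "amap P (Ide braid_cat x) = Ide C (omap P x)" for x by simp
    show "omap P x \<in> Obj C" for x by simp
    show "amap P f \<in> Hom C (omap P x) (omap P y)" if "f \<in> Hom braid_cat x y" for f x y
      using that by (auto simp: BC.Hom_S T.Hom_iff split: if_splits)
    show "amap P (g \<cdot>\<^bsub>braid_cat\<^esub> f) = amap P g \<cdot> amap P f"
      if "f \<in> Hom braid_cat x y" "g \<in> Hom braid_cat y z" for f g x y z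
      using that by (auto simp: BC.Hom_S act_append split: if_splits)
  qed
  have "monoidal_functor braid_cat C P"
  proof (intro monoidal_functor.intro P_functor BC.monoidal_category_S monoidal_functor_axioms.intro)
    show "monoidal_category C" ..
    show "phi2 P (x', y') \<cdot> (amap P f \<boxtimes> amap P g) = amap P (f \<boxtimes>\<^bsub>braid_cat\<^esub> g) \<cdot> phi2 P (x, y)"
      if "f \<in> Hom braid_cat x x'" "g \<in> Hom braid_cat y y'" for f g x x' y y'
      using that by (auto simp: BC.Hom_S phi_natural split: if_splits)
    show "phi2 P (x, y \<boxdot>\<^bsub>braid_cat\<^esub> z) \<cdot> (Ide C (omap P x) \<boxtimes> phi2 P (y, z)) \<cdot> assoc C (omap P x) (omap P y) (omap P z)
        = amap P (assoc braid_cat x y z) \<cdot> phi2 P (x \<boxdot>\<^bsub>braid_cat\<^esub> y, z) \<cdot> (phi2 P (x, y) \<boxtimes> Ide C (omap P z))" for x y z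
      using phi_assoc [of x y z] by (simp add: add.assoc)
    show "lunit C (omap P x) = amap P (lunit braid_cat x) \<cdot> phi2 P (unit_obj braid_cat, x) \<cdot> (phi0 P \<boxtimes> Ide C (omap P x))" for x
      using phi_lunit [of x] by simp
    show "runit C (omap P x) = amap P (runit braid_cat x) \<cdot> phi2 P (x, unit_obj braid_cat) \<cdot> (Ide C (omap P x) \<boxtimes> phi0 P)" for x
      using phi_runit [of x] by simp
  qed (use phi0_Hom phi2_Hom in simp_all)
  then show ?thesis by (simp add: P_def)
qed

lemma Theta_obj_comp_proj:
  assumes "PS_monoidal_functor C F"
  shows "Theta_obj C (comp_monfun braid_cat C F proj) = (omap F 1, PS_monoidal_functor.opr C F True)"
proof -
  interpret PS_monoidal_functor C F by fact
  have "braiding 1 1 = (2, braid_class 2 [(1, True)])" by (simp add: braiding_def braiding_word_def upt_conv_Cons)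
  then show ?thesis
    by (simp add: Theta_obj_def comp_monfun_proj [OF assms] opr_def act_def PS_word_def)
qed

section \<open>Full faithfulness of \<open>\<Theta>\<close>-tilde\<close>

locale PS_functor_pair = F: PS_monoidal_functor C F + G: PS_monoidal_functor C G
  for C :: "('o, 'a) moncat" (structure) and F G
begin

lemma nat_trans_iff:
  assumes "t \<in> UNIV \<rightarrow> Arr C" "\<And>n. Dom C (t n) = F.V n" "\<And>n. Cod C (t n) = G.V n"
  shows "monoidal_nat_trans PS_cat C F G t \<longleftrightarrow>
    (\<forall>n. \<forall>w\<in>braid_words n. t n \<cdot> F.act n w = G.act n w \<cdot> t n) \<and> t 0 \<cdot> phi0 F = phi0 G \<and>
    (\<forall>m n. t (m + n) \<cdot> F.phi m n = G.phi m n \<cdot> (t m \<boxtimes> t n))"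
  using assms by (auto simp: monoidal_nat_trans_def nat_trans_def F.T.Hom_iff PSC.Hom_S F.act_def G.act_def Pi_iff split: if_splits) blast

lemma nat_transD:
  assumes "monoidal_nat_trans PS_cat C F G t"
  shows "t n \<in> Arr C" "Dom C (t n) = F.V n" "Cod C (t n) = G.V n"
    and "w \<in> braid_words n \<Longrightarrow> t n \<cdot> F.act n w = G.act n w \<cdot> t n" "t 0 \<cdot> phi0 F = phi0 G"
    "t (m + n) \<cdot> F.phi m n = G.phi m n \<cdot> (t m \<boxtimes> t n)"
proof -
  show *: "t n \<in> Arr C" "Dom C (t n) = F.V n" "Cod C (t n) = G.V n" for n
    using monoidal_nat_transE(1-3) [OF assms F.T.category_axioms, of n] by simp_all
  show "w \<in> braid_words n \<Longrightarrow> t n \<cdot> F.act n w = G.act n w \<cdot> t n" "t 0 \<cdot> phi0 F = phi0 G"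
    "t (m + n) \<cdot> F.phi m n = G.phi m n \<cdot> (t m \<boxtimes> t n)"
    using assms nat_trans_iff [of t] * by simp_all
qed

lemma nat_trans_comp_proj:
  assumes "monoidal_nat_trans PS_cat C F G t"
  shows "monoidal_nat_trans braid_cat C (comp_monfun braid_cat C F proj) (comp_monfun braid_cat C G proj) t"
  using nat_transD [OF assms] F.PS_monoidal_functor_axioms G.PS_monoidal_functor_axioms
  by (auto simp: monoidal_nat_trans_def nat_trans_def comp_monfun_proj F.T.Hom_iff BC.Hom_S F.act_def G.act_def
      PS_word_def split: if_splits)

lemma nat_trans_opr:
  assumes "monoidal_nat_trans PS_cat C F G t"
  shows "(t 1 \<boxtimes> t 1) \<cdot> F.opr b = G.opr b \<cdot> (t 1 \<boxtimes> t 1)"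
proof -
  note t = nat_transD [OF assms]
  note [simp] = t(1-3)
  have tens: "t 2 \<cdot> F.phi 1 1 = G.phi 1 1 \<cdot> (t 1 \<boxtimes> t 1)" using t(6) [of 1 1] by simp
  have "G.phi 1 1 \<cdot> ((t 1 \<boxtimes> t 1) \<cdot> F.opr b) = (G.phi 1 1 \<cdot> (t 1 \<boxtimes> t 1)) \<cdot> F.opr b" by simp
  also have "\<dots> = t 2 \<cdot> (F.phi 1 1 \<cdot> F.opr b)" unfolding tens [symmetric] by simp
  also have "\<dots> = (t 2 \<cdot> F.act 2 [(1, b)]) \<cdot> F.phi 1 1" unfolding F.phi_opr by simp
  also have "t 2 \<cdot> F.act 2 [(1, b)] = G.act 2 [(1, b)] \<cdot> t 2" by (rule t(4)) simp
  also have "(G.act 2 [(1, b)] \<cdot> t 2) \<cdot> F.phi 1 1 = G.act 2 [(1, b)] \<cdot> (t 2 \<cdot> F.phi 1 1)" by simp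
  also have "\<dots> = (G.act 2 [(1, b)] \<cdot> G.phi 1 1) \<cdot> (t 1 \<boxtimes> t 1)" unfolding tens by simp
  also have "\<dots> = G.phi 1 1 \<cdot> (G.opr b \<cdot> (t 1 \<boxtimes> t 1))" unfolding G.phi_opr [symmetric] by simp
  finally show ?thesis
    by (rule F.T.iso_cancel_left [of "G.phi 1 1", rotated -1]) simp_all
qed

text \<open>The components at \<open>0\<close> and \<open>n + 1\<close> are determined by the constraints, so the component at \<open>1\<close> determines
the transformation.\<close>

lemma nat_trans_determined:
  assumes "monoidal_nat_trans PS_cat C F G t" "monoidal_nat_trans PS_cat C F G u" "t 1 = u 1"
  shows "t = u"
proof
  fix n
  note t = nat_transD [OF assms(1)] and u = nat_transD [OF assms(2)]
  note [simp] = t(1-3) u(1-3)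
  show "t n = u n"
  proof (induction n)
    case 0
    show ?case by (rule F.T.iso_cancel_right [of "phi0 F"]) (simp_all add: t(5) u(5))
  next
    case (Suc n)
    have "t (1 + n) \<cdot> F.phi 1 n = u (1 + n) \<cdot> F.phi 1 n"
      unfolding t(6) u(6) using Suc assms(3) by simp
    then show ?case using F.T.iso_cancel_right [of "F.phi 1 n" "t (Suc n)" "u (Suc n)"] by simp
  qed
qed

end

locale PS_functor_pair_morphism = PS_functor_pair +
  fixes f
  assumes f: "f \<in> Hom C (F.V 1) (G.V 1)"
    and f_opr_True: "(f \<boxtimes> f) \<cdot> F.opr True = G.opr True \<cdot> (f \<boxtimes> f)"
begin

lemma f_simps [simp]: "f \<in> Arr C" "Dom C f = F.V 1" "Cod C f = G.V 1"
  using f by (simp_all add: F.T.Hom_iff)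

text \<open>The only family with component \<open>f\<close> at \<open>1\<close> that is compatible with the unit constraints and with the
constraints for \<open>1 + n\<close>.\<close>

primrec extension :: "nat \<Rightarrow> 'b" where
  "extension 0 = phi0 G \<cdot> inv_arr C (phi0 F)"
| "extension (Suc n) = G.phi 1 n \<cdot> ((f \<boxtimes> extension n) \<cdot> inv_arr C (F.phi 1 n))"

lemma extension_Arr [simp]: "extension n \<in> Arr C" "Dom C (extension n) = F.V n" "Cod C (extension n) = G.V n"
  by (induction n) simp_all

lemma extension_unit: "extension 0 \<cdot> phi0 F = phi0 G"
  by simp

lemma extension_Suc: "extension (1 + n) \<cdot> F.phi 1 n = G.phi 1 n \<cdot> (f \<boxtimes> extension n)"
  by simp

declare extension.simps [simp del]

text \<open>Compatibility with the constraints for \<open>m + n\<close>, by induction on \<open>m\<close>. The base case is the left unit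
axiom, the step is the associativity axiom for \<open>1 + m + n\<close>; both equations are checked after
precomposition with a constraint isomorphism.\<close>

lemma extension_tens: "extension (m + n) \<cdot> F.phi m n = G.phi m n \<cdot> (extension m \<boxtimes> extension n)"
proof (induction m)
  case 0
  let ?i = "phi0 F \<boxtimes> Ide C (F.V n)"
  show ?case
  proof (rule F.T.iso_cancel_right [of ?i])
    have "(extension (0 + n) \<cdot> F.phi 0 n) \<cdot> ?i = extension n \<cdot> (F.phi 0 n \<cdot> ?i)" by simp
    also have "\<dots> = extension n \<cdot> lunit C (F.V n)" unfolding F.phi_lunit ..
    also have "\<dots> = lunit C (G.V n) \<cdot> (Ide C (unit_obj C) \<boxtimes> extension n)"
      using F.C.lunit_natural [of "extension n" "F.V n" "G.V n"] by (simp add: F.T.Hom_iff)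
    also have "\<dots> = G.phi 0 n \<cdot> ((phi0 G \<boxtimes> Ide C (G.V n)) \<cdot> (Ide C (unit_obj C) \<boxtimes> extension n))"
      unfolding G.phi_lunit [symmetric] by simp
    also have "\<dots> = (G.phi 0 n \<cdot> (extension 0 \<boxtimes> extension n)) \<cdot> ?i"
      by (simp add: F.C.interchange extension_unit)
    finally show "(extension (0 + n) \<cdot> F.phi 0 n) \<cdot> ?i = (G.phi 0 n \<cdot> (extension 0 \<boxtimes> extension n)) \<cdot> ?i" .
  qed simp_all
next
  case (Suc m)
  let ?i = "F.phi 1 m \<boxtimes> Ide C (F.V n)"
  let ?aF = "assoc C (F.V 1) (F.V m) (F.V n)" and ?aG = "assoc C (G.V 1) (G.V m) (G.V n)"
  have "extension (1 + m + n) \<cdot> F.phi (1 + m) n = G.phi (1 + m) n \<cdot> (extension (1 + m) \<boxtimes> extension n)"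
  proof (rule F.T.iso_cancel_right [of ?i])
    have "(extension (1 + m + n) \<cdot> F.phi (1 + m) n) \<cdot> ?i = extension (1 + m + n) \<cdot> (F.phi (1 + m) n \<cdot> ?i)" by simp
    also have "\<dots> = extension (1 + (m + n)) \<cdot> (F.phi 1 (m + n) \<cdot> ((Ide C (F.V 1) \<boxtimes> F.phi m n) \<cdot> ?aF))"
      unfolding F.phi_assoc [symmetric] by (simp only: add.assoc)
    also have "\<dots> = (extension (1 + (m + n)) \<cdot> F.phi 1 (m + n)) \<cdot> ((Ide C (F.V 1) \<boxtimes> F.phi m n) \<cdot> ?aF)" by simp
    also have "\<dots> = G.phi 1 (m + n) \<cdot> ((f \<boxtimes> (extension (m + n) \<cdot> F.phi m n)) \<cdot> ?aF)"
      unfolding extension_Suc by (simp add: F.C.interchange)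
    also have "\<dots> = G.phi 1 (m + n) \<cdot> ((Ide C (G.V 1) \<boxtimes> G.phi m n) \<cdot> ((f \<boxtimes> (extension m \<boxtimes> extension n)) \<cdot> ?aF))"
      unfolding Suc.IH by (simp add: F.C.interchange)
    also have "(f \<boxtimes> (extension m \<boxtimes> extension n)) \<cdot> ?aF = ?aG \<cdot> ((f \<boxtimes> extension m) \<boxtimes> extension n)"
      using F.C.assoc_nat [of f "extension m" "extension n"] by simp
    also have "G.phi 1 (m + n) \<cdot> ((Ide C (G.V 1) \<boxtimes> G.phi m n) \<cdot> (?aG \<cdot> ((f \<boxtimes> extension m) \<boxtimes> extension n)))
      = (G.phi 1 (m + n) \<cdot> ((Ide C (G.V 1) \<boxtimes> G.phi m n) \<cdot> ?aG)) \<cdot> ((f \<boxtimes> extension m) \<boxtimes> extension n)" by simp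
    also have "\<dots> = G.phi (1 + m) n \<cdot> ((G.phi 1 m \<cdot> (f \<boxtimes> extension m)) \<boxtimes> extension n)"
      unfolding G.phi_assoc by (simp add: F.C.interchange)
    also have "\<dots> = G.phi (1 + m) n \<cdot> ((extension (1 + m) \<boxtimes> extension n) \<cdot> ?i)"
      unfolding extension_Suc [symmetric] by (simp add: F.C.interchange)
    finally show "(extension (1 + m + n) \<cdot> F.phi (1 + m) n) \<cdot> ?i = (G.phi (1 + m) n \<cdot> (extension (1 + m) \<boxtimes> extension n)) \<cdot> ?i" by simp
  qed simp_all
  then show ?case by simp
qed

text \<open>The recursion defines \<open>extension 1\<close> through \<open>1 = 1 + 0\<close>; the right unit axiom identifies it with \<open>f\<close>.\<close>

lemma extension_1: "extension 1 = f"
proof (rule F.T.iso_cancel_right [of "runit C (F.V 1)"])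
  let ?i = "Ide C (F.V 1) \<boxtimes> phi0 F"
  have "extension 1 \<cdot> runit C (F.V 1) = (extension (1 + 0) \<cdot> F.phi 1 0) \<cdot> ?i"
    unfolding F.phi_runit [symmetric] by simp
  also have "\<dots> = G.phi 1 0 \<cdot> (f \<boxtimes> (extension 0 \<cdot> phi0 F))" unfolding extension_Suc by (simp add: F.C.interchange)
  also have "\<dots> = (G.phi 1 0 \<cdot> (Ide C (G.V 1) \<boxtimes> phi0 G)) \<cdot> (f \<boxtimes> Ide C (unit_obj C))"
    unfolding extension_unit by (simp add: F.C.interchange)
  also have "\<dots> = f \<cdot> runit C (F.V 1)"
    unfolding G.phi_runit using F.C.runit_natural [OF f] by simp
  finally show "extension 1 \<cdot> runit C (F.V 1) = f \<cdot> runit C (F.V 1)" .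
qed simp_all

lemma f_opr: "(f \<boxtimes> f) \<cdot> F.opr b = G.opr b \<cdot> (f \<boxtimes> f)"
proof (cases b)
  case False
  have "(f \<boxtimes> f) \<cdot> F.opr False = (G.opr False \<cdot> G.opr True) \<cdot> ((f \<boxtimes> f) \<cdot> F.opr False)"
    using G.opr_cancel [of False] by simp
  also have "\<dots> = G.opr False \<cdot> ((G.opr True \<cdot> (f \<boxtimes> f)) \<cdot> F.opr False)" by simp
  also have "\<dots> = (G.opr False \<cdot> (f \<boxtimes> f)) \<cdot> (F.opr True \<cdot> F.opr False)"
    unfolding f_opr_True [symmetric] by simp
  also have "\<dots> = G.opr False \<cdot> (f \<boxtimes> f)" using F.opr_cancel [of True] by simp
  finally show ?thesis using False by simp
qed (use f_opr_True in simp)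

definition natural_at :: "nat \<Rightarrow> braid_word \<Rightarrow> bool" where
  "natural_at n w \<longleftrightarrow> extension n \<cdot> F.act n w = G.act n w \<cdot> extension n"

lemma natural_at_Nil: "natural_at n []"
  by (simp add: natural_at_def)

lemma natural_at_append:
  assumes "natural_at n u" "natural_at n v" "u \<in> braid_words n" "v \<in> braid_words n"
  shows "natural_at n (u @ v)"
proof -
  have "extension n \<cdot> F.act n (u @ v) = (extension n \<cdot> F.act n u) \<cdot> F.act n v"
    using assms by (simp add: F.act_append)
  also have "\<dots> = G.act n u \<cdot> (extension n \<cdot> F.act n v)"
    unfolding assms(1) [unfolded natural_at_def] using assms by simp
  also have "\<dots> = G.act n (u @ v) \<cdot> extension n"
    unfolding assms(2) [unfolded natural_at_def] using assms by (simp add: G.act_append)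
  finally show ?thesis by (simp add: natural_at_def)
qed

lemma natural_at_tens:
  assumes u: "natural_at m u" "u \<in> braid_words m" and v: "natural_at n v" "v \<in> braid_words n"
  shows "natural_at (m + n) (u @ shift_word m v)"
proof -
  let ?w = "u @ shift_word m v"
  have w: "?w \<in> braid_words (m + n)" using u v by simp
  note [simp] = u(2) v(2) F.act_simps [OF w] G.act_simps [OF w]
  have "(extension (m + n) \<cdot> F.act (m + n) ?w) \<cdot> F.phi m n = extension (m + n) \<cdot> (F.act (m + n) ?w \<cdot> F.phi m n)"
    by simp
  also have "\<dots> = (extension (m + n) \<cdot> F.phi m n) \<cdot> (F.act m u \<boxtimes> F.act n v)"
    using F.phi_natural [OF u(2) v(2)] by simp
  also have "\<dots> = G.phi m n \<cdot> ((extension m \<cdot> F.act m u) \<boxtimes> (extension n \<cdot> F.act n v))"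
    unfolding extension_tens by (simp add: F.C.interchange)
  also have "\<dots> = (G.phi m n \<cdot> (G.act m u \<boxtimes> G.act n v)) \<cdot> (extension m \<boxtimes> extension n)"
    using u v by (simp add: natural_at_def F.C.interchange)
  also have "\<dots> = G.act (m + n) ?w \<cdot> (G.phi m n \<cdot> (extension m \<boxtimes> extension n))"
    unfolding G.phi_natural [OF u(2) v(2)] by simp
  also have "\<dots> = (G.act (m + n) ?w \<cdot> extension (m + n)) \<cdot> F.phi m n"
    unfolding extension_tens [symmetric] by simp
  finally show ?thesis
    unfolding natural_at_def by (rule F.T.iso_cancel_right [of "F.phi m n", rotated -1]) simp_all
qed

lemma natural_at_crossing: "natural_at 2 [(1, b)]"
proof -
  have tens: "extension 2 \<cdot> F.phi 1 1 = G.phi 1 1 \<cdot> (f \<boxtimes> f)" using extension_tens [of 1 1] extension_1 by simp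
  have "(extension 2 \<cdot> F.act 2 [(1, b)]) \<cdot> F.phi 1 1 = extension 2 \<cdot> (F.act 2 [(1, b)] \<cdot> F.phi 1 1)" by simp
  also have "\<dots> = (extension 2 \<cdot> F.phi 1 1) \<cdot> F.opr b" unfolding F.phi_opr [symmetric] by simp
  also have "\<dots> = G.phi 1 1 \<cdot> ((f \<boxtimes> f) \<cdot> F.opr b)" unfolding tens by simp
  also have "\<dots> = (G.phi 1 1 \<cdot> G.opr b) \<cdot> (f \<boxtimes> f)" unfolding f_opr by simp
  also have "\<dots> = G.act 2 [(1, b)] \<cdot> (G.phi 1 1 \<cdot> (f \<boxtimes> f))" unfolding G.phi_opr by simp
  also have "\<dots> = (G.act 2 [(1, b)] \<cdot> extension 2) \<cdot> F.phi 1 1" unfolding tens [symmetric] by simp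
  finally show ?thesis
    unfolding natural_at_def by (rule F.T.iso_cancel_right [of "F.phi 1 1", rotated -1]) simp_all
qed

text \<open>The letter \<open>\<sigma>\<^sub>i\<close> on \<open>n\<close> strands is a crossing with \<open>i - 1\<close> straight strands on its left and \<open>n - i - 1\<close> on
its right.\<close>

lemma natural_at_letter:
  assumes "1 \<le> i" "i < n" shows "natural_at n [(i, b)]"
proof -
  have "natural_at (2 + (n - i - 1)) ([(1, b)] @ shift_word 2 [])"
    by (intro natural_at_tens natural_at_crossing natural_at_Nil) simp_all
  then have "natural_at ((i - 1) + (2 + (n - i - 1))) ([] @ shift_word (i - 1) [(1, b)])"
    by (intro natural_at_tens natural_at_Nil) simp_all
  moreover have "(i - 1) + (2 + (n - i - 1)) = n" using assms by simp
  ultimately show ?thesis using assms by simp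
qed

lemma natural_at_word: "w \<in> braid_words n \<Longrightarrow> natural_at n w"
proof (induction w)
  case (Cons l w)
  then show ?case using natural_at_append [of n "[l]" w] natural_at_letter [of "fst l" n "snd l"] by simp
qed (rule natural_at_Nil)

lemma extension_monoidal: "monoidal_nat_trans PS_cat C F G extension"
  using nat_trans_iff [of extension] natural_at_word extension_tens extension_unit by (auto simp: natural_at_def)

end

lemma PS_functor_pair_intro:
  "\<lbrakk>monoidal_functor PS_cat C F; monoidal_functor PS_cat C G\<rbrakk> \<Longrightarrow> PS_functor_pair C F G"
  by (simp add: PS_functor_pair_def PS_monoidal_functor_def)

lemma Theta_tilde_omap:
  fixes C :: "('o, 'a) moncat"
  assumes "monoidal_functor PS_cat C F"
  shows "omap (Theta_tilde C) F = (omap F 1, PS_monoidal_functor.opr C F True)"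
  using assms monoidal_functor_comp_proj [of C F] Theta_obj_comp_proj [of C F]
  by (simp add: Theta_tilde_def comp_functor_def precomp_functor_def Theta_def PS_monoidal_functor_def)

lemma Theta_tilde_amap:
  fixes C :: "('o, 'a) moncat"
  assumes "(F, t, G) \<in> Arr (Tens PS_cat C)"
  shows "amap (Theta_tilde C) (F, t, G) = (omap (Theta_tilde C) F, t 1, omap (Theta_tilde C) G)"
proof -
  have FG: "monoidal_functor PS_cat C F" "monoidal_functor PS_cat C G" "monoidal_nat_trans PS_cat C F G t"
    using assms by simp_all
  have "monoidal_nat_trans braid_cat C (comp_monfun braid_cat C F proj) (comp_monfun braid_cat C G proj) t"
    by (rule PS_functor_pair.nat_trans_comp_proj [OF PS_functor_pair_intro [OF FG(1,2)] FG(3)])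
  moreover have "restrict t UNIV = t" by (simp add: restrict_def)
  ultimately show ?thesis
    using FG monoidal_functor_comp_proj [of C F] Theta_obj_comp_proj [of C F]
      monoidal_functor_comp_proj [of C G] Theta_obj_comp_proj [of C G]
    by (simp add: Theta_tilde_omap) (simp add: Theta_tilde_def comp_functor_def precomp_functor_def Theta_def PS_monoidal_functor_def)
qed

lemma Theta_tilde_functor:
  fixes C :: "('o, 'a) moncat"
  assumes "monoidal_category C"
  shows "cat_functor (Tens PS_cat C) (PSYB C) (Theta_tilde C)"
proof -
  interpret C: monoidal_category C by fact
  interpret T: category "Tens PS_cat C" by (intro category_Tens PSC.monoidal_category_S assms)
  interpret P: category "PSYB C" by (rule C.category_PSYB)
  show ?thesis
  proof
    fix F assume F: "F \<in> Obj (Tens PS_cat C)"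
    then interpret F: PS_monoidal_functor C F by (simp add: PS_monoidal_functor_def)
    show obj: "omap (Theta_tilde C) F \<in> Obj (PSYB C)"
      using F F.pseudosymmetric_opr by (simp add: Theta_tilde_omap)
    show "amap (Theta_tilde C) (Ide (Tens PS_cat C) F) = Ide (PSYB C) (omap (Theta_tilde C) F)"
      using F monoidal_nat_trans_Ide [of PS_cat C F] by (simp add: Theta_tilde_amap) (simp add: Theta_tilde_omap)
  next
    fix a F G assume a: "a \<in> Hom (Tens PS_cat C) F G"
    then obtain t where t: "a = (F, t, G)" "(F, t, G) \<in> Arr (Tens PS_cat C)" by (cases a) (auto simp: Hom_def)
    then interpret PS_functor_pair C F G by (simp add: PS_functor_pair_intro)
    have "monoidal_nat_trans PS_cat C F G t" using t by simp
    then show "amap (Theta_tilde C) a \<in> Hom (PSYB C) (omap (Theta_tilde C) F) (omap (Theta_tilde C) G)"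
      using t nat_trans_opr [of t True] nat_transD(1-3) [of t 1] F.pseudosymmetric_opr G.pseudosymmetric_opr
      by (simp add: Theta_tilde_amap P.Hom_iff) (simp add: Theta_tilde_omap C.Hom_iff)
  next
    fix a b F G H assume "a \<in> Hom (Tens PS_cat C) F G" "b \<in> Hom (Tens PS_cat C) G H"
    moreover from this have "b \<cdot>\<^bsub>Tens PS_cat C\<^esub> a \<in> Arr (Tens PS_cat C)" by (simp add: T.Hom_iff)
    ultimately show "amap (Theta_tilde C) (b \<cdot>\<^bsub>Tens PS_cat C\<^esub> a) = amap (Theta_tilde C) b \<cdot>\<^bsub>PSYB C\<^esub> amap (Theta_tilde C) a"
      by (cases a; cases b) (auto simp: Hom_def Theta_tilde_amap simp del: Tens_simps(2))
  next
    show "omap (Theta_tilde C) \<in> extensional (Obj (Tens PS_cat C))"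
      "amap (Theta_tilde C) \<in> extensional (Arr (Tens PS_cat C))"
      by (simp_all add: Theta_tilde_def comp_functor_def)
  qed
qed

lemma Theta_tilde_faithful:
  fixes C :: "('o, 'a) moncat"
  assumes "a \<in> Hom (Tens PS_cat C) F G" "b \<in> Hom (Tens PS_cat C) F G" "amap (Theta_tilde C) a = amap (Theta_tilde C) b"
  shows "a = b"
proof -
  from assms obtain t u where tu: "a = (F, t, G)" "b = (F, u, G)" "(F, t, G) \<in> Arr (Tens PS_cat C)" "(F, u, G) \<in> Arr (Tens PS_cat C)"
    by (cases a; cases b) (auto simp: Hom_def)
  then interpret PS_functor_pair C F G by (simp add: PS_functor_pair_intro)
  show ?thesis
    using assms(3) tu nat_trans_determined [of t u] by (simp add: Theta_tilde_amap)
qed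

lemma Theta_tilde_full:
  fixes C :: "('o, 'a) moncat"
  assumes FG: "F \<in> Obj (Tens PS_cat C)" "G \<in> Obj (Tens PS_cat C)"
    and h: "h \<in> Hom (PSYB C) (omap (Theta_tilde C) F) (omap (Theta_tilde C) G)"
  shows "\<exists>a\<in>Hom (Tens PS_cat C) F G. amap (Theta_tilde C) a = h"
proof -
  interpret PS_functor_pair C F G using FG by (simp add: PS_functor_pair_intro)
  obtain f where hf: "h = (omap (Theta_tilde C) F, f, omap (Theta_tilde C) G)" "h \<in> Arr (PSYB C)"
    using h by (cases h) (auto simp: Hom_def simp del: PSYB_simps(1,2))
  interpret PS_functor_pair_morphism C F G f
    by unfold_locales (use hf FG in \<open>simp_all add: Theta_tilde_omap\<close>)
  show ?thesis
    using FG extension_monoidal extension_1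
    by (intro bexI [of _ "(F, extension, G)"]) (simp_all add: Theta_tilde_amap hf Hom_def)
qed

section \<open>Automorphism groups and isomorphisms of pseudosymmetric operators\<close>

definition Aut :: "('o, 'a, 'e) cat_scheme \<Rightarrow> 'o \<Rightarrow> 'a monoid" where
  "Aut C X = \<lparr>carrier = {f \<in> Hom C X X. Defs.is_iso C f}, mult = Comp C, one = Ide C X\<rparr>"

context category begin

lemma Aut_simps [simp]:
  "f \<in> carrier (Aut C X) \<longleftrightarrow> f \<in> Arr C \<and> Dom C f = X \<and> Cod C f = X \<and> Defs.is_iso C f"
  "f \<otimes>\<^bsub>Aut C X\<^esub> g = f \<cdot> g" "\<one>\<^bsub>Aut C X\<^esub> = Ide C X"
  by (auto simp: Aut_def Hom_iff)

lemma group_Aut: assumes "X \<in> Obj C" shows "group (Aut C X)"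
proof (rule groupI)
  fix f assume "f \<in> carrier (Aut C X)"
  then show "\<exists>g\<in>carrier (Aut C X). g \<otimes>\<^bsub>Aut C X\<^esub> f = \<one>\<^bsub>Aut C X\<^esub>"
    by (intro bexI [of _ "inv_arr C f"]) simp_all
qed (use assms in simp_all)

lemma inv_Aut:
  assumes "f \<in> carrier (Aut C X)" shows "inv\<^bsub>Aut C X\<^esub> f = inv_arr C f"
proof -
  have "X \<in> Obj C" using assms Dom_Obj by auto
  then show ?thesis using assms by (intro group.inv_equality group_Aut) simp_all
qed

end

text \<open>The inverse of a morphism of operators that is invertible in \<open>C\<close> is compatible with the operators as well.\<close>

lemma (in monoidal_category) PSYB_isoI:
  assumes h: "(X, h, Y) \<in> Arr (PSYB C)" and iso: "Defs.is_iso C h"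
  shows "Defs.is_iso (PSYB C) (X, h, Y)"
proof -
  have [simp]: "h \<in> Arr C" "Dom C h = fst X" "Cod C h = fst Y" "fst X \<in> Obj C" "fst Y \<in> Obj C"
    using h by (auto simp: Hom_iff)
  have ps: "pseudosymmetric_yang_baxter C (fst X) (snd X)" "pseudosymmetric_yang_baxter C (fst Y) (snd Y)"
    using h by simp_all
  note [simp] = pseudosymmetric_Arr(1-3) [OF ps(1)] pseudosymmetric_Arr(1-3) [OF ps(2)] iso
  let ?g = "inv_arr C h"
  have comm: "(h \<boxtimes> h) \<cdot> snd X = snd Y \<cdot> (h \<boxtimes> h)" using h by simp
  have "(?g \<boxtimes> ?g) \<cdot> snd Y = (?g \<boxtimes> ?g) \<cdot> ((snd Y \<cdot> (h \<boxtimes> h)) \<cdot> (?g \<boxtimes> ?g))"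
    by (simp add: interchange)
  also have "\<dots> = ((?g \<boxtimes> ?g) \<cdot> (h \<boxtimes> h)) \<cdot> (snd X \<cdot> (?g \<boxtimes> ?g))"
    unfolding comm [symmetric] by simp
  also have "\<dots> = snd X \<cdot> (?g \<boxtimes> ?g)" by (simp add: interchange)
  finally have "(?g \<boxtimes> ?g) \<cdot> snd Y = snd X \<cdot> (?g \<boxtimes> ?g)" .
  then have "inverse_arrows (PSYB C) (X, h, Y) (Y, ?g, X)"
    using h ps by (auto simp: inverse_arrows_def Hom_def [of "PSYB C"] Hom_iff)
  then show ?thesis unfolding Defs.is_iso_def by blast
qed

section \<open>Essential surjectivity: tensor powers of a pseudosymmetric operator\<close>

locale pseudosymmetric_object = monoidal_category C
  for C :: "('o, 'a) moncat" (structure) +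
  fixes V :: 'o and \<sigma> :: 'a
  assumes V_Obj [simp]: "V \<in> Obj C" and pseudo: "pseudosymmetric_yang_baxter C V \<sigma>"
begin

abbreviation "I \<equiv> unit_obj C"
abbreviation "ide \<equiv> Ide C"
abbreviation "\<alpha> \<equiv> assoc C"

text \<open>Tensor powers bracketed to the right, ending in the unit object. With this choice one more strand on the
left is one more tensor factor \<open>V\<close>, so inductions on the strands on the left follow the recursion.\<close>

primrec pow :: "nat \<Rightarrow> 'o" where
  "pow 0 = I"
| "pow (Suc n) = V \<boxdot> pow n"

lemma pow_Obj [simp]: "pow n \<in> Obj C"
  by (induction n) simp_all

text \<open>The canonical isomorphism from \<open>V\<^sup>m \<otimes> V\<^sup>n\<close> to \<open>V\<^bsup>m+n\<^esup>\<close>, which concatenates powers.\<close>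

primrec con :: "nat \<Rightarrow> nat \<Rightarrow> 'a" where
  "con 0 n = lunit C (pow n)"
| "con (Suc m) n = (ide V \<boxtimes> con m n) \<cdot> \<alpha> V (pow m) (pow n)"

lemma con_simps [simp]:
  "con m n \<in> Arr C" "Dom C (con m n) = pow m \<boxdot> pow n" "Cod C (con m n) = pow (m + n)" "is_iso C (con m n)"
  by (induction m) simp_all

text \<open>Induction on \<open>x\<close>: the base case is \<open>lunit_tens\<close>, the step is the pentagon for \<open>V\<close> and the three powers.\<close>

lemma con_assoc: "con x (y + z) \<cdot> ((ide (pow x) \<boxtimes> con y z) \<cdot> \<alpha> (pow x) (pow y) (pow z))
  = con (x + y) z \<cdot> (con x y \<boxtimes> ide (pow z))"
proof (induction x)
  case 0
  have "con 0 (y + z) \<cdot> ((ide (pow 0) \<boxtimes> con y z) \<cdot> \<alpha> (pow 0) (pow y) (pow z))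
      = (lunit C (pow (y + z)) \<cdot> (ide I \<boxtimes> con y z)) \<cdot> \<alpha> I (pow y) (pow z)" by simp
  also have "\<dots> = con y z \<cdot> (lunit C (pow y \<boxdot> pow z) \<cdot> \<alpha> I (pow y) (pow z))"
    using lunit_natural [of "con y z" "pow y \<boxdot> pow z" "pow (y + z)"] by (simp add: Hom_iff)
  also have "\<dots> = con (0 + y) z \<cdot> (con 0 y \<boxtimes> ide (pow z))" by (simp add: lunit_tens)
  finally show ?case .
next
  case (Suc x)
  let ?v = "ide V"
  have nat1: "\<alpha> V (pow x) (pow (y + z)) \<cdot> (ide (V \<boxdot> pow x) \<boxtimes> con y z)
      = (?v \<boxtimes> (ide (pow x) \<boxtimes> con y z)) \<cdot> \<alpha> V (pow x) (pow y \<boxdot> pow z)"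
    using assoc_nat [of ?v "ide (pow x)" "con y z"] by simp
  have nat2: "(?v \<boxtimes> (con x y \<boxtimes> ide (pow z))) \<cdot> \<alpha> V (pow x \<boxdot> pow y) (pow z)
      = \<alpha> V (pow (x + y)) (pow z) \<cdot> ((?v \<boxtimes> con x y) \<boxtimes> ide (pow z))"
    using assoc_nat [of ?v "con x y" "ide (pow z)"] by simp
  have "con (Suc x) (y + z) \<cdot> ((ide (pow (Suc x)) \<boxtimes> con y z) \<cdot> \<alpha> (pow (Suc x)) (pow y) (pow z))
      = (?v \<boxtimes> con x (y + z)) \<cdot> ((\<alpha> V (pow x) (pow (y + z)) \<cdot> (ide (V \<boxdot> pow x) \<boxtimes> con y z)) \<cdot> \<alpha> (V \<boxdot> pow x) (pow y) (pow z))"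
    by simp
  also have "\<dots> = (?v \<boxtimes> (con x (y + z) \<cdot> (ide (pow x) \<boxtimes> con y z)))
      \<cdot> (\<alpha> V (pow x) (pow y \<boxdot> pow z) \<cdot> \<alpha> (V \<boxdot> pow x) (pow y) (pow z))"
    unfolding nat1 by (simp add: interchange)
  also have "\<dots> = (?v \<boxtimes> (con x (y + z) \<cdot> (ide (pow x) \<boxtimes> con y z)))
      \<cdot> ((?v \<boxtimes> \<alpha> (pow x) (pow y) (pow z)) \<cdot> (\<alpha> V (pow x \<boxdot> pow y) (pow z) \<cdot> (\<alpha> V (pow x) (pow y) \<boxtimes> ide (pow z))))"
    by (simp add: pentagon)
  also have "\<dots> = (?v \<boxtimes> (con x (y + z) \<cdot> ((ide (pow x) \<boxtimes> con y z) \<cdot> \<alpha> (pow x) (pow y) (pow z))))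
      \<cdot> (\<alpha> V (pow x \<boxdot> pow y) (pow z) \<cdot> (\<alpha> V (pow x) (pow y) \<boxtimes> ide (pow z)))"
    by (simp add: interchange)
  also have "\<dots> = (?v \<boxtimes> con (x + y) z) \<cdot> (((?v \<boxtimes> (con x y \<boxtimes> ide (pow z))) \<cdot> \<alpha> V (pow x \<boxdot> pow y) (pow z))
      \<cdot> (\<alpha> V (pow x) (pow y) \<boxtimes> ide (pow z)))"
    unfolding Suc.IH by (simp add: interchange add.assoc)
  also have "\<dots> = con (Suc x + y) z \<cdot> (con (Suc x) y \<boxtimes> ide (pow z))"
    unfolding nat2 by (simp add: interchange)
  finally show ?case .
qed

lemma con_0_right: "con x 0 = runit C (pow x)"
  by (induction x) (simp_all add: lunit_unit_eq_runit_unit runit_tens)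

text \<open>The operator and its inverse, indexed like the letters of a braid word.\<close>

definition sig :: "bool \<Rightarrow> 'a" where
  "sig b = (if b then \<sigma> else inv_arr C \<sigma>)"

lemma sig_simps [simp]: "sig b \<in> Arr C" "Dom C (sig b) = V \<boxdot> V" "Cod C (sig b) = V \<boxdot> V" "is_iso C (sig b)"
  "inv_arr C (sig b) = sig (\<not> b)"
  using pseudosymmetric_Arr [OF pseudo] by (simp_all add: sig_def)

text \<open>The operator \<open>sig b\<close> acting on two adjacent factors, with \<open>i\<close> factors on the left of them and \<open>k\<close> on the
right. Counting on both sides, instead of giving the total number of strands, avoids subtraction.\<close>

primrec gen :: "bool \<Rightarrow> nat \<Rightarrow> nat \<Rightarrow> 'a" where
  "gen b 0 k = \<alpha> V V (pow k) \<cdot> ((sig b \<boxtimes> ide (pow k)) \<cdot> inv_arr C (\<alpha> V V (pow k)))"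
| "gen b (Suc i) k = ide V \<boxtimes> gen b i k"

lemma gen_simps [simp]:
  "gen b i k \<in> Arr C" "Dom C (gen b i k) = pow (Suc (Suc (i + k)))" "Cod C (gen b i k) = pow (Suc (Suc (i + k)))"
  by (induction i) simp_all

lemma gen_inverse [simp]: "is_iso C (gen b i k)" "inv_arr C (gen b i k) = gen (\<not> b) i k"
  by (induction i) simp_all

text \<open>With no factor on the left, the second operator acts only on the factor that the first one leaves alone;
further factors on the left are tensored onto both sides.\<close>

lemma gen_far: "gen b i (Suc (Suc (d + k))) \<cdot> gen c (Suc (Suc (i + d))) k = gen c (Suc (Suc (i + d))) k \<cdot> gen b i (Suc (Suc (d + k)))"
proof (induction i)
  case 0
  let ?W = "pow (Suc (Suc (d + k)))" and ?g = "gen c d k"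
  have nat: "(ide V \<boxtimes> (ide V \<boxtimes> ?g)) \<cdot> \<alpha> V V ?W = \<alpha> V V ?W \<cdot> (ide (V \<boxdot> V) \<boxtimes> ?g)"
    using assoc_nat [of "ide V" "ide V" ?g] by simp
  have nat': "inv_arr C (\<alpha> V V ?W) \<cdot> (ide V \<boxtimes> (ide V \<boxtimes> ?g)) = (ide (V \<boxdot> V) \<boxtimes> ?g) \<cdot> inv_arr C (\<alpha> V V ?W)"
  proof (rule iso_cancel_right [of "\<alpha> V V ?W"])
    show "(inv_arr C (\<alpha> V V ?W) \<cdot> (ide V \<boxtimes> (ide V \<boxtimes> ?g))) \<cdot> \<alpha> V V ?W
        = ((ide (V \<boxdot> V) \<boxtimes> ?g) \<cdot> inv_arr C (\<alpha> V V ?W)) \<cdot> \<alpha> V V ?W"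
      using nat by (simp del: pow.simps)
  qed (simp_all add: pow.simps(2) [symmetric] del: pow.simps)
  have "gen b 0 (Suc (Suc (d + k))) \<cdot> gen c (Suc (Suc (0 + d))) k
      = \<alpha> V V ?W \<cdot> ((sig b \<boxtimes> ide ?W) \<cdot> (inv_arr C (\<alpha> V V ?W) \<cdot> (ide V \<boxtimes> (ide V \<boxtimes> ?g))))"
    by simp
  also have "\<dots> = \<alpha> V V ?W \<cdot> ((sig b \<boxtimes> ?g) \<cdot> inv_arr C (\<alpha> V V ?W))"
    unfolding nat' by (simp add: interchange)
  also have "\<dots> = (\<alpha> V V ?W \<cdot> (ide (V \<boxdot> V) \<boxtimes> ?g)) \<cdot> ((sig b \<boxtimes> ide ?W) \<cdot> inv_arr C (\<alpha> V V ?W))"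
    by (simp add: interchange)
  also have "\<dots> = gen c (Suc (Suc (0 + d))) k \<cdot> gen b 0 (Suc (Suc (d + k)))"
    unfolding nat [symmetric] by simp
  finally show ?case .
next
  case (Suc i)
  then show ?case by (simp add: interchange add.assoc del: gen.simps(1))
qed

text \<open>A relation for the operators on \<open>(V \<otimes> V) \<otimes> V\<close> is tensored with the factors on the right and transported
to the bracketing of \<open>pow\<close>; factors on the left are then added by induction.\<close>

lemma gen_relation:
  assumes rel: "yang_baxter_relation C V (sig b) (sig c) (sig d)"
  shows "gen b i (Suc k) \<cdot> gen c (Suc i) k \<cdot> gen d i (Suc k) = gen d (Suc i) k \<cdot> gen c i (Suc k) \<cdot> gen b (Suc i) k"
proof (induction i)
  case 0
  let ?W = "pow k" and ?v = "ide V" and ?w = "ide (pow k)"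
  let ?a = "\<alpha> V V V \<boxtimes> ?w"
  \<comment> \<open>\<open>?t\<close> and \<open>?t'\<close> rebracket the first three factors in the way of \<open>pow\<close>\<close>
  let ?t = "\<alpha> V V (V \<boxdot> ?W) \<cdot> \<alpha> (V \<boxdot> V) V ?W" and ?t' = "(?v \<boxtimes> \<alpha> V V ?W) \<cdot> \<alpha> V (V \<boxdot> V) ?W"
  have tri: "?t' \<cdot> ?a = ?t" using pentagon [of V V V ?W] by simp
  have P: "gen b 0 (Suc k) \<cdot> ?t = ?t \<cdot> ((sig b \<boxtimes> ?v) \<boxtimes> ?w)" for b
    using assoc_nat [of "sig b" ?v ?w] by simp
  have Q: "gen b (Suc 0) k \<cdot> ?t' = ?t' \<cdot> ((?v \<boxtimes> sig b) \<boxtimes> ?w)" for b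
  proof -
    have "gen b (Suc 0) k \<cdot> ?t' = (?v \<boxtimes> \<alpha> V V ?W) \<cdot> ((?v \<boxtimes> (sig b \<boxtimes> ?w)) \<cdot> \<alpha> V (V \<boxdot> V) ?W)"
      by (simp add: interchange)
    also have "\<dots> = ?t' \<cdot> ((?v \<boxtimes> sig b) \<boxtimes> ?w)" using assoc_nat [of ?v "sig b" ?w] by simp
    finally show ?thesis .
  qed
  have "?a \<cdot> ((sig b \<boxtimes> ?v) \<boxtimes> ?w) \<cdot> inv_arr C ?a \<cdot> ((?v \<boxtimes> sig c) \<boxtimes> ?w) \<cdot> ?a \<cdot> ((sig d \<boxtimes> ?v) \<boxtimes> ?w)
      = ((?v \<boxtimes> sig d) \<boxtimes> ?w) \<cdot> ?a \<cdot> ((sig c \<boxtimes> ?v) \<boxtimes> ?w) \<cdot> inv_arr C ?a \<cdot> ((?v \<boxtimes> sig b) \<boxtimes> ?w) \<cdot> ?a"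
    using rel by (simp add: interchange yang_baxter_relation_def Let_def)
  then show ?case
    by (subst (asm) braid_word_transport [of ?t ?t' _ "pow (Suc (Suc (Suc k)))", OF _ _ _ _ _ _ _ _ _ tri _ _ _ _ _ _ _ _ _ _ _ _ P P P Q Q Q])
      (simp_all add: Hom_iff del: gen.simps)
next
  case (Suc i)
  then show ?case by (simp add: interchange del: gen.simps(1))
qed

lemma sig_relation: "yang_baxter_relation C V (sig True) (sig b) (sig True)"
  using pseudo by (cases b) (simp_all add: pseudosymmetric_yang_baxter_iff sig_def)

lemma con_gen_right: "con m (Suc (Suc (i + k))) \<cdot> (ide (pow m) \<boxtimes> gen b i k) = gen b (m + i) k \<cdot> con m (Suc (Suc (i + k)))"
proof (induction m)
  case 0
  show ?case
    using lunit_natural [of "gen b i k" "pow (Suc (Suc (i + k)))" "pow (Suc (Suc (i + k)))"]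
    by (simp add: Hom_iff)
next
  case (Suc m)
  let ?n = "Suc (Suc (i + k))"
  have "con (Suc m) ?n \<cdot> (ide (pow (Suc m)) \<boxtimes> gen b i k)
      = (ide V \<boxtimes> con m ?n) \<cdot> (\<alpha> V (pow m) (pow ?n) \<cdot> ((ide V \<boxtimes> ide (pow m)) \<boxtimes> gen b i k))" by simp
  also have "\<dots> = (ide V \<boxtimes> con m ?n) \<cdot> ((ide V \<boxtimes> (ide (pow m) \<boxtimes> gen b i k)) \<cdot> \<alpha> V (pow m) (pow ?n))"
    using assoc_nat [of "ide V" "ide (pow m)" "gen b i k"] by simp
  also have "\<dots> = (ide V \<boxtimes> (con m ?n \<cdot> (ide (pow m) \<boxtimes> gen b i k))) \<cdot> \<alpha> V (pow m) (pow ?n)"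
    by (simp add: interchange)
  also have "\<dots> = gen b (Suc m + i) k \<cdot> con (Suc m) ?n"
    unfolding Suc.IH by (simp add: interchange add.assoc)
  finally show ?case .
qed

text \<open>In the base case the pentagon and naturality of the associator turn \<open>con\<close> on \<open>V\<^bsup>k+2\<^esup> \<otimes> V\<^sup>n\<close> into \<open>con\<close> on
\<open>V\<^sup>k \<otimes> V\<^sup>n\<close>, with the first two factors bracketed together.\<close>

lemma con_gen_left: "con (Suc (Suc (i + k))) n \<cdot> (gen b i k \<boxtimes> ide (pow n)) = gen b i (k + n) \<cdot> con (Suc (Suc (i + k))) n"
proof (induction i)
  case 0
  let ?k = "pow k" and ?n = "pow n" and ?v = "ide V" and ?c = "con k n"
  let ?a = "\<alpha> V V ?k" and ?a' = "\<alpha> V V (pow (k + n))" and ?b = "\<alpha> (V \<boxdot> V) ?k ?n"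
  have con: "con (Suc (Suc k)) n \<cdot> (?a \<boxtimes> ide ?n) = ?a' \<cdot> ((ide (V \<boxdot> V) \<boxtimes> ?c) \<cdot> ?b)"
  proof -
    have "con (Suc (Suc k)) n \<cdot> (?a \<boxtimes> ide ?n)
        = (?v \<boxtimes> (?v \<boxtimes> ?c)) \<cdot> ((?v \<boxtimes> \<alpha> V ?k ?n) \<cdot> (\<alpha> V (V \<boxdot> ?k) ?n \<cdot> (?a \<boxtimes> ide ?n)))"
      by (simp add: interchange)
    also have "\<dots> = ((?v \<boxtimes> (?v \<boxtimes> ?c)) \<cdot> \<alpha> V V (?k \<boxdot> ?n)) \<cdot> ?b" by (simp add: pentagon)
    also have "\<dots> = (?a' \<cdot> ((?v \<boxtimes> ?v) \<boxtimes> ?c)) \<cdot> ?b" using assoc_nat [of ?v ?v ?c] by simp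
    finally show ?thesis by simp
  qed
  have nat: "?b \<cdot> ((sig b \<boxtimes> ide ?k) \<boxtimes> ide ?n) = (sig b \<boxtimes> ide (?k \<boxdot> ?n)) \<cdot> ?b"
    using assoc_nat [of "sig b" "ide ?k" "ide ?n"] by simp
  have "(con (Suc (Suc k)) n \<cdot> (gen b 0 k \<boxtimes> ide ?n)) \<cdot> (?a \<boxtimes> ide ?n)
      = (con (Suc (Suc k)) n \<cdot> (?a \<boxtimes> ide ?n)) \<cdot> ((sig b \<boxtimes> ide ?k) \<boxtimes> ide ?n)"
    by (simp add: interchange)
  also have "\<dots> = ?a' \<cdot> ((ide (V \<boxdot> V) \<boxtimes> ?c) \<cdot> (?b \<cdot> ((sig b \<boxtimes> ide ?k) \<boxtimes> ide ?n)))"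
    unfolding con by simp
  also have "\<dots> = (?a' \<cdot> ((sig b \<boxtimes> ide (pow (k + n))) \<cdot> inv_arr C ?a')) \<cdot> (?a' \<cdot> ((ide (V \<boxdot> V) \<boxtimes> ?c) \<cdot> ?b))"
    unfolding nat by (simp add: interchange)
  also have "\<dots> = (gen b 0 (k + n) \<cdot> con (Suc (Suc k)) n) \<cdot> (?a \<boxtimes> ide ?n)"
    unfolding con [symmetric] by simp
  finally have "con (Suc (Suc k)) n \<cdot> (gen b 0 k \<boxtimes> ide ?n) = gen b 0 (k + n) \<cdot> con (Suc (Suc k)) n"
    by (rule iso_cancel_right [of "?a \<boxtimes> ide ?n", rotated -1]) simp_all
  then show ?case by simp
next
  case (Suc i)
  let ?m = "Suc (Suc (i + k))"
  have "con (Suc ?m) n \<cdot> (gen b (Suc i) k \<boxtimes> ide (pow n))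
      = (ide V \<boxtimes> con ?m n) \<cdot> (\<alpha> V (pow ?m) (pow n) \<cdot> ((ide V \<boxtimes> gen b i k) \<boxtimes> ide (pow n)))" by simp
  also have "\<dots> = (ide V \<boxtimes> con ?m n) \<cdot> ((ide V \<boxtimes> (gen b i k \<boxtimes> ide (pow n))) \<cdot> \<alpha> V (pow ?m) (pow n))"
    using assoc_nat [of "ide V" "gen b i k" "ide (pow n)"] by simp
  also have "\<dots> = (ide V \<boxtimes> (con ?m n \<cdot> (gen b i k \<boxtimes> ide (pow n)))) \<cdot> \<alpha> V (pow ?m) (pow n)"
    by (simp add: interchange)
  also have "\<dots> = gen b (Suc i) (k + n) \<cdot> con (Suc ?m) n"
    unfolding Suc.IH by (simp add: interchange add.assoc)
  finally show ?case by simp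
qed

text \<open>The action of the generator \<open>\<sigma>\<^sub>i\<close> on the \<open>n\<close>-th power, in the numbering of Artin's presentation.\<close>

definition crossing :: "nat \<Rightarrow> nat \<Rightarrow> 'a" where
  "crossing n i = gen True (i - 1) (n - i - 1)"

lemma gen_strands [simp]:
  assumes "1 \<le> i" "i < n"
  shows "Dom C (gen b (i - 1) (n - i - 1)) = pow n" "Cod C (gen b (i - 1) (n - i - 1)) = pow n"
proof -
  have "Suc (Suc ((i - 1) + (n - i - 1))) = n" using assms by simp
  then show "Dom C (gen b (i - 1) (n - i - 1)) = pow n" "Cod C (gen b (i - 1) (n - i - 1)) = pow n"
    by (simp_all only: gen_simps)
qed

lemma crossing_Aut: "\<lbrakk>1 \<le> i; i < n\<rbrakk> \<Longrightarrow> crossing n i \<in> carrier (Aut C (pow n))"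
  using gen_strands [of i n] by (simp add: crossing_def)

lemma inv_crossing: "\<lbrakk>1 \<le> i; i < n\<rbrakk> \<Longrightarrow> inv\<^bsub>Aut C (pow n)\<^esub> crossing n i = gen False (i - 1) (n - i - 1)"
  using crossing_Aut [of i n] by (simp add: inv_Aut) (simp add: crossing_def)

lemma crossing_representation: "pseudosymmetric_representation (Aut C (pow n)) n (crossing n)"
proof -
  interpret group "Aut C (pow n)" by (rule group_Aut) simp
  show ?thesis
  proof
    fix i assume i: "i \<in> {1..<n}"
    then show "crossing n i \<in> carrier (Aut C (pow n))" using crossing_Aut by simp
    show "crossing n i \<otimes>\<^bsub>Aut C (pow n)\<^esub> crossing n j = crossing n j \<otimes>\<^bsub>Aut C (pow n)\<^esub> crossing n i"
      if "j \<in> {1..<n}" "i + 2 \<le> j" for j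
    proof -
      define d k where "d = j - i - 2" and "k = n - j - 1"
      have "n - i - 1 = Suc (Suc (d + k))" "j - 1 = Suc (Suc (i - 1 + d))" "n - j - 1 = k"
        using i that by (auto simp: d_def k_def)
      then show ?thesis using gen_far [of True "i - 1" d k True] by (simp only: crossing_def Aut_simps)
    qed
    assume i': "i + 1 \<in> {1..<n}"
    define k where "k = n - i - 2"
    have k: "n - i - 1 = Suc k" "i + 1 - 1 = Suc (i - 1)" "n - (i + 1) - 1 = k"
      using i i' by (auto simp: k_def)
    show "crossing n i \<otimes>\<^bsub>Aut C (pow n)\<^esub> crossing n (i + 1) \<otimes>\<^bsub>Aut C (pow n)\<^esub> crossing n i
        = crossing n (i + 1) \<otimes>\<^bsub>Aut C (pow n)\<^esub> crossing n i \<otimes>\<^bsub>Aut C (pow n)\<^esub> crossing n (i + 1)"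
      using gen_relation [OF sig_relation [of True], of "i - 1" k] unfolding crossing_def k Aut_simps by (simp del: gen.simps)
    have "inv\<^bsub>Aut C (pow n)\<^esub> crossing n (i + 1) = gen False (Suc (i - 1)) k"
      "inv\<^bsub>Aut C (pow n)\<^esub> crossing n i = gen False (i - 1) (Suc k)"
      using inv_crossing [of "i + 1" n] inv_crossing [of i n] i i' unfolding k by (simp_all del: gen.simps)
    then show "crossing n i \<otimes>\<^bsub>Aut C (pow n)\<^esub> inv\<^bsub>Aut C (pow n)\<^esub> crossing n (i + 1) \<otimes>\<^bsub>Aut C (pow n)\<^esub> crossing n i
        = crossing n (i + 1) \<otimes>\<^bsub>Aut C (pow n)\<^esub> inv\<^bsub>Aut C (pow n)\<^esub> crossing n i \<otimes>\<^bsub>Aut C (pow n)\<^esub> crossing n (i + 1)"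
      using gen_relation [OF sig_relation [of False], of "i - 1" k] unfolding crossing_def k Aut_simps by (simp del: gen.simps)
  qed
qed

interpretation R: pseudosymmetric_representation "Aut C (pow n)" n "crossing n" for n
  by (rule crossing_representation)

definition val :: "nat \<Rightarrow> braid_word \<Rightarrow> 'a" where
  "val n w = R.word_val n w"

lemma letter_val_eq: "fst l \<in> {1..<n} \<Longrightarrow> R.letter_val n l = gen (snd l) (fst l - 1) (n - fst l - 1)"
  using inv_crossing [of "fst l" n] by (cases l; cases "snd l") (simp_all add: crossing_def)

lemma val_Nil: "val n [] = ide (pow n)"
  by (simp add: val_def)

lemma val_Cons: "fst l \<in> {1..<n} \<Longrightarrow> val n (l # w) = gen (snd l) (fst l - 1) (n - fst l - 1) \<cdot> val n w"
  by (simp add: val_def letter_val_eq)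

lemma val_simps [simp]:
  "w \<in> braid_words n \<Longrightarrow> val n w \<in> Arr C" "w \<in> braid_words n \<Longrightarrow> Dom C (val n w) = pow n"
  "w \<in> braid_words n \<Longrightarrow> Cod C (val n w) = pow n"
  using R.word_val_closed [of w n] by (simp_all add: val_def)

lemma val_append: "\<lbrakk>u \<in> braid_words n; v \<in> braid_words n\<rbrakk> \<Longrightarrow> val n (u @ v) = val n u \<cdot> val n v"
  by (simp add: val_def)

lemma val_cong:
  assumes "PS_word n u = PS_word n v" "u \<in> braid_words n" "v \<in> braid_words n"
  shows "val n u = val n v"
  using R.PS_universal [of n] assms unfolding val_def by metis

lemma con_val_left: "u \<in> braid_words m \<Longrightarrow> con m n \<cdot> (val m u \<boxtimes> ide (pow n)) = val (m + n) u \<cdot> con m n"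
proof (induction u)
  case (Cons l u)
  define i k b where "i = fst l - 1" and "k = m - fst l - 1" and "b = snd l"
  have m: "m = Suc (Suc (i + k))" and l: "m + n - fst l - 1 = k + n"
    using Cons.prems by (auto simp: i_def k_def)
  have u: "u \<in> braid_words m" "u \<in> braid_words (m + n)" using Cons.prems braid_words_mono [of u m "m + n"] by simp_all
  have g: "Dom C (gen b i k) = pow m" "Cod C (gen b i k) = pow m" by (simp_all only: gen_simps m)
  have g': "Dom C (gen b i (k + n)) = pow (m + n)" "Cod C (gen b i (k + n)) = pow (m + n)"
    by (simp_all only: gen_simps m add_Suc add.assoc)
  have IH: "con m n \<cdot> (val m u \<boxtimes> ide (pow n)) = val (m + n) u \<cdot> con m n" using Cons.IH u by simp
  have left: "con m n \<cdot> (gen b i k \<boxtimes> ide (pow n)) = gen b i (k + n) \<cdot> con m n"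
    unfolding m by (rule con_gen_left)
  have val: "val m (l # u) = gen b i k \<cdot> val m u" "val (m + n) (l # u) = gen b i (k + n) \<cdot> val (m + n) u"
    using val_Cons [of l m u] val_Cons [of l "m + n" u] Cons.prems l by (simp_all add: i_def k_def b_def)
  note [simp del] = gen_simps(2,3)
  note [simp] = g g' u
  have "con m n \<cdot> (val m (l # u) \<boxtimes> ide (pow n)) = (con m n \<cdot> (gen b i k \<boxtimes> ide (pow n))) \<cdot> (val m u \<boxtimes> ide (pow n))"
    unfolding val by (simp add: interchange)
  also have "\<dots> = gen b i (k + n) \<cdot> (con m n \<cdot> (val m u \<boxtimes> ide (pow n)))" unfolding left by simp
  also have "\<dots> = val (m + n) (l # u) \<cdot> con m n" unfolding IH val by simp
  finally show ?case .
qed (simp add: val_Nil)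

lemma con_val_right: "v \<in> braid_words n \<Longrightarrow> con m n \<cdot> (ide (pow m) \<boxtimes> val n v) = val (m + n) (shift_word m v) \<cdot> con m n"
proof (induction v)
  case (Cons l v)
  define i k b where "i = fst l - 1" and "k = n - fst l - 1" and "b = snd l"
  have n: "n = Suc (Suc (i + k))" and l: "m + n - (m + fst l) - 1 = k" "m + fst l - 1 = m + i"
    using Cons.prems by (auto simp: i_def k_def)
  have v: "v \<in> braid_words n" "shift_word m v \<in> braid_words (m + n)" using Cons.prems shift_word_words by simp_all
  have shift: "shift_word m (l # v) = (m + fst l, b) # shift_word m v" by (cases l) (simp add: b_def)
  have g: "Dom C (gen b i k) = pow n" "Cod C (gen b i k) = pow n" by (simp_all only: gen_simps n)
  have g': "Dom C (gen b (m + i) k) = pow (m + n)" "Cod C (gen b (m + i) k) = pow (m + n)"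
    by (simp_all only: gen_simps n add_Suc_right add.assoc)
  have IH: "con m n \<cdot> (ide (pow m) \<boxtimes> val n v) = val (m + n) (shift_word m v) \<cdot> con m n" using Cons.IH v by simp
  have right: "con m n \<cdot> (ide (pow m) \<boxtimes> gen b i k) = gen b (m + i) k \<cdot> con m n"
    unfolding n by (rule con_gen_right)
  have val: "val n (l # v) = gen b i k \<cdot> val n v"
    "val (m + n) (shift_word m (l # v)) = gen b (m + i) k \<cdot> val (m + n) (shift_word m v)"
    using val_Cons [of l n v] val_Cons [of "(m + fst l, b)" "m + n" "shift_word m v"] Cons.prems l
    unfolding shift by (simp_all add: i_def k_def b_def)
  note [simp del] = gen_simps(2,3)
  note [simp] = g g' v
  have "con m n \<cdot> (ide (pow m) \<boxtimes> val n (l # v)) = (con m n \<cdot> (ide (pow m) \<boxtimes> gen b i k)) \<cdot> (ide (pow m) \<boxtimes> val n v)"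
    unfolding val by (simp add: interchange)
  also have "\<dots> = gen b (m + i) k \<cdot> (con m n \<cdot> (ide (pow m) \<boxtimes> val n v))" unfolding right by simp
  also have "\<dots> = val (m + n) (shift_word m (l # v)) \<cdot> con m n" unfolding IH val by simp
  finally show ?case .
qed (simp add: val_Nil)

lemma con_val:
  assumes [simp]: "u \<in> braid_words m" "v \<in> braid_words n"
  shows "con m n \<cdot> (val m u \<boxtimes> val n v) = val (m + n) (u @ shift_word m v) \<cdot> con m n"
proof -
  have [simp]: "u \<in> braid_words (m + n)" "shift_word m v \<in> braid_words (m + n)"
    using braid_words_mono [of u m "m + n"] shift_word_words by simp_all
  have "con m n \<cdot> (val m u \<boxtimes> val n v) = (con m n \<cdot> (val m u \<boxtimes> ide (pow n))) \<cdot> (ide (pow m) \<boxtimes> val n v)"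
    by (simp add: interchange)
  also have "\<dots> = val (m + n) u \<cdot> (con m n \<cdot> (ide (pow m) \<boxtimes> val n v))"
    by (simp add: con_val_left)
  also have "\<dots> = val (m + n) (u @ shift_word m v) \<cdot> con m n"
    by (simp add: con_val_right val_append)
  finally show ?thesis .
qed

text \<open>The action of an element of \<open>PS\<^sub>n\<close>, evaluated on an arbitrary word that represents it.\<close>

definition rho :: "nat \<Rightarrow> braid_word set set \<Rightarrow> 'a" where
  "rho n X = val n (SOME w. w \<in> braid_words n \<and> PS_word n w = X)"

lemma rho_PS_word:
  assumes "w \<in> braid_words n" shows "rho n (PS_word n w) = val n w"
proof -
  have "(SOME v. v \<in> braid_words n \<and> PS_word n v = PS_word n w) \<in> braid_words n
      \<and> PS_word n (SOME v. v \<in> braid_words n \<and> PS_word n v = PS_word n w) = PS_word n w"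
    by (rule someI [of _ w]) (use assms in simp)
  then show ?thesis unfolding rho_def using assms by (intro val_cong) simp_all
qed

definition power_functor :: "(nat, nat \<times> braid_word set set, 'o, 'a) monfun_data" where
  "power_functor = \<lparr>omap = pow, amap = (\<lambda>(n, X)\<in>Arr PS_cat. rho n X), phi0 = ide I, phi2 = (\<lambda>(m, n). con m n)\<rparr>"

lemma power_functor_simps [simp]:
  "omap power_functor = pow" "phi0 power_functor = ide I" "phi2 power_functor (m, n) = con m n"
  "w \<in> braid_words n \<Longrightarrow> amap power_functor (n, PS_word n w) = val n w"
  by (simp_all add: power_functor_def rho_PS_word)

lemma power_functor_monoidal: "monoidal_functor PS_cat C power_functor"
proof -
  have is_functor: "cat_functor PS_cat C power_functor"
  proof
    show "amap power_functor \<in> extensional (Arr PS_cat)" by (simp add: power_functor_def)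
    show "amap power_functor f \<in> Hom C (omap power_functor x) (omap power_functor y)" if "f \<in> Hom PS_cat x y" for f x y
      using that by (auto simp: PSC.Hom_S Hom_iff split: if_splits)
    show "amap power_functor (g \<cdot>\<^bsub>PS_cat\<^esub> f) = amap power_functor g \<cdot> amap power_functor f"
      if "f \<in> Hom PS_cat x y" "g \<in> Hom PS_cat y z" for f g x y z
      using that by (auto simp: PSC.Hom_S val_append split: if_splits)
  qed (simp_all add: val_Nil)
  show ?thesis
  proof (intro monoidal_functor.intro is_functor PSC.monoidal_category_S monoidal_functor_axioms.intro)
    show "monoidal_category C" ..
    show "phi2 power_functor (x', y') \<cdot> (amap power_functor f \<boxtimes> amap power_functor g) = amap power_functor (f \<boxtimes>\<^bsub>PS_cat\<^esub> g) \<cdot> phi2 power_functor (x, y)"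
      if "f \<in> Hom PS_cat x x'" "g \<in> Hom PS_cat y y'" for f g x x' y y'
      using that by (auto simp: PSC.Hom_S con_val split: if_splits)
    show "phi2 power_functor (x, y \<boxdot>\<^bsub>PS_cat\<^esub> z) \<cdot> (ide (omap power_functor x) \<boxtimes> phi2 power_functor (y, z)) \<cdot> \<alpha> (omap power_functor x) (omap power_functor y) (omap power_functor z)
        = amap power_functor (assoc PS_cat x y z) \<cdot> phi2 power_functor (x \<boxdot>\<^bsub>PS_cat\<^esub> y, z) \<cdot> (phi2 power_functor (x, y) \<boxtimes> ide (omap power_functor z))" for x y z
      using con_assoc [of x y z] by (simp add: val_Nil add.assoc)
    show "lunit C (omap power_functor x) = amap power_functor (lunit PS_cat x) \<cdot> phi2 power_functor (unit_obj PS_cat, x) \<cdot> (phi0 power_functor \<boxtimes> ide (omap power_functor x))" for x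
      by (simp add: val_Nil)
    show "runit C (omap power_functor x) = amap power_functor (runit PS_cat x) \<cdot> phi2 power_functor (x, unit_obj PS_cat) \<cdot> (ide (omap power_functor x) \<boxtimes> phi0 power_functor)" for x
      by (simp add: val_Nil con_0_right)
  qed (simp_all add: Hom_iff)
qed

sublocale PF: PS_monoidal_functor C power_functor
  by (simp add: PS_monoidal_functor_def power_functor_monoidal)

text \<open>The functor sends \<open>1\<close> to \<open>V \<otimes> I\<close> rather than to \<open>V\<close>. The right unit constraint is an isomorphism between
the two that respects the operators: by the triangle, \<open>con 1 1\<close> is \<open>runit V \<otimes> id\<close>, and \<open>runit_tens\<close>
moves \<open>runit V\<close> past the associator in the definition of the crossing.\<close>

lemma runit_opr:
  "(runit C V \<boxtimes> runit C V) \<cdot> PF.opr True = \<sigma> \<cdot> (runit C V \<boxtimes> runit C V)"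
proof -
  have [simp]: "\<sigma> \<in> Arr C" "Dom C \<sigma> = V \<boxdot> V" "Cod C \<sigma> = V \<boxdot> V"
    using pseudosymmetric_Arr [OF pseudo] by simp_all
  let ?r = "runit C V" and ?a = "\<alpha> V V I"
  have con: "con 1 1 = ?r \<boxtimes> ide (V \<boxdot> I)" using triangle [of V "V \<boxdot> I"] by simp
  have [simp]: "pow 2 = V \<boxdot> (V \<boxdot> I)" by (simp only: numeral_2_eq_2 pow.simps)
  have act: "PF.act 2 [(1, True)] = ?a \<cdot> ((\<sigma> \<boxtimes> ide I) \<cdot> inv_arr C ?a)"
    using val_Cons [of "(1, True)" 2 "[]"] by (simp add: PF.act_def val_Nil sig_def)
  have opr: "PF.opr True = inv_arr C (con 1 1) \<cdot> (PF.act 2 [(1, True)] \<cdot> con 1 1)" by (simp add: PF.opr_def)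
  have "(?r \<boxtimes> ?r) \<cdot> PF.opr True = (((ide V \<boxtimes> ?r) \<cdot> ?a) \<cdot> ((\<sigma> \<boxtimes> ide I) \<cdot> inv_arr C ?a)) \<cdot> con 1 1"
    unfolding opr act con by (simp add: interchange)
  also have "\<dots> = ((runit C (V \<boxdot> V) \<cdot> (\<sigma> \<boxtimes> ide I)) \<cdot> inv_arr C ?a) \<cdot> con 1 1"
    unfolding runit_tens [OF V_Obj V_Obj] by (simp add: con)
  also have "runit C (V \<boxdot> V) \<cdot> (\<sigma> \<boxtimes> ide I) = \<sigma> \<cdot> runit C (V \<boxdot> V)"
    using runit_natural [of \<sigma> "V \<boxdot> V" "V \<boxdot> V"] by (simp add: Hom_iff)
  also have "(\<sigma> \<cdot> runit C (V \<boxdot> V)) \<cdot> inv_arr C ?a = \<sigma> \<cdot> (ide V \<boxtimes> ?r)"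
    unfolding runit_tens [OF V_Obj V_Obj, symmetric] by simp
  also have "(\<sigma> \<cdot> (ide V \<boxtimes> ?r)) \<cdot> con 1 1 = \<sigma> \<cdot> (?r \<boxtimes> ?r)"
    unfolding con by (simp add: interchange)
  finally show ?thesis .
qed

lemma Theta_tilde_hits:
  "\<exists>F\<in>Obj (Tens PS_cat C). \<exists>e\<in>Hom (PSYB C) (omap (Theta_tilde C) F) (V, \<sigma>). Defs.is_iso (PSYB C) e"
proof (intro bexI)
  let ?e = "((pow 1, PF.opr True), runit C V, (V, \<sigma>))"
  have "?e \<in> Arr (PSYB C)"
    using PF.pseudosymmetric_opr pseudo runit_opr by (simp add: Hom_iff)
  then show "?e \<in> Hom (PSYB C) (omap (Theta_tilde C) power_functor) (V, \<sigma>)" "Defs.is_iso (PSYB C) ?e"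
    using power_functor_monoidal PSYB_isoI by (simp_all add: Theta_tilde_omap Hom_def)
  show "power_functor \<in> Obj (Tens PS_cat C)" using power_functor_monoidal by simp
qed

end

section \<open>The equivalence\<close>

theorem theorem5p4:
  fixes C :: "('o, 'a) moncat"
  assumes "monoidal_category C"
  shows "equivalence_of_categories (Tens PS_cat C) (PSYB C) (Theta_tilde C)"
proof (rule equivalence_of_fully_faithful)
  show "cat_functor (Tens PS_cat C) (PSYB C) (Theta_tilde C)"
    by (rule Theta_tilde_functor [OF assms])
  show "a = b" if "a \<in> Hom (Tens PS_cat C) F G" "b \<in> Hom (Tens PS_cat C) F G"
    "amap (Theta_tilde C) a = amap (Theta_tilde C) b" for a b F G
    using that by (rule Theta_tilde_faithful)
  show "\<exists>a\<in>Hom (Tens PS_cat C) F G. amap (Theta_tilde C) a = h"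
    if "F \<in> Obj (Tens PS_cat C)" "G \<in> Obj (Tens PS_cat C)"
      "h \<in> Hom (PSYB C) (omap (Theta_tilde C) F) (omap (Theta_tilde C) G)" for F G h
    using that by (rule Theta_tilde_full)
  show "\<exists>F\<in>Obj (Tens PS_cat C). \<exists>e\<in>Hom (PSYB C) (omap (Theta_tilde C) F) X. Defs.is_iso (PSYB C) e"
    if X: "X \<in> Obj (PSYB C)" for X
  proof -
    interpret pseudosymmetric_object C "fst X" "snd X"
      using X assms by (simp add: pseudosymmetric_object_def pseudosymmetric_object_axioms_def)
    show ?thesis using Theta_tilde_hits by simp
  qed
qed

end
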